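(* Let $(Z_n)_{n\ge 0}$ be the additive martingale of the branching random walk at the complex parameter $\lambda$, $Z_n=\sum_{|u|=n}L(u)$. Suppose that there is an $\alpha\in(1,2)$ such that $$\mathbb{E}\Big[\sum_{|u|=1}|L(u)|^{\alpha}\Big]=1\quad\text{and}\quad \mathbb{E}\Big[\sum_{|u|=1}|L(u)|^{\alpha}\log(|L(u)|)\Big]\le 0,$$ and that, for this $\alpha$, $$\mathbb{E}\big[|Z_1|^{\alpha}\log_+^{2+\epsilon}(|Z_1|)\big]<\infty\quad\text{for some }\epsilon>0.$$ Then $(Z_n)_{n\ge 0}$ converges almost surely and in $L^p$ for every $p<\alpha$ to a non-degenerate limit $Z$.
   Context: Let $d\in\mathbb{N}=\{1,2,\ldots\}$ and $\mathbb{N}_0=\mathbb{N}\cup\{0\}$. Let $\mathcal{Z}=\sum_{j=1}^{N}\delta_{X_j}$ be a point process on $\mathbb{R}^d$ with $N=\mathcal{Z}(\mathbb{R}^d)\in\mathbb{N}_0\cup\{\infty\}$ and intensity measure $\mu$. The process is supercritical: $\mu(\mathbb{R}^d)=\mathbb{E}[N]>1$. Let $\mathcal{I}=\bigcup_{n\ge0}\mathbb{N}^n$ be the set of finite tuples of positive integers, with empty tuple $\varnothing$ and concatenation $uv$. Let $(\mathcal{Z}(u))_{u\in\mathcal{I}}$ be i.i.d. copies of $\mathcal{Z}$ on a probability space $(\Omega,\mathcal{A},\mathbb{P})$, $\mathcal{Z}(u)=\sum_{i=1}^{N(u)}\delta_{X_i(u)}$. Generations are $\mathcal{G}_0=\{\varnothing\}$,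 $\mathcal{G}_{n+1}=\{uj: u\in\mathcal{G}_n,\ j\in\mathbb{N},\ 1\le j\le N(u)\}$; $|u|=n$ means $u\in\mathcal{G}_n$. The position of $u=u_1\ldots u_n\in\mathcal{G}_n$ is $S(u)=X_{u_1}(\varnothing)+\ldots+X_{u_n}(u_1\ldots u_{n-1})$, and $S(\varnothing)=0$. For $\lambda=\theta+\mathrm{i}\eta\in\mathbb{C}^d$ with $\theta,\eta\in\mathbb{R}^d$, put $m(\lambda)=\int e^{-\lambda x}\,\mu(dx)$, where $\lambda x=\sum_k\lambda_kx_k$, whenever this converges, i.e. for $\lambda\in\mathcal{D}=\{\theta\in\mathbb{R}^d:m(\theta)<\infty\}+\mathrm{i}\mathbb{R}^d$. It is assumed that the interior of $\mathcal{D}$ is non-empty. Fix $\lambda\in\mathcal{D}$ with $m(\lambda)\ne0$ and put $L(u)=m(\lambda)^{-n}e^{-\lambda S(u)}$ for $u\in\mathcal{G}_n$ (and $L(u)=0$ for $u\in\mathcal I$ in no generation), and $Z_n=\sum_{|u|=n}L(u)$, $n\in\mathbb{N}_0$. Then $(Z_n)_{n\ge0}$ is a complex martingale with respect to $\mathcal{F}_n=\sigma(\mathcal{Z}(u):u\in\mathbb{N}^k\text{ for some }k<n)$ ($\mathcal{F}_0$ trivial), with $\mathbb{E}[Z_1]=1$. It is assumed that $\mathbb{P}(Z_1=1)<1$. Conventions: $\log_+ x=\max(\log x,0)$, with $\log_+0=0$; $L^p$ is considered for $p>0$; non-degenerate means not almost surely constant. *)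

theory Defs
  imports "HOL-Probability.Probability"
begin

text \<open>
  A point process $\sum_{j=1}^{N} \delta_{X_j}$ on $\mathbb{R}^d$ is given by its number of
  points \<open>N\<close> and an enumeration \<open>X j\<close>, \<open>1 \<le> j \<le> N\<close>, of its points; values \<open>X j\<close> with
  \<open>j > N\<close> are irrelevant.
\<close>

(* The image of counting measure under j |-> X_j is the sum of the unit masses at the X_j. *)
definition point_process ::
    "('a \<Rightarrow> enat) \<Rightarrow> (nat \<Rightarrow> 'a \<Rightarrow> real ^ 'd) \<Rightarrow> 'a \<Rightarrow> (real ^ 'd) measure" where
  "point_process N X \<omega> =
     distr (count_space {j. 1 \<le> j \<and> enat j \<le> N \<omega>}) borel (\<lambda>j. X j \<omega>)"

(* The enumerated points as one random element; the irrelevant values are masked by 0. *)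
definition enumerated_points ::
    "('a \<Rightarrow> enat) \<Rightarrow> (nat \<Rightarrow> 'a \<Rightarrow> real ^ 'd) \<Rightarrow> 'a \<Rightarrow> enat \<times> (nat \<Rightarrow> real ^ 'd)" where
  "enumerated_points N X \<omega> =
     (N \<omega>, \<lambda>j\<in>{1..}. if enat j \<le> N \<omega> then X j \<omega> else 0)"

definition enumeration_space :: "(enat \<times> (nat \<Rightarrow> real ^ 'd)) measure" where
  "enumeration_space = count_space UNIV \<Otimes>\<^sub>M (\<Pi>\<^sub>M j\<in>{1..}. borel)"

(* The law of the random measure, on the sigma-algebra generated by the evaluations at Borel sets. *)
definition point_process_law ::
    "'a measure \<Rightarrow> ('a \<Rightarrow> enat) \<Rightarrow> (nat \<Rightarrow> 'a \<Rightarrow> real ^ 'd) \<Rightarrow> ((real ^ 'd) set \<Rightarrow> ennreal) measure" where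
  "point_process_law M N X =
     distr M (\<Pi>\<^sub>M B\<in>sets borel. borel)
       (\<lambda>\<omega>. \<lambda>B\<in>sets borel. emeasure (point_process N X \<omega>) B)"

definition intensity ::
    "'a measure \<Rightarrow> ('a \<Rightarrow> enat) \<Rightarrow> (nat \<Rightarrow> 'a \<Rightarrow> real ^ 'd) \<Rightarrow> (real ^ 'd) measure" where
  "intensity M N X =
     measure_of UNIV (sets borel) (\<lambda>B. \<integral>\<^sup>+\<omega>. emeasure (point_process N X \<omega>) B \<partial>M)"

definition cpairing :: "complex ^ 'd \<Rightarrow> real ^ 'd \<Rightarrow> complex" where
  "cpairing l x = (\<Sum>k\<in>UNIV. l $ k * complex_of_real (x $ k))"

definition laplace :: "(real ^ 'd) measure \<Rightarrow> complex ^ 'd \<Rightarrow> complex" where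
  "laplace \<mu> l = (\<integral>x. exp (- cpairing l x) \<partial>\<mu>)"

definition laplace_domain :: "(real ^ 'd) measure \<Rightarrow> (complex ^ 'd) set" where
  "laplace_domain \<mu> =
     {(\<chi> k. Complex (\<theta> $ k) (\<eta> $ k)) | \<theta> \<eta>. (\<integral>\<^sup>+x. ennreal (exp (- (\<theta> \<bullet> x))) \<partial>\<mu>) < \<infinity>}"

text \<open>
  The processes indexed by the tuples of positive integers are i.i.d. copies of the reference
  process \<open>(N0, X0)\<close>: they have the same law as random measures, and they are independent
  together with the enumerations of their points. Independence of the random measures alone would
  allow the enumeration at one node to depend on the processes at other nodes; the positions would
  then depend on that choice and the additive sums would not form a martingale.
\<close>

locale branching_random_walk =
  prob_space M + reference: prob_space M0
  for M :: "'a measure" and M0 :: "'b measure" +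
  fixes N :: "nat list \<Rightarrow> 'a \<Rightarrow> enat"
    and X :: "nat list \<Rightarrow> nat \<Rightarrow> 'a \<Rightarrow> real ^ 'd"
    and N0 :: "'b \<Rightarrow> enat"
    and X0 :: "nat \<Rightarrow> 'b \<Rightarrow> real ^ 'd"
  assumes reference_measurable: "enumerated_points N0 X0 \<in> M0 \<rightarrow>\<^sub>M enumeration_space"
    and independent:
      "indep_vars (\<lambda>_. enumeration_space) (\<lambda>u. enumerated_points (N u) (X u)) (lists {1..})"
    and identically_distributed:
      "\<And>u. u \<in> lists {1..} \<Longrightarrow> point_process_law M (N u) (X u) = point_process_law M0 N0 X0"

primrec generation :: "(nat list \<Rightarrow> 'a \<Rightarrow> enat) \<Rightarrow> 'a \<Rightarrow> nat \<Rightarrow> nat list set" where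
  "generation N \<omega> 0 = {[]}"
| "generation N \<omega> (Suc n) =
     {u @ [j] | u j. u \<in> generation N \<omega> n \<and> 1 \<le> j \<and> enat j \<le> N u \<omega>}"

definition position :: "(nat list \<Rightarrow> nat \<Rightarrow> 'a \<Rightarrow> real ^ 'd) \<Rightarrow> nat list \<Rightarrow> 'a \<Rightarrow> real ^ 'd" where
  "position X u \<omega> = (\<Sum>k<length u. X (take k u) (u ! k) \<omega>)"

definition weight ::
    "(real ^ 'd) measure \<Rightarrow> (nat list \<Rightarrow> 'a \<Rightarrow> enat) \<Rightarrow> (nat list \<Rightarrow> nat \<Rightarrow> 'a \<Rightarrow> real ^ 'd) \<Rightarrow>
     complex ^ 'd \<Rightarrow> nat list \<Rightarrow> 'a \<Rightarrow> complex" where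
  "weight \<mu> N X l u \<omega> =
     (if u \<in> generation N \<omega> (length u)
      then inverse (laplace \<mu> l ^ length u) * exp (- cpairing l (position X u \<omega>))
      else 0)"

(* Generations may be infinite. The sum converges absolutely almost surely if l is in the Laplace
   domain of the intensity; elsewhere infsum is 0. *)
definition additive_martingale ::
    "(real ^ 'd) measure \<Rightarrow> (nat list \<Rightarrow> 'a \<Rightarrow> enat) \<Rightarrow> (nat list \<Rightarrow> nat \<Rightarrow> 'a \<Rightarrow> real ^ 'd) \<Rightarrow>
     complex ^ 'd \<Rightarrow> nat \<Rightarrow> 'a \<Rightarrow> complex" where
  "additive_martingale \<mu> N X l n \<omega> = (\<Sum>\<^sub>\<infinity>u\<in>generation N \<omega> n. weight \<mu> N X l u \<omega>)"

definition log_plus :: "real \<Rightarrow> real" where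
  "log_plus x = (if x = 0 then 0 else max (ln x) 0)"

definition in_Lp :: "'a measure \<Rightarrow> real \<Rightarrow> ('a \<Rightarrow> complex) \<Rightarrow> bool" where
  "in_Lp M p f \<longleftrightarrow>
     f \<in> borel_measurable M \<and> (\<integral>\<^sup>+\<omega>. ennreal (norm (f \<omega>) powr p) \<partial>M) < \<infinity>"

definition converges_in_Lp ::
    "'a measure \<Rightarrow> real \<Rightarrow> (nat \<Rightarrow> 'a \<Rightarrow> complex) \<Rightarrow> ('a \<Rightarrow> complex) \<Rightarrow> bool" where
  "converges_in_Lp M p f g \<longleftrightarrow>
     (\<forall>n. in_Lp M p (f n)) \<and> in_Lp M p g \<and>
     (\<lambda>n. \<integral>\<^sup>+\<omega>. ennreal (norm (f n \<omega> - g \<omega>) powr p) \<partial>M) \<longlonglongrightarrow> 0"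

end

theory Submission
  imports Defs
begin

text \<open>
  Write \<open>L(u)\<close> for the weight of a node and \<open>D(u)\<close> for its excess, the sum of the relative weights
  of its children minus one. Then \<open>Z_(n+1) - Z_n\<close> is the sum of \<open>L(u) D(u)\<close> over generation \<open>n\<close>, where
  \<open>D(u)\<close> is centred and independent of the weights of all nodes up to that generation. The heart of
  the proof is the tail estimate \<open>P(sup |Z_n - 1| > t) = O(t powr -\<alpha>)\<close> (\<open>level_sum_tail\<close>). It gives a
  common integrable bound for \<open>|Z_n - 1| powr p\<close>, \<open>p < \<alpha>\<close>, so that almost sure convergence implies
  convergence in \<open>L^p\<close>.

  For the tail estimate, kill every line of descent whose weight rises above \<open>t\<close>. Since the \<open>\<alpha>\<close>-th
  powers of the weights in a generation have expected sum one, some weight exceeds \<open>t\<close> with probability at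
  most \<open>t powr -\<alpha>\<close> (\<open>first_crossing_bound\<close>); otherwise \<open>Z_n - 1\<close> agrees with the transform in which
  \<open>L(u)\<close> is replaced by the truncated weight \<open>T(u)\<close>. Second moments are not available for \<open>D(u)\<close>. A
  Huber function, quadratic near zero and linear at infinity, serves in their place: at scale \<open>t\<close>
  its expectation is at most twice the sum over \<open>u\<close> of \<open>E min ((|T(u) D(u)| / t)^2, |T(u) D(u)| / t)\<close>
  (\<open>huber_transform\<close>), and because stopping a transform yields a transform the same sum controls
  the supremum (\<open>maximal_inequality\<close>). The vanishing of its tails gives almost sure convergence.

  To bound the sum, tilt the weights by their \<open>\<alpha>\<close>-th powers. By the many-to-one formula the logarithms
  of the weights along a line of descent become a random walk \<open>S\<close>, and the sum is at most
  \<open>t powr -\<alpha>\<close> times the expectation of \<open>|D| powr \<alpha>\<close> times a Green function of \<open>S\<close> killed above \<open>ln t\<close>,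
  integrated over the points within distance about \<open>log_plus |D|\<close> of the barrier
  (\<open>truncated_sum_bound\<close>). Splitting each path at its first maximum factorises this Green function
  into the expected number of strict records, and the expected number of times at which a path
  that has stayed below its starting point is close to it. Both are bounded on each interval of a
  suitable fixed length by a disjointness argument, which gives a bound of order
  \<open>(1 + log_plus |D|)^2\<close>, uniformly in \<open>t\<close> (\<open>green_bound\<close>). Its expectation against \<open>|D| powr \<alpha>\<close> is finite by
  the moment condition on \<open>Z_1\<close>.

  The limit is not constant since testing the martingale property against bounded functions of the
  first generation would otherwise force \<open>Z_1 = 1\<close> (\<open>limit_sum_nondegenerate\<close>).

  All this takes place on the canonical product space of the families of offspring weights, where
  independence means that a coordinate can be redrawn (\<open>nn_integral_PiM_resample\<close>). The branching random
  walk is mapped to this space in the last part: independence of the nodes gives the product law, and the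
  equality in law of the point processes gives equal intensities and equally distributed excesses.
\<close>

section \<open>Redrawing a coordinate of a product measure\<close>

lemma measurable_fun_upd_UNIV:
  "(\<lambda>(e, w). w(i := e)) \<in> Q i \<Otimes>\<^sub>M PiM UNIV Q \<rightarrow>\<^sub>M PiM UNIV Q"
proof (rule measurable_PiM_single')
  show "(\<lambda>p. (case p of (e, w) \<Rightarrow> w(i := e)) j) \<in> Q i \<Otimes>\<^sub>M PiM UNIV Q \<rightarrow>\<^sub>M Q j" for j
    by (cases "j = i") (simp_all add: case_prod_beta)
qed (auto simp: space_pair_measure space_PiM PiE_iff)

text \<open>
  Redrawing one coordinate independently does not change the law of the family. Below,
  independence on the tree is always used in this form: a quantity is
  independent of the coordinate \<open>i\<close> when it is unchanged by the update \<open>w(i := e)\<close>.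
\<close>
lemma nn_integral_PiM_resample:
  assumes Q: "\<And>i. prob_space (Q i)" and f: "f \<in> borel_measurable (PiM UNIV Q)"
  shows "(\<integral>\<^sup>+w. f w \<partial>PiM UNIV Q) = (\<integral>\<^sup>+w. (\<integral>\<^sup>+e. f (w(i := e)) \<partial>Q i) \<partial>PiM UNIV Q)"
proof -
  interpret P: prob_space "PiM UNIV Q" by (rule prob_space_PiM) (rule Q)
  interpret Qi: prob_space "Q i" by (rule Q)
  interpret PP: pair_sigma_finite "Q i" "PiM UNIV Q" ..
  have eq: "distr (Q i \<Otimes>\<^sub>M PiM UNIV Q) (PiM UNIV Q) (\<lambda>(e, w). w(i := e)) = PiM UNIV Q"
    using distr_pair_PiM_eq_PiM[of UNIV Q i] Q by simp
  have mf: "(\<lambda>p. f ((snd p)(i := fst p))) \<in> borel_measurable (Q i \<Otimes>\<^sub>M PiM UNIV Q)"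
    using measurable_compose[OF measurable_fun_upd_UNIV f, of i] by (simp add: case_prod_beta)
  have "(\<integral>\<^sup>+w. f w \<partial>PiM UNIV Q) = (\<integral>\<^sup>+p. f ((snd p)(i := fst p)) \<partial>(Q i \<Otimes>\<^sub>M PiM UNIV Q))"
    by (subst eq[symmetric], subst nn_integral_distr[OF measurable_fun_upd_UNIV])
       (use f in \<open>simp_all add: case_prod_beta\<close>)
  also have "\<dots> = (\<integral>\<^sup>+w. (\<integral>\<^sup>+e. f (w(i := e)) \<partial>Q i) \<partial>PiM UNIV Q)"
    using PP.nn_integral_snd[of "\<lambda>p. f ((snd p)(i := fst p))"] mf by (simp add: case_prod_beta)
  finally show ?thesis .
qed

lemma nn_integral_PiM_resample_mult:
  assumes Q: "\<And>i. prob_space (Q i)" and f: "f \<in> borel_measurable (PiM UNIV Q)"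
    and indep: "\<And>w e. w \<in> space (PiM UNIV Q) \<Longrightarrow> e \<in> space (Q i) \<Longrightarrow> f (w(i := e)) = f w"
    and g: "g \<in> borel_measurable (Q i)"
  shows "(\<integral>\<^sup>+w. f w * g (w i) \<partial>PiM UNIV Q) = (\<integral>\<^sup>+w. f w \<partial>PiM UNIV Q) * (\<integral>\<^sup>+e. g e \<partial>Q i)"
proof -
  have m: "(\<lambda>w. f w * g (w i)) \<in> borel_measurable (PiM UNIV Q)"
    using f measurable_compose[OF measurable_component_singleton[of i UNIV Q] g] by simp
  have "(\<integral>\<^sup>+w. f w * g (w i) \<partial>PiM UNIV Q)
      = (\<integral>\<^sup>+w. (\<integral>\<^sup>+e. f w * g e \<partial>Q i) \<partial>PiM UNIV Q)"
    unfolding nn_integral_PiM_resample[OF Q m, of i]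
    by (intro nn_integral_cong) (auto simp: indep intro!: nn_integral_cong)
  then show ?thesis
    using f g by (simp add: nn_integral_cmult nn_integral_multc)
qed

lemma nn_integral_PiM_shift:
  assumes "prob_space \<nu>" and f: "f \<in> borel_measurable (PiM (UNIV :: nat set) (\<lambda>_. \<nu>))"
  shows "(\<integral>\<^sup>+w. f (\<lambda>i. w (i + k)) \<partial>PiM UNIV (\<lambda>_. \<nu>)) = (\<integral>\<^sup>+w. f w \<partial>PiM (UNIV :: nat set) (\<lambda>_. \<nu>))"
proof -
  have eq: "distr (PiM UNIV (\<lambda>_. \<nu>)) (PiM (UNIV::nat set) (\<lambda>_. \<nu>)) (\<lambda>w i. w (i + k)) = PiM (UNIV :: nat set) (\<lambda>_. \<nu>)"
    using distr_PiM_reindex[of UNIV "\<lambda>_. \<nu>" "\<lambda>i. i + k" UNIV] assms(1)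
    by (simp add: inj_on_def restrict_UNIV)
  have m: "(\<lambda>w i. w (i + k)) \<in> PiM (UNIV::nat set) (\<lambda>_. \<nu>) \<rightarrow>\<^sub>M PiM (UNIV::nat set) (\<lambda>_. \<nu>)"
    by (rule measurable_PiM_single') (auto simp: space_PiM PiE_iff)
  show ?thesis
    by (subst (2) eq[symmetric], subst nn_integral_distr[OF m]) (use f in simp_all)
qed

section \<open>Random walks and their records\<close>

definition walk :: "(nat \<Rightarrow> real) \<Rightarrow> nat \<Rightarrow> real" where
  "walk x n = (\<Sum>i<n. x i)"

lemma walk_0 [simp]: "walk x 0 = 0" and walk_Suc: "walk x (Suc n) = walk x n + x n"
  by (simp_all add: walk_def)

lemma walk_add: "walk x (m + n) = walk x m + walk (\<lambda>i. x (i + m)) n"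
  by (induction n) (simp_all add: walk_Suc add.commute)

lemma walk_upd: "n \<le> k \<Longrightarrow> walk (x(k := e)) n = walk x n"
  unfolding walk_def by (rule sum.cong) auto

locale random_walk = prob_space \<nu> for \<nu> :: "real measure" +
  assumes sets_eq [measurable_cong]: "sets \<nu> = sets borel"
begin

abbreviation S :: "(nat \<Rightarrow> real) measure" where "S \<equiv> PiM UNIV (\<lambda>_::nat. \<nu>)"

lemma prob_S: "prob_space S"
  by (rule prob_space_PiM) (rule prob_space_axioms)

lemma space_S [simp]: "space S = UNIV"
  using sets_eq_imp_space_eq[OF sets_eq] by (simp add: space_PiM)

lemma space_nu [simp]: "space \<nu> = UNIV"
  using sets_eq_imp_space_eq[OF sets_eq] by simp

lemma measurable_step [measurable]: "(\<lambda>x. x n) \<in> borel_measurable S"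
  using measurable_component_singleton[of n UNIV "\<lambda>_. \<nu>"] measurable_cong_sets[OF refl sets_eq]
  by auto

lemma measurable_walk [measurable]: "(\<lambda>x. walk x n) \<in> borel_measurable S"
  unfolding walk_def by measurable

definition strict_record :: "(nat \<Rightarrow> real) \<Rightarrow> nat \<Rightarrow> bool" where
  "strict_record x k \<longleftrightarrow> (\<forall>j<k. walk x j < walk x k)"

definition stays_below :: "(nat \<Rightarrow> real) \<Rightarrow> nat \<Rightarrow> bool" where
  "stays_below x m \<longleftrightarrow> (\<forall>i\<le>m. walk x i \<le> 0)"

lemma measurable_strict_record [measurable]: "Measurable.pred S (\<lambda>x. strict_record x k)"
  unfolding strict_record_def by measurable

lemma measurable_stays_below [measurable]: "Measurable.pred S (\<lambda>x. stays_below x k)"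
  unfolding stays_below_def by measurable

text \<open>
  If a strict record at time \<open>k\<close> lies in the interval and the next step exceeds its length \<open>a\<close>,
  then all later records lie above the interval. These events are therefore disjoint for
  different \<open>k\<close>, and each of them has the probability of the record times that of a step
  larger than \<open>a\<close>.
\<close>
lemma strict_records_in_interval:
  "(\<Sum>k. emeasure S {x. strict_record x k \<and> y < walk x k \<and> walk x k \<le> y + a}) * emeasure \<nu> {a<..} \<le> 1"
proof -
  interpret PS: prob_space S by (rule prob_S)
  define E where "E k = {x. strict_record x k \<and> y < walk x k \<and> walk x k \<le> y + a}" for k
  have E [measurable]: "E k \<in> sets S" for k
  proof -
    have "E k = {x \<in> space S. strict_record x k \<and> y < walk x k \<and> walk x k \<le> y + a}" by (auto simp: E_def)
    also have "\<dots> \<in> sets S" by measurable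
    finally show ?thesis .
  qed
  define B where "B k = {x. x \<in> E k \<and> a < x k}" for k
  have B [measurable]: "B k \<in> sets S" for k
  proof -
    have "B k = {x \<in> space S. x \<in> E k \<and> a < x k}" by (auto simp: B_def)
    also have "\<dots> \<in> sets S" by measurable
    finally show ?thesis .
  qed
  have later: "walk x i > y + a" if "x \<in> B k" "x \<in> E i" "k < i" for x k i
  proof -
    have s: "walk x (Suc k) > y + a"
      using that(1) by (auto simp: B_def E_def walk_Suc)
    show ?thesis
    proof (cases "i = Suc k")
      case False
      then have "Suc k < i" using that by simp
      then have "walk x (Suc k) < walk x i" using that by (auto simp: E_def strict_record_def)
      then show ?thesis using s by simp
    qed (use s in simp)
  qed
  have disj: "disjoint_family B"
  proof -
    have "False" if "x \<in> B k" "x \<in> B i" "k < i" for x k i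
      using later[of x k i] that by (auto simp: B_def E_def)
    then show ?thesis
      unfolding disjoint_family_on_def by (metis disjoint_iff linorder_neqE_nat)
  qed
  have eB: "emeasure S (B k) = emeasure S (E k) * emeasure \<nu> {a<..}" for k
  proof -
    have "emeasure S (B k) = (\<integral>\<^sup>+x. indicator (E k) x * indicator {a<..} (x k) \<partial>S)"
      unfolding nn_integral_indicator[OF B[of k], symmetric]
      by (intro nn_integral_cong) (auto simp: B_def split: split_indicator)
    also have "\<dots> = (\<integral>\<^sup>+x. indicator (E k) x \<partial>S) * (\<integral>\<^sup>+e. indicator {a<..} e \<partial>\<nu>)"
    proof (rule nn_integral_PiM_resample_mult[where i = k and Q = "\<lambda>_. \<nu>" and f = "indicator (E k)" and g = "indicator {a<..}"])
      show "indicator (E k) (x(k := e)) = (indicator (E k) x :: ennreal)" for x e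
        by (auto simp: E_def strict_record_def walk_upd indicator_def)
      show "prob_space \<nu>" by (rule prob_space_axioms)
      show "indicator (E k) \<in> borel_measurable S"
        by (simp add: borel_measurable_indicator)
      show "indicator {a<..} \<in> borel_measurable \<nu>"
        by (simp add: sets_eq borel_measurable_indicator)
    qed
    finally show ?thesis by simp
  qed
  have "(\<Sum>k. emeasure S (E k)) * emeasure \<nu> {a<..} = (\<Sum>k. emeasure S (B k))"
    by (simp add: eB ennreal_suminf_multc)
  also have "\<dots> = emeasure S (\<Union>k. B k)"
    by (rule suminf_emeasure) (use disj in auto)
  also have "\<dots> \<le> 1" by (rule PS.emeasure_le_1)
  finally show ?thesis unfolding E_def .
qed

text \<open>
  The dual of the bound for records. Place the path of length \<open>m\<close> in the last \<open>m\<close> steps of a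
  window of length \<open>n\<close> and require the step just before it to be smaller than \<open>-a\<close>. If this holds
  for \<open>m < m'\<close>, then the end point of the longer path lies more than \<open>a\<close> below that of the
  shorter one, so both cannot lie in an interval of length \<open>a\<close>; for fixed \<open>n\<close> the events are disjoint.
\<close>
lemma stays_below_in_interval:
  "(\<Sum>m. emeasure S {x. stays_below x m \<and> y < walk x m \<and> walk x m \<le> y + a}) * emeasure \<nu> {..<-a} \<le> 1"
proof -
  interpret PS: prob_space S by (rule prob_S)
  define E where "E m = {x. stays_below x m \<and> y < walk x m \<and> walk x m \<le> y + a}" for m
  have E [measurable]: "E k \<in> sets S" for k
  proof -
    have "E k = {x \<in> space S. stays_below x k \<and> y < walk x k \<and> walk x k \<le> y + a}" by (auto simp: E_def)
    also have "\<dots> \<in> sets S" by measurable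
    finally show ?thesis .
  qed
  have sh [measurable]: "(\<lambda>w i. w (i + k)) \<in> S \<rightarrow>\<^sub>M S" for k
    by (rule measurable_PiM_single') (auto simp: space_PiM PiE_iff)
  have fin: "(\<Sum>m<n. emeasure S (E m)) * emeasure \<nu> {..<-a} \<le> 1" for n
  proof -
    define B where "B m = {x. (\<lambda>i. x (i + (n - m))) \<in> E m \<and> x (n - m - 1) < -a}" for m
    have B [measurable]: "B m \<in> sets S" for m
    proof -
      have "B m = {x \<in> space S. (\<lambda>i. x (i + (n - m))) \<in> E m \<and> x (n - m - 1) < -a}" by (auto simp: B_def)
      also have "\<dots> \<in> sets S" by measurable
      finally show ?thesis .
    qed
    have disj: "disjoint_family_on B {..<n}"
    proof -
      have False if "x \<in> B m" "x \<in> B m'" "m < m'" "m' < n" for x m m'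
      proof -
        define z where "z i = x (i + (n - m'))" for i
        define j where "j = m' - m - 1"
        have j: "m' = Suc j + m" "Suc j + (n - m') = n - m" "j + (n - m') = n - m - 1"
          using that by (auto simp: j_def)
        have "walk z m' = walk z j + z j + walk (\<lambda>i. z (i + Suc j)) m"
          by (subst j(1), subst walk_add) (simp add: walk_Suc)
        moreover have "z (i + Suc j) = x (i + (n - m))" for i
          unfolding z_def j(2)[symmetric] by (simp only: add.assoc)
        moreover have "z j < -a" using that(1) j by (simp add: z_def B_def)
        moreover have "walk z j \<le> 0" "y < walk z m'"
          using that(2) j by (auto simp: z_def[abs_def] B_def E_def stays_below_def)
        moreover have "walk (\<lambda>i. x (i + (n - m))) m \<le> y + a" using that(1) by (auto simp: B_def E_def)
        ultimately show False by simp
      qed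
      then show ?thesis
        unfolding disjoint_family_on_def by (metis disjoint_iff lessThan_iff linorder_neqE_nat)
    qed
    have eB: "emeasure S (B m) = emeasure S (E m) * emeasure \<nu> {..<-a}" if "m < n" for m
    proof -
      have "emeasure S (B m) = (\<integral>\<^sup>+x. indicator (E m) (\<lambda>i. x (i + (n - m))) * indicator {..<-a} (x (n - m - 1)) \<partial>S)"
      unfolding nn_integral_indicator[OF B[of m], symmetric]
      by (intro nn_integral_cong) (auto simp: B_def split: split_indicator)
      also have "\<dots> = (\<integral>\<^sup>+x. indicator (E m) (\<lambda>i. x (i + (n - m))) \<partial>S) * (\<integral>\<^sup>+e. indicator {..<-a} e \<partial>\<nu>)"
      proof (rule nn_integral_PiM_resample_mult[where g = "indicator {..<-a}"])
        show "indicator (E m) (\<lambda>i. (x(n - m - 1 := e)) (i + (n - m))) =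
            (indicator (E m) (\<lambda>i. x (i + (n - m))) :: ennreal)" for x e
        proof -
          have "i + (n - m) \<noteq> n - m - 1" for i
            using that by linarith
          then have "(\<lambda>i. (x(n - m - 1 := e)) (i + (n - m))) = (\<lambda>i. x (i + (n - m)))"
            by (simp only: fun_upd_other not_False_eq_True)
          then show ?thesis by simp
        qed
        show "prob_space \<nu>" by (rule prob_space_axioms)
        show "(\<lambda>x. indicator (E m) (\<lambda>i. x (i + (n - m)))) \<in> borel_measurable S" by measurable
        show "indicator {..<-a} \<in> borel_measurable \<nu>"
          by (simp add: sets_eq borel_measurable_indicator)
      qed
      also have "(\<integral>\<^sup>+x. indicator (E m) (\<lambda>i. x (i + (n - m))) \<partial>S) = (\<integral>\<^sup>+x. indicator (E m) x \<partial>S)"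
        by (rule nn_integral_PiM_shift[OF prob_space_axioms, of "indicator (E m)"]) simp
      finally show ?thesis by simp
    qed
    have "(\<Sum>m<n. emeasure S (E m)) * emeasure \<nu> {..<-a} = (\<Sum>m<n. emeasure S (B m))"
      by (simp add: eB sum_distrib_right)
    also have "\<dots> = emeasure S (\<Union>m<n. B m)"
      by (rule sum_emeasure) (use disj in auto)
    also have "\<dots> \<le> 1" by (rule PS.emeasure_le_1)
    finally show ?thesis .
  qed
  have "(\<Sum>m. emeasure S (E m)) * emeasure \<nu> {..<-a} = (\<Sum>m. emeasure S (E m) * emeasure \<nu> {..<-a})"
    by simp
  also have "\<dots> \<le> 1"
    by (rule suminf_le_const) (use fin in \<open>auto simp: sum_distrib_right[symmetric]\<close>)
  finally show ?thesis unfolding E_def .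
qed

end

section \<open>The Green function of a walk killed above a barrier\<close>

text \<open>
  The profile of the sums below: bounded within distance \<open>r\<close> of the barrier and
  exponentially small beyond.
\<close>
definition decay :: "real \<Rightarrow> real \<Rightarrow> real \<Rightarrow> real" where
  "decay \<delta> r y = min 1 (exp (- \<delta> * (y - r)))"

lemma decay_pos: "decay \<delta> r y > 0" and decay_le_1: "decay \<delta> r y \<le> 1"
  by (simp_all add: decay_def)

lemma measurable_decay [measurable]: "decay \<delta> r \<in> borel_measurable borel"
  unfolding decay_def[abs_def] by measurable

lemma decay_antimono: "\<delta> \<ge> 0 \<Longrightarrow> y \<le> z \<Longrightarrow> decay \<delta> r z \<le> decay \<delta> r y"
  unfolding decay_def by (intro min.mono) (auto intro: mult_left_mono)

text \<open>
  Submultiplicativity lets the distance of a path to the barrier be split at its maximum.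
\<close>
lemma decay_add_le:
  assumes "\<delta> \<ge> 0" "r \<ge> 0" "p \<ge> 0" "q \<ge> 0"
  shows "decay \<delta> r (p + q) \<le> decay \<delta> r p * decay \<delta> r q"
proof -
  have *: "\<delta> * r \<ge> 0" "\<delta> * p \<ge> 0" "\<delta> * q \<ge> 0" using assms by simp_all
  have "exp (- \<delta> * (p + q - r)) \<le> exp (- \<delta> * (p - r)) * exp (- \<delta> * (q - r))"
    using * by (simp add: exp_add[symmetric] algebra_simps)
  moreover have "exp (- \<delta> * (p + q - r)) \<le> exp (- \<delta> * (p - r))" "exp (- \<delta> * (p + q - r)) \<le> exp (- \<delta> * (q - r))"
    using * by (simp_all add: algebra_simps)
  ultimately show ?thesis unfolding decay_def min_def by auto
qed

lemma sum_decay_le: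
  assumes "\<delta> > 0" "a > 0"
  shows "\<exists>C\<ge>0. \<forall>r\<ge>0. (\<Sum>c::nat. ennreal (decay \<delta> r (real c * a))) \<le> ennreal (C * (1 + r))"
proof (intro exI conjI allI impI)
  define q where "q = exp (- \<delta> * a)"
  have q: "0 < q" "q < 1" using assms by (simp_all add: q_def)
  let ?C = "1 / a + 1 + 1 / (1 - q)"
  show "?C \<ge> 0" using q assms by simp
  fix r :: real assume r: "r \<ge> 0"
  define c0 where "c0 = nat \<lceil>r / a\<rceil>"
  have c0: "r / a \<le> real c0" "real c0 \<le> r / a + 1"
    using r assms unfolding c0_def by (simp_all add: le_of_int_ceiling of_int_ceiling_le_add_one)
  define g where "g c = (if c < c0 then 1 else q ^ (c - c0))" for c
  have le: "decay \<delta> r (real c * a) \<le> g c" for c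
  proof (cases "c < c0")
    case False
    have "real c0 * a \<ge> r" using c0(1) assms by (simp add: field_simps)
    then have "real c * a - r \<ge> real (c - c0) * a"
      using False by (simp add: of_nat_diff algebra_simps)
    then have "\<delta> * (real c * a - r) \<ge> \<delta> * (real (c - c0) * a)"
      using assms by (intro mult_left_mono) auto
    moreover have "q ^ (c - c0) = exp (- (\<delta> * (real (c - c0) * a)))"
      unfolding q_def by (simp add: exp_of_nat_mult[symmetric] algebra_simps)
    ultimately have "exp (- \<delta> * (real c * a - r)) \<le> q ^ (c - c0)" by simp
    then show ?thesis using False by (simp add: g_def decay_def)
  qed (simp add: g_def decay_le_1)
  have geo: "(\<lambda>c. g (c + c0)) sums (1 / (1 - q))"
    using geometric_sums[of q] q by (simp add: g_def)
  have sm: "summable g"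
    using geo summable_iff_shift sums_summable by blast
  have "suminf g = (\<Sum>c. g (c + c0)) + sum g {..<c0}"
    by (rule suminf_split_initial_segment[OF sm])
  also have "\<dots> = 1 / (1 - q) + real c0"
    using sums_unique[OF geo] by (simp add: g_def)
  also have "\<dots> \<le> ?C + r / a"
    using c0 divide_pos_pos[OF zero_less_one assms(2)] by linarith
  also have "\<dots> \<le> ?C * (1 + r)"
  proof -
    have "0 \<le> r * (1 + 1 / (1 - q))" using r q by simp
    then show ?thesis by (simp add: algebra_simps add_divide_distrib)
  qed
  finally have *: "suminf g \<le> ?C * (1 + r)" .
  have "(\<Sum>c::nat. ennreal (decay \<delta> r (real c * a))) \<le> (\<Sum>c. ennreal (g c))"
    by (intro suminf_le) (simp_all add: le ennreal_leI)
  also have "\<dots> = ennreal (suminf g)"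
    by (rule suminf_ennreal2[OF _ sm]) (use q in \<open>simp add: g_def\<close>)
  finally show "(\<Sum>c::nat. ennreal (decay \<delta> r (real c * a))) \<le> ennreal (?C * (1 + r))"
    using * by (meson ennreal_leI order_trans)
qed

lemma suminf_swap_ennreal:
  fixes f :: "nat \<Rightarrow> nat \<Rightarrow> ennreal"
  shows "(\<Sum>i. \<Sum>j. f i j) = (\<Sum>j. \<Sum>i. f i j)"
proof -
  have "(\<Sum>i. \<Sum>j. f i j) = (\<integral>\<^sup>+i. (\<Sum>j. f i j) \<partial>count_space UNIV)"
    by (simp add: nn_integral_count_space_nat)
  also have "\<dots> = (\<Sum>j. \<integral>\<^sup>+i. f i j \<partial>count_space UNIV)"
    by (rule nn_integral_suminf) simp
  finally show ?thesis by (simp add: nn_integral_count_space_nat)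
qed

lemma suminf_convolution_ennreal:
  fixes A B :: "nat \<Rightarrow> ennreal"
  shows "(\<Sum>n. \<Sum>k\<le>n. A k * B (n - k)) = (\<Sum>k. A k) * (\<Sum>m. B m)"
proof -
  have "(\<Sum>n. \<Sum>k\<le>n. A k * B (n - k)) = (\<Sum>n. \<Sum>k. if k \<le> n then A k * B (n - k) else 0)"
    by (intro suminf_cong, subst suminf_finite[of "{..n}" for n]) auto
  also have "\<dots> = (\<Sum>k. \<Sum>n. if k \<le> n then A k * B (n - k) else 0)"
    by (rule suminf_swap_ennreal)
  also have "\<dots> = (\<Sum>k. A k * (\<Sum>m. B m))"
  proof (intro suminf_cong)
    fix k
    have "(\<Sum>n. if k \<le> n then A k * B (n - k) else 0)
        = (\<Sum>n. if k \<le> n + k then A k * B (n + k - k) else 0) + (\<Sum>n<k. if k \<le> n then A k * B (n - k) else 0)"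
      by (rule suminf_offset) simp
    then show "(\<Sum>n. if k \<le> n then A k * B (n - k) else 0) = A k * (\<Sum>m. B m)" by simp
  qed
  finally show ?thesis by simp
qed

context random_walk begin

abbreviation (input) record_mass :: "real \<Rightarrow> real \<Rightarrow> real \<Rightarrow> nat \<Rightarrow> ennreal" where
  "record_mass \<delta> r b k \<equiv>
     \<integral>\<^sup>+x. (if strict_record x k \<and> walk x k \<le> b then ennreal (decay \<delta> r (b - walk x k)) else 0) \<partial>S"

abbreviation (input) below_mass :: "real \<Rightarrow> real \<Rightarrow> nat \<Rightarrow> ennreal" where
  "below_mass \<delta> r m \<equiv> \<integral>\<^sup>+x. (if stays_below x m then ennreal (decay \<delta> r (- walk x m)) else 0) \<partial>S"

abbreviation (input) killed_mean :: "real \<Rightarrow> nat \<Rightarrow> (real \<Rightarrow> ennreal) \<Rightarrow> ennreal" where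
  "killed_mean b n g \<equiv> \<integral>\<^sup>+x. (if \<forall>k\<le>n. walk x k \<le> b then g (walk x n) else 0) \<partial>S"

lemma exists_threshold_right:
  assumes "emeasure \<nu> {0<..} \<noteq> 0" shows "\<exists>a>0. emeasure \<nu> {a<..} \<noteq> 0"
proof (rule ccontr)
  assume "\<not> ?thesis"
  then have "{1 / real (Suc n)<..} \<in> null_sets \<nu>" for n by (auto simp: null_sets_def sets_eq)
  then have "(\<Union>n. {1 / real (Suc n)<..}) \<in> null_sets \<nu>" by auto
  moreover have "(\<Union>n. {1 / real (Suc n)<..}) = {0<..}"
  proof -
    have "\<exists>n. 1 / real (Suc n) < x" if "0 < x" for x
      using nat_approx_posE[OF that] by (auto simp: divide_inverse)
    then show ?thesis by (auto intro: less_trans[rotated])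
  qed
  ultimately show False using assms by (simp add: null_sets_def)
qed

lemma exists_threshold_left:
  assumes "emeasure \<nu> {..<0} \<noteq> 0" shows "\<exists>a>0. emeasure \<nu> {..<-a} \<noteq> 0"
proof (rule ccontr)
  assume "\<not> ?thesis"
  then have "\<forall>a>0. emeasure \<nu> {..<-a} = 0" by simp
  then have "emeasure \<nu> {..<- (1 / real (Suc n))} = 0" for n
    by (rule allE[of _ "1 / real (Suc n)"]) simp
  then have "{..<- (1 / real (Suc n))} \<in> null_sets \<nu>" for n
    by (simp add: null_sets_def sets_eq)
  then have "(\<Union>n. {..<- (1 / real (Suc n))}) \<in> null_sets \<nu>" by auto
  moreover have "(\<Union>n. {..<- (1 / real (Suc n))}) = {..<0}"
  proof -
    have "\<exists>n. x < - (1 / real (Suc n))" if "x < 0" for x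
    proof -
      have "0 < - x" using that by simp
      then obtain n where "1 / real (Suc n) < - x" by (rule nat_approx_posE)
      then have "x < - (1 / real (Suc n))" by linarith
      then show ?thesis ..
    qed
    then show ?thesis by (auto intro: less_trans)
  qed
  ultimately show False using assms by (simp add: null_sets_def)
qed

text \<open>
  Cut the half line below the barrier \<open>b\<close> into cells of length \<open>a\<close> and use that the profile is
  decreasing; in each cell the expected number of visits is at most \<open>K\<close>.
\<close>
lemma sum_decay_over_cells:
  assumes P [measurable]: "\<And>k. Measurable.pred S (\<lambda>x. P x k)"
    and a: "a > 0" and \<delta>: "\<delta> \<ge> 0"
    and K: "\<And>y. (\<Sum>k. emeasure S {x. P x k \<and> y < walk x k \<and> walk x k \<le> y + a}) \<le> K"
  shows "(\<Sum>k. \<integral>\<^sup>+x. (if P x k \<and> walk x k \<le> b then ennreal (decay \<delta> r (b - walk x k)) else 0) \<partial>S)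
     \<le> K * (\<Sum>c::nat. ennreal (decay \<delta> r (real c * a)))"
proof -
  define E where "E c k = {x. P x k \<and> b - (real c + 1) * a < walk x k \<and> walk x k \<le> b - (real c + 1) * a + a}" for c k
  have E [measurable]: "E c k \<in> sets S" for c k
  proof -
    have "E c k = {x \<in> space S. P x k \<and> b - (real c + 1) * a < walk x k \<and> walk x k \<le> b - (real c + 1) * a + a}"
      by (auto simp: E_def)
    also have "\<dots> \<in> sets S" by measurable
    finally show ?thesis .
  qed
  have "(if P x k \<and> walk x k \<le> b then ennreal (decay \<delta> r (b - walk x k)) else 0)
      \<le> (\<Sum>c. ennreal (decay \<delta> r (real c * a)) * indicator (E c k) x)" for x k
  proof (cases "P x k \<and> walk x k \<le> b")
    case True
    define c where "c = nat \<lfloor>(b - walk x k) / a\<rfloor>"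
    have "0 \<le> (b - walk x k) / a" using True a by simp
    then have c: "real c \<le> (b - walk x k) / a" "(b - walk x k) / a < real c + 1"
      unfolding c_def by (simp_all add: floor_less_cancel)
    then have c': "real c * a \<le> b - walk x k" "b - walk x k < (real c + 1) * a"
      using a by (simp_all add: field_simps)
    then have "x \<in> E c k" using True by (auto simp: E_def algebra_simps)
    moreover have "decay \<delta> r (b - walk x k) \<le> decay \<delta> r (real c * a)"
      by (rule decay_antimono[OF \<delta> c'(1)])
    ultimately have "ennreal (decay \<delta> r (b - walk x k)) \<le> (\<Sum>c\<in>{c}. ennreal (decay \<delta> r (real c * a)) * indicator (E c k) x)"
      by (simp add: ennreal_leI)
    also have "\<dots> \<le> (\<Sum>c. ennreal (decay \<delta> r (real c * a)) * indicator (E c k) x)"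
      by (rule sum_le_suminf) auto
    finally show ?thesis using True by simp
  next
    case False
    then show ?thesis by (subst if_not_P) simp_all
  qed
  then have "(\<Sum>k. \<integral>\<^sup>+x. (if P x k \<and> walk x k \<le> b then ennreal (decay \<delta> r (b - walk x k)) else 0) \<partial>S)
     \<le> (\<Sum>k. \<integral>\<^sup>+x. (\<Sum>c. ennreal (decay \<delta> r (real c * a)) * indicator (E c k) x) \<partial>S)"
    by (intro suminf_le nn_integral_mono) auto
  also have "\<dots> = (\<Sum>k. \<Sum>c. ennreal (decay \<delta> r (real c * a)) * emeasure S (E c k))"
    by (simp add: nn_integral_suminf nn_integral_cmult)
  also have "\<dots> = (\<Sum>c. \<Sum>k. ennreal (decay \<delta> r (real c * a)) * emeasure S (E c k))"
    by (rule suminf_swap_ennreal)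
  also have "\<dots> = (\<Sum>c. ennreal (decay \<delta> r (real c * a)) * (\<Sum>k. emeasure S (E c k)))"
    by simp
  also have "\<dots> \<le> (\<Sum>c. ennreal (decay \<delta> r (real c * a)) * K)"
    by (intro suminf_le mult_left_mono) (use K in \<open>auto simp: E_def\<close>)
  also have "\<dots> = K * (\<Sum>c::nat. ennreal (decay \<delta> r (real c * a)))"
    by (simp add: mult.commute)
  finally show ?thesis .
qed

lemma le_inverse_of_mult_le_1:
  fixes A :: ennreal
  assumes "A * emeasure \<nu> B \<le> 1" "emeasure \<nu> B \<noteq> 0"
  shows "A \<le> ennreal (1 / measure \<nu> B)"
proof -
  have p: "measure \<nu> B > 0"
    using assms(2) by (simp add: emeasure_eq_measure zero_less_measure_iff)
  have "A = A * ennreal (measure \<nu> B) * ennreal (1 / measure \<nu> B)"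
    using p by (simp add: mult.assoc ennreal_mult[symmetric])
  also have "\<dots> \<le> 1 * ennreal (1 / measure \<nu> B)"
    using assms(1) by (intro mult_right_mono) (simp_all add: emeasure_eq_measure)
  finally show ?thesis by simp
qed

text \<open>
  If upward steps have probability zero, only the time \<open>0\<close> is a strict record. Otherwise some
  \<open>a > 0\<close> is exceeded by a step with positive probability and the records can be counted in cells
  of length \<open>a\<close>.
\<close>
lemma strict_record_green:
  assumes "\<delta> > 0"
  shows "\<exists>C\<ge>0. \<forall>r\<ge>0. \<forall>b. (\<Sum>k. record_mass \<delta> r b k)
     \<le> ennreal (C * (1 + r))"
proof (cases "emeasure \<nu> {0<..} = 0")
  case True
  interpret PS: prob_space S by (rule prob_S)
  have "AE e in \<nu>. e \<le> 0"
    using True by (intro AE_I[of _ _ "{0<..}"]) (auto simp: sets_eq)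
  then have "AE x in S. x i \<le> 0" for i
    by (intro AE_PiM_component[where P = "\<lambda>e. e \<le> 0" and M = "\<lambda>_. \<nu>"] prob_space_axioms) auto
  then have *: "AE x in S. \<forall>i. x i \<le> 0" by (simp add: AE_all_countable)
  have zero: "(record_mass \<delta> r b k) = 0"
    if "k \<noteq> 0" for k r b
  proof -
    have "AE x in S. (if strict_record x k \<and> walk x k \<le> b then ennreal (decay \<delta> r (b - walk x k)) else 0) = 0"
      using *
    proof eventually_elim
      case (elim x)
      have "walk x k \<le> 0" unfolding walk_def using elim by (intro sum_nonpos) auto
      then have "\<not> strict_record x k" unfolding strict_record_def using that by (metis linorder_not_less not_gr_zero walk_0)
      then show ?case by simp
    qed
    then show ?thesis by (simp add: nn_integral_0_iff_AE)
  qed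
  show ?thesis
  proof (intro exI[of _ 1] conjI allI impI)
    fix r b :: real assume "r \<ge> 0"
    have "(\<Sum>k. record_mass \<delta> r b k)
      = (\<Sum>k\<in>{0}. record_mass \<delta> r b k)"
      by (rule suminf_finite) (use zero in auto)
    also have "\<dots> \<le> (\<integral>\<^sup>+x. 1 \<partial>S)"
      by (simp only: sum.insert_remove finite.emptyI sum.empty Diff_empty empty_Diff, simp only: add_0_right)
         (intro nn_integral_mono, simp add: decay_le_1)
    also have "\<dots> = ennreal 1" using PS.emeasure_space_1 by simp
    also have "\<dots> \<le> ennreal (1 * (1 + r))" using \<open>r \<ge> 0\<close> by (intro ennreal_leI) simp
    finally show "(\<Sum>k. record_mass \<delta> r b k)
      \<le> ennreal (1 * (1 + r))" .
  qed simp
next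
  case False
  then obtain a where a: "a > 0" "emeasure \<nu> {a<..} \<noteq> 0" using exists_threshold_right by blast
  obtain C where C: "C \<ge> 0" "\<And>r. r \<ge> 0 \<Longrightarrow> (\<Sum>c::nat. ennreal (decay \<delta> r (real c * a))) \<le> ennreal (C * (1 + r))"
    using sum_decay_le[OF assms a(1)] by blast
  show ?thesis
  proof (intro exI[of _ "1 / measure \<nu> {a<..} * C"] conjI allI impI)
    fix r b :: real assume r: "r \<ge> 0"
    have "(\<Sum>k. record_mass \<delta> r b k)
      \<le> ennreal (1 / measure \<nu> {a<..}) * (\<Sum>c::nat. ennreal (decay \<delta> r (real c * a)))"
      using a assms by (intro sum_decay_over_cells le_inverse_of_mult_le_1 strict_records_in_interval) auto
    also have "\<dots> \<le> ennreal (1 / measure \<nu> {a<..}) * ennreal (C * (1 + r))"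
      by (intro mult_left_mono C r) simp
    finally show "(\<Sum>k. record_mass \<delta> r b k)
      \<le> ennreal (1 / measure \<nu> {a<..} * C * (1 + r))"
      using C(1) r by (simp add: ennreal_mult[symmetric] mult.assoc)
  qed (use C in simp)
qed

lemma stays_below_green:
  assumes "\<delta> > 0" and neg: "emeasure \<nu> {..<0} \<noteq> 0"
  shows "\<exists>C\<ge>0. \<forall>r\<ge>0. (\<Sum>m. below_mass \<delta> r m)
     \<le> ennreal (C * (1 + r))"
proof -
  obtain a where a: "a > 0" "emeasure \<nu> {..<-a} \<noteq> 0" using exists_threshold_left[OF neg] by blast
  obtain C where C: "C \<ge> 0" "\<And>r. r \<ge> 0 \<Longrightarrow> (\<Sum>c::nat. ennreal (decay \<delta> r (real c * a))) \<le> ennreal (C * (1 + r))"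
    using sum_decay_le[OF assms(1) a(1)] by blast
  show ?thesis
  proof (intro exI[of _ "1 / measure \<nu> {..<-a} * C"] conjI allI impI)
    fix r :: real assume r: "r \<ge> 0"
    have "(\<Sum>m. below_mass \<delta> r m)
      = (\<Sum>k. \<integral>\<^sup>+x. (if stays_below x k \<and> walk x k \<le> 0 then ennreal (decay \<delta> r (0 - walk x k)) else 0) \<partial>S)"
      by (intro suminf_cong nn_integral_cong) (auto simp: stays_below_def)
    also have "\<dots>
      \<le> ennreal (1 / measure \<nu> {..<-a}) * (\<Sum>c::nat. ennreal (decay \<delta> r (real c * a)))"
      using a assms by (intro sum_decay_over_cells le_inverse_of_mult_le_1 stays_below_in_interval) auto
    also have "\<dots> \<le> ennreal (1 / measure \<nu> {..<-a}) * ennreal (C * (1 + r))"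
      by (intro mult_left_mono C r) simp
    finally show "(\<Sum>m. below_mass \<delta> r m)
      \<le> ennreal (1 / measure \<nu> {..<-a} * C * (1 + r))"
      using C(1) r by (simp add: ennreal_mult[symmetric] mult.assoc)
  qed (use C in simp)
qed

text \<open>
  The steps from time \<open>k\<close> on form an independent copy of the walk.
\<close>
lemma nn_integral_split:
  assumes f [measurable]: "f \<in> borel_measurable S" and g [measurable]: "g \<in> borel_measurable S"
    and indep: "\<And>x y. (\<And>j. j < k \<Longrightarrow> x j = y j) \<Longrightarrow> f x = f y"
  shows "(\<integral>\<^sup>+x. f x * g (\<lambda>i. x (i + k)) \<partial>S) = (\<integral>\<^sup>+x. f x \<partial>S) * (\<integral>\<^sup>+x. g x \<partial>S)"
proof -
  interpret SS: sequence_space \<nu> ..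
  interpret PS: prob_space S by (rule prob_S)
  interpret PP: pair_sigma_finite S S ..
  have sh [measurable]: "(\<lambda>w i. w (i + k)) \<in> S \<rightarrow>\<^sub>M S"
    by (rule measurable_PiM_single') (auto simp: space_PiM PiE_iff)
  have h: "(\<lambda>x. f x * g (\<lambda>i. x (i + k))) \<in> borel_measurable S" by measurable
  have "(\<integral>\<^sup>+x. f x * g (\<lambda>i. x (i + k)) \<partial>S)
    = (\<integral>\<^sup>+p. f (comb_seq k (fst p) (snd p)) * g (\<lambda>i. comb_seq k (fst p) (snd p) (i + k)) \<partial>(S \<Otimes>\<^sub>M S))"
    by (subst SS.PiM_comb_seq[of k, symmetric], subst nn_integral_distr[OF measurable_comb_seq])
       (use h in \<open>simp_all add: case_prod_beta\<close>)
  also have "\<dots> = (\<integral>\<^sup>+p. f (fst p) * g (snd p) \<partial>(S \<Otimes>\<^sub>M S))"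
    by (intro nn_integral_cong arg_cong2[where f="(*)"] indep) (simp_all add: comb_seq_less comb_seq_add)
  also have "\<dots> = (\<integral>\<^sup>+x. (\<integral>\<^sup>+y. f x * g y \<partial>S) \<partial>S)"
    using sigma_finite_measure.nn_integral_fst[OF prob_space_imp_sigma_finite[OF prob_S], of "\<lambda>p. f (fst p) * g (snd p)" S]
    by simp
  also have "\<dots> = (\<integral>\<^sup>+x. f x \<partial>S) * (\<integral>\<^sup>+x. g x \<partial>S)"
    by (simp add: nn_integral_cmult nn_integral_multc)
  finally show ?thesis .
qed

text \<open>
  Green function of the walk killed above \<open>b\<close>, integrated against a profile of width \<open>r\<close>, with a bound
  uniform in \<open>b\<close>. A path is split at the first time \<open>k\<close> at which it attains its maximum: then \<open>k\<close> is a
  strict record, and the rest of the path stays below its starting point. Both parts are sums of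
  order \<open>1 + r\<close>, and the double sum over \<open>k\<close> and the remaining time factorises.
\<close>
lemma green_bound:
  assumes \<delta>: "\<delta> > 0" and neg: "emeasure \<nu> {..<0} \<noteq> 0"
  shows "\<exists>C\<ge>0. \<forall>r\<ge>0. \<forall>b. (\<Sum>n. killed_mean b n (\<lambda>y. ennreal (decay \<delta> r (b - y))))
     \<le> ennreal (C * (1 + r)\<^sup>2)"
proof -
  obtain C1 where C1: "C1 \<ge> 0" "\<And>r b. r \<ge> 0 \<Longrightarrow>
      (\<Sum>k. record_mass \<delta> r b k) \<le> ennreal (C1 * (1 + r))"
    using strict_record_green[OF \<delta>] by blast
  obtain C2 where C2: "C2 \<ge> 0" "\<And>r. r \<ge> 0 \<Longrightarrow>
      (\<Sum>m. below_mass \<delta> r m) \<le> ennreal (C2 * (1 + r))"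
    using stays_below_green[OF assms] by blast
  show ?thesis
  proof (intro exI[of _ "C1 * C2"] conjI allI impI)
    fix r b :: real assume r: "r \<ge> 0"
    define f where "f k x = (if strict_record x k \<and> walk x k \<le> b then ennreal (decay \<delta> r (b - walk x k)) else 0)" for k x
    define g where "g m x = (if stays_below x m then ennreal (decay \<delta> r (- walk x m)) else 0)" for m x
    have fm [measurable]: "f k \<in> borel_measurable S" for k unfolding f_def[abs_def] by measurable
    have gm [measurable]: "g k \<in> borel_measurable S" for k unfolding g_def[abs_def] by measurable
    have sh [measurable]: "(\<lambda>w i. w (i + k)) \<in> S \<rightarrow>\<^sub>M S" for k
      by (rule measurable_PiM_single') (auto simp: space_PiM PiE_iff)
    have split: "(if \<forall>k\<le>n. walk x k \<le> b then ennreal (decay \<delta> r (b - walk x n)) else 0)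
       \<le> (\<Sum>k\<le>n. f k x * g (n - k) (\<lambda>i. x (i + k)))" for n x
    proof (cases "\<forall>k\<le>n. walk x k \<le> b")
      case True
      define W where "W = Max (walk x ` {..n})"
      define k where "k = (LEAST k. k \<le> n \<and> walk x k = W)"
      have "W \<in> walk x ` {..n}" unfolding W_def by (intro Max_in) auto
      then have "\<exists>k. k \<le> n \<and> walk x k = W" by auto
      then have k: "k \<le> n" "walk x k = W" unfolding k_def by (metis (mono_tags, lifting) LeastI_ex)+
      have W: "walk x j \<le> W" if "j \<le> n" for j unfolding W_def using that by (intro Max_ge) auto
      have rec: "strict_record x k"
        unfolding strict_record_def
      proof (intro allI impI)
        fix j assume "j < k"
        then have "walk x j \<noteq> W" "j \<le> n" using not_less_Least[of j "\<lambda>k. k \<le> n \<and> walk x k = W"] k unfolding k_def by auto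
        then show "walk x j < walk x k" using W[of j] k by simp
      qed
      have shift: "walk (\<lambda>i. x (i + k)) i = walk x (k + i) - walk x k" for i
        using walk_add[of x k i] by simp
      have below: "stays_below (\<lambda>i. x (i + k)) (n - k)"
        unfolding stays_below_def shift using W k by auto
      have "decay \<delta> r (b - walk x n) = decay \<delta> r ((b - walk x k) + (- walk (\<lambda>i. x (i + k)) (n - k)))"
        using k by (simp add: shift)
      also have "\<dots> \<le> decay \<delta> r (b - walk x k) * decay \<delta> r (- walk (\<lambda>i. x (i + k)) (n - k))"
        using True k below r \<delta> by (intro decay_add_le) (auto simp: stays_below_def)
      finally have "ennreal (decay \<delta> r (b - walk x n)) \<le> f k x * g (n - k) (\<lambda>i. x (i + k))"
        using True[rule_format, OF k(1)] rec below by (simp add: f_def g_def ennreal_mult[symmetric] decay_pos less_imp_le ennreal_leI)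
      also have "\<dots> \<le> (\<Sum>k\<le>n. f k x * g (n - k) (\<lambda>i. x (i + k)))"
        using k by (intro member_le_sum) auto
      finally show ?thesis using True by simp
    next
      case False
      then show ?thesis by (subst if_not_P) simp_all
    qed
    have "(\<Sum>n. killed_mean b n (\<lambda>y. ennreal (decay \<delta> r (b - y))))
      \<le> (\<Sum>n. \<integral>\<^sup>+x. (\<Sum>k\<le>n. f k x * g (n - k) (\<lambda>i. x (i + k))) \<partial>S)"
      by (intro suminf_le nn_integral_mono split) auto
    also have "\<dots> = (\<Sum>n. \<Sum>k\<le>n. (\<integral>\<^sup>+x. f k x * g (n - k) (\<lambda>i. x (i + k)) \<partial>S))"
      by (intro suminf_cong nn_integral_sum) measurable
    also have "\<dots> = (\<Sum>n. \<Sum>k\<le>n. (\<integral>\<^sup>+x. f k x \<partial>S) * (\<integral>\<^sup>+x. g (n - k) x \<partial>S))"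
    proof (intro suminf_cong sum.cong refl nn_integral_split)
      fix k and x y :: "nat \<Rightarrow> real" assume "\<And>j. j < k \<Longrightarrow> x j = y j"
      then have "walk x j = walk y j" if "j \<le> k" for j unfolding walk_def using that by (intro sum.cong) auto
      then show "f k x = f k y" unfolding f_def strict_record_def by auto
    qed measurable
    also have "\<dots> = (\<Sum>k. \<integral>\<^sup>+x. f k x \<partial>S) * (\<Sum>m. \<integral>\<^sup>+x. g m x \<partial>S)"
      by (rule suminf_convolution_ennreal)
    also have "\<dots> \<le> ennreal (C1 * (1 + r)) * ennreal (C2 * (1 + r))"
      unfolding f_def g_def by (intro mult_mono C1 C2 r) auto
    also have "\<dots> = ennreal (C1 * C2 * (1 + r)\<^sup>2)"
      using C1(1) C2(1) r by (simp add: ennreal_mult[symmetric] power2_eq_square mult_ac)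
    finally show "(\<Sum>n. killed_mean b n (\<lambda>y. ennreal (decay \<delta> r (b - y))))
     \<le> ennreal (C1 * C2 * (1 + r)\<^sup>2)" .
  qed (use C1 C2 in simp)
qed

end

section \<open>Countable sums as integrals\<close>

lemma summable_on_iff_nn_integral:
  fixes f :: "'i \<Rightarrow> complex"
  shows "f summable_on A \<longleftrightarrow> (\<integral>\<^sup>+u. ennreal (norm (f u)) \<partial>count_space A) < \<infinity>"
  unfolding summable_on_iff_abs_summable_on_complex abs_summable_equivalent Infinite_Set_Sum.abs_summable_on_def
  by (simp add: integrable_iff_bounded)

lemma infsum_eq_integral:
  fixes f :: "'i \<Rightarrow> complex"
  shows "infsum f A = (\<integral>u. f u \<partial>count_space A)"
proof (cases "f summable_on A")
  case True
  then have "Infinite_Set_Sum.abs_summable_on f A"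
    unfolding summable_on_iff_abs_summable_on_complex abs_summable_equivalent .
  then show ?thesis using infsetsum_infsum[of f A] by (simp add: infsetsum_def)
next
  case False
  then have "\<not> integrable (count_space A) f"
    unfolding summable_on_iff_abs_summable_on_complex abs_summable_equivalent Infinite_Set_Sum.abs_summable_on_def .
  then show ?thesis using False by (simp add: infsum_not_exists not_integrable_integral_eq)
qed

lemma measurable_count_pair:
  assumes "countable A" "\<And>u. u \<in> A \<Longrightarrow> f u \<in> M \<rightarrow>\<^sub>M K"
  shows "(\<lambda>p. f (snd p) (fst p)) \<in> M \<Otimes>\<^sub>M count_space A \<rightarrow>\<^sub>M K"
  by (rule measurable_compose_countable'[where I = A and g = snd and f = "\<lambda>u p. f u (fst p)"])
     (use assms in \<open>auto intro: measurable_compose[OF measurable_fst]\<close>)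

lemma measurable_infsum:
  fixes f :: "'i \<Rightarrow> 'a \<Rightarrow> complex"
  assumes "countable A" "\<And>u. u \<in> A \<Longrightarrow> f u \<in> borel_measurable M"
  shows "(\<lambda>\<omega>. infsum (\<lambda>u. f u \<omega>) A) \<in> borel_measurable M"
proof -
  interpret sigma_finite_measure "count_space A"
    by (rule sigma_finite_measure_count_space_countable) fact
  show ?thesis unfolding infsum_eq_integral
    by (rule borel_measurable_lebesgue_integral)
       (use measurable_count_pair[OF assms] in \<open>simp add: case_prod_beta\<close>)
qed

lemma measurable_nn_integral_count:
  assumes "countable A" "\<And>u. u \<in> A \<Longrightarrow> f u \<in> borel_measurable M"
  shows "(\<lambda>\<omega>. \<integral>\<^sup>+u. f u \<omega> \<partial>count_space A) \<in> borel_measurable M"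
proof -
  interpret sigma_finite_measure "count_space A"
    by (rule sigma_finite_measure_count_space_countable) fact
  show ?thesis
    by (rule borel_measurable_nn_integral)
       (use measurable_count_pair[OF assms] in \<open>simp add: case_prod_beta\<close>)
qed

lemma norm_infsum_le_nn_integral:
  fixes f :: "'i \<Rightarrow> complex"
  shows "ennreal (norm (infsum f A)) \<le> (\<integral>\<^sup>+u. ennreal (norm (f u)) \<partial>count_space A)"
proof (cases "f summable_on A")
  case True
  then have "Infinite_Set_Sum.abs_summable_on f A"
    unfolding summable_on_iff_abs_summable_on_complex abs_summable_equivalent .
  then show ?thesis
    unfolding infsum_eq_integral Infinite_Set_Sum.abs_summable_on_def by (rule integral_norm_bound_ennreal)
qed (simp add: infsum_not_exists)

section \<open>The levels of the tree\<close>

definition level :: "nat \<Rightarrow> nat list set" where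
  "level n = {v. length v = n}"

lemma level_0: "level 0 = {[]}" by (auto simp: level_def)

lemma countable_level [simp]: "countable (level n)" by simp

lemma bij_betw_level_Suc: "bij_betw (\<lambda>(v, j). v @ [j]) (level n \<times> UNIV) (level (Suc n))"
proof (rule bij_betwI')
  fix v assume "v \<in> level (Suc n)"
  then have "v = butlast v @ [last v]" "butlast v \<in> level n"
    by (auto simp: level_def intro!: append_butlast_last_id[symmetric])
  then show "\<exists>p\<in>level n \<times> UNIV. v = (case p of (v, j) \<Rightarrow> v @ [j])"
    by (intro bexI[of _ "(butlast v, last v)"]) auto
qed (auto simp: level_def)

lemma nn_integral_level_Suc:
  "(\<integral>\<^sup>+v. f v \<partial>count_space (level (Suc n)))
    = (\<integral>\<^sup>+v. \<integral>\<^sup>+j. f (v @ [j]) \<partial>count_space UNIV \<partial>count_space (level n))"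
proof -
  have "(\<integral>\<^sup>+v. f v \<partial>count_space (level (Suc n)))
    = (\<integral>\<^sup>+p. f (case p of (v, j) \<Rightarrow> v @ [j]) \<partial>count_space (level n \<times> UNIV))"
    by (rule nn_integral_bij_count_space[OF bij_betw_level_Suc, symmetric])
  also have "\<dots> = (\<integral>\<^sup>+p. f (fst p @ [snd p]) \<partial>(count_space (level n) \<Otimes>\<^sub>M count_space (UNIV :: nat set)))"
    by (simp add: pair_measure_countable case_prod_beta)
  also have "\<dots> = (\<integral>\<^sup>+v. \<integral>\<^sup>+j. f (v @ [j]) \<partial>count_space UNIV \<partial>count_space (level n))"
    using sigma_finite_measure.nn_integral_fst[OF sigma_finite_measure_count_space_countable,
        of "UNIV :: nat set" "\<lambda>p. f (fst p @ [snd p])" "count_space (level n)"]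
    by (simp add: pair_measure_countable)
  finally show ?thesis .
qed

lemma nn_integral_all_levels:
  fixes f :: "nat list \<Rightarrow> ennreal"
  shows "(\<integral>\<^sup>+v. f v \<partial>count_space UNIV) = (\<Sum>n. \<integral>\<^sup>+v. f v \<partial>count_space (level n))"
proof -
  have "(\<integral>\<^sup>+v. f v \<partial>count_space UNIV) = (\<integral>\<^sup>+v. (\<Sum>n. f v * indicator (level n) v) \<partial>count_space UNIV)"
  proof (intro nn_integral_cong)
    fix v :: "nat list"
    have "(\<Sum>n. f v * indicator (level n) v) = (\<Sum>n\<in>{length v}. f v * indicator (level n) v)"
      by (rule suminf_finite) (auto simp: level_def)
    then show "f v = (\<Sum>n. f v * indicator (level n) v)" by (simp add: level_def)
  qed
  also have "\<dots> = (\<Sum>n. \<integral>\<^sup>+v. f v * indicator (level n) v \<partial>count_space UNIV)"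
    by (rule nn_integral_suminf) simp
  finally show ?thesis by (simp add: nn_integral_count_space_indicator)
qed

section \<open>A Huber function\<close>

text \<open>
  A smooth version of the Huber function: quadratic near \<open>0\<close>, linear at infinity.
\<close>
definition huber :: "complex \<Rightarrow> real" where
  "huber z = sqrt (1 + (norm z)\<^sup>2) - 1"

lemma huber_nonneg: "huber z \<ge> 0" by (simp add: huber_def)

lemma huber_0 [simp]: "huber 0 = 0" by (simp add: huber_def)

lemma continuous_huber: "isCont huber z"
  unfolding huber_def[abs_def] by (intro continuous_intros)

lemma measurable_huber [measurable]: "huber \<in> borel_measurable borel"
  unfolding huber_def[abs_def] by measurable

definition min_sq :: "real \<Rightarrow> real" where
  "min_sq x = min (x\<^sup>2) x"

lemma min_sq_nonneg: "x \<ge> 0 \<Longrightarrow> min_sq x \<ge> 0" by (simp add: min_sq_def)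

lemma min_sq_0 [simp]: "min_sq 0 = 0" by (simp add: min_sq_def)

lemma min_sq_mono: "0 \<le> x \<Longrightarrow> x \<le> y \<Longrightarrow> min_sq x \<le> min_sq y"
  unfolding min_sq_def by (intro min.mono power_mono) auto

lemma measurable_min_sq [measurable]: "min_sq \<in> borel_measurable borel"
  unfolding min_sq_def[abs_def] by measurable

text \<open>
  With \<open>a = sqrt (1 + |z|^2)\<close> one has \<open>1 + |z + d|^2 = a^2 + 2 Re (cnj z * d) + |d|^2\<close>. Concavity of the
  square root gives the error \<open>|d|^2 / 2\<close>, the triangle inequality the error \<open>2 |d|\<close>; the linear
  term vanishes for centred \<open>d\<close>. This replaces orthogonality in a setting with fewer than two moments.
\<close>
lemma huber_add_le:
  "huber (z + d) \<le> huber z + Re (cnj z * d) / sqrt (1 + (norm z)\<^sup>2) + 2 * min_sq (norm d)"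
proof -
  define a where "a = sqrt (1 + (norm z)\<^sup>2)"
  have a: "a \<ge> 1" "a\<^sup>2 = 1 + (norm z)\<^sup>2" "norm z \<le> a"
    unfolding a_def by (auto intro: real_le_rsqrt)
  have sq: "1 + (norm (z + d))\<^sup>2 = a\<^sup>2 + 2 * Re (cnj z * d) + (norm d)\<^sup>2"
    unfolding a(2) cmod_power2 by (simp add: power2_eq_square algebra_simps)
  define c where "c = Re (cnj z * d) / a"
  have ca: "c * a = Re (cnj z * d)" using a by (simp add: c_def)
  have cb: "\<bar>c\<bar> \<le> norm d"
  proof -
    have "\<bar>Re (cnj z * d)\<bar> \<le> norm z * norm d"
      using abs_Re_le_cmod[of "cnj z * d"] by (simp add: norm_mult)
    also have "\<dots> \<le> a * norm d" using a by (intro mult_right_mono) auto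
    finally show ?thesis using a by (simp add: c_def field_simps)
  qed
  have pos: "a + c + (norm d)\<^sup>2 / 2 \<ge> 0"
  proof -
    have "(norm d - 1)\<^sup>2 \<ge> 0" by simp
    then have "1 - norm d + (norm d)\<^sup>2 / 2 \<ge> 0" by (simp add: power2_eq_square algebra_simps)
    then show ?thesis using a cb by linarith
  qed
  have "sqrt (1 + (norm (z + d))\<^sup>2) \<le> a + c + (norm d)\<^sup>2 / 2"
  proof (rule real_le_lsqrt)
    have "(a + c + (norm d)\<^sup>2 / 2)\<^sup>2 = a\<^sup>2 + 2 * (c * a) + a * (norm d)\<^sup>2 + (c + (norm d)\<^sup>2 / 2)\<^sup>2"
      by (simp add: power2_eq_square algebra_simps)
    moreover have "a * (norm d)\<^sup>2 \<ge> (norm d)\<^sup>2" using a mult_right_mono[of 1 a "(norm d)\<^sup>2"] by simp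
    ultimately show "1 + (norm (z + d))\<^sup>2 \<le> (a + c + (norm d)\<^sup>2 / 2)\<^sup>2"
      unfolding sq ca by (smt (verit) zero_le_power2)
  qed (use pos in auto)
  moreover have "sqrt (1 + (norm (z + d))\<^sup>2) \<le> a + norm d"
  proof (rule real_le_lsqrt)
    have "Re (cnj z * d) \<le> a * norm d" using cb a ca by (smt (verit) mult.commute mult_left_mono)
    then show "1 + (norm (z + d))\<^sup>2 \<le> (a + norm d)\<^sup>2" unfolding sq by (simp add: power2_eq_square algebra_simps)
  qed (use a in auto)
  moreover have "0 \<le> (norm d)\<^sup>2" by simp
  moreover have "min_sq (norm d) = (norm d)\<^sup>2 \<or> min_sq (norm d) = norm d" by (auto simp: min_sq_def)
  ultimately show ?thesis
    using cb unfolding huber_def a_def[symmetric] c_def[symmetric] by linarith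
qed

lemma nn_integral_huber_increment:
  assumes "prob_space N" and D [measurable]: "integrable N D" and mean: "(\<integral>e. D e \<partial>N) = 0"
  shows "(\<integral>\<^sup>+e. ennreal (huber (z + h * D e)) \<partial>N)
     \<le> ennreal (huber z) + (\<integral>\<^sup>+e. ennreal (2 * min_sq (norm (h * D e))) \<partial>N)"
proof -
  interpret prob_space N by fact
  define a where "a = sqrt (1 + (norm z)\<^sup>2)"
  have [measurable]: "D \<in> borel_measurable N" using D by simp
  have i1: "integrable N (\<lambda>e. Re (cnj z * (h * D e)) / a)"
    using D by auto
  have i2: "integrable N (\<lambda>e. 2 * min_sq (norm (h * D e)))"
  proof (rule Bochner_Integration.integrable_bound)
    show "integrable N (\<lambda>e. 2 * norm (h * D e))" using D by auto
  qed (auto simp: min_sq_def)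
  have z: "(\<integral>e. Re (cnj z * (h * D e)) / a \<partial>N) = 0"
    using D mean by (simp add: integral_Re)
  have "(\<integral>\<^sup>+e. ennreal (huber (z + h * D e)) \<partial>N)
    \<le> (\<integral>\<^sup>+e. ennreal (huber z + Re (cnj z * (h * D e)) / a + 2 * min_sq (norm (h * D e))) \<partial>N)"
    by (intro nn_integral_mono ennreal_leI huber_add_le[of z, folded a_def])
  also have "\<dots> = ennreal (\<integral>e. huber z + Re (cnj z * (h * D e)) / a + 2 * min_sq (norm (h * D e)) \<partial>N)"
  proof (rule nn_integral_eq_integral)
    show "integrable N (\<lambda>e. huber z + Re (cnj z * (h * D e)) / a + 2 * min_sq (norm (h * D e)))"
      using i1 i2 by (intro Bochner_Integration.integrable_add) auto
    show "AE e in N. 0 \<le> huber z + Re (cnj z * (h * D e)) / a + 2 * min_sq (norm (h * D e))"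
      by (intro AE_I2 order_trans[OF huber_nonneg huber_add_le[of z, folded a_def]])
  qed
  also have "(\<integral>e. huber z + Re (cnj z * (h * D e)) / a + 2 * min_sq (norm (h * D e)) \<partial>N)
    = huber z + (\<integral>e. 2 * min_sq (norm (h * D e)) \<partial>N)"
    using i1 i2 z by (simp add: prob_space)
  also have "ennreal \<dots> = ennreal (huber z) + ennreal (\<integral>e. 2 * min_sq (norm (h * D e)) \<partial>N)"
    by (intro ennreal_plus huber_nonneg integral_nonneg) (auto simp: min_sq_def)
  also have "ennreal (\<integral>e. 2 * min_sq (norm (h * D e)) \<partial>N) = (\<integral>\<^sup>+e. ennreal (2 * min_sq (norm (h * D e))) \<partial>N)"
    by (rule nn_integral_eq_integral[symmetric, OF i2]) (auto simp: min_sq_def)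
  finally show ?thesis .
qed

section \<open>Independent weights on a tree and martingale transforms\<close>

definition excess :: "(nat \<Rightarrow> complex) \<Rightarrow> complex" where
  "excess e = (\<Sum>\<^sub>\<infinity>j. e j) - 1"

definition node_weight :: "(nat list \<Rightarrow> nat \<Rightarrow> complex) \<Rightarrow> nat list \<Rightarrow> complex" where
  "node_weight w v = (\<Prod>k<length v. w (take k v) (v ! k))"

lemma node_weight_Nil [simp]: "node_weight w [] = 1"
  by (simp add: node_weight_def)

lemma node_weight_snoc [simp]: "node_weight w (v @ [j]) = node_weight w v * w v j"
  by (simp add: node_weight_def nth_append)

lemma node_weight_upd:
  assumes "length v \<le> length u" shows "node_weight (w(u := e)) v = node_weight w v"
  unfolding node_weight_def
proof (rule prod.cong)
  fix k assume "k \<in> {..<length v}"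
  then have "take k v \<noteq> u" using assms by auto
  then show "(w(u := e)) (take k v) (v ! k) = w (take k v) (v ! k)" by simp
qed simp

text \<open>
  Weights on the tree of finite sequences: \<open>Q v\<close> is the joint law of the weights of the children of
  \<open>v\<close>, independently over the nodes. The laws may depend on the node because in the branching random
  walk only the random measures, and not the enumerations of their points, have the same law.
\<close>
locale cascade =
  fixes Q :: "nat list \<Rightarrow> (nat \<Rightarrow> complex) measure" and \<kappa> :: real
  assumes prob_Q: "\<And>v. prob_space (Q v)"
    and sets_Q [measurable_cong]: "\<And>v. sets (Q v) = sets (PiM UNIV (\<lambda>_. borel))"
    and abs_moment: "\<And>v. (\<integral>\<^sup>+e. \<integral>\<^sup>+j. ennreal (norm (e j)) \<partial>count_space UNIV \<partial>Q v) \<le> ennreal \<kappa>"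
    and mean_one: "\<And>v. (\<integral>e. (\<Sum>\<^sub>\<infinity>j. e j) \<partial>Q v) = 1"
begin

abbreviation P :: "(nat list \<Rightarrow> nat \<Rightarrow> complex) measure" where
  "P \<equiv> PiM UNIV Q"

abbreviation (input) mean_abs :: "nat list \<Rightarrow> ennreal" where
  "mean_abs v \<equiv> \<integral>\<^sup>+w. ennreal (norm (node_weight w v)) \<partial>P"

text \<open>
  \<open>double_cost T s u\<close> bounds the contribution of the node \<open>u\<close> to the expected Huber function, at scale \<open>s\<close>, of
  the transform with coefficients \<open>T\<close>.
\<close>
abbreviation (input) double_cost :: "((nat list \<Rightarrow> nat \<Rightarrow> complex) \<Rightarrow> nat list \<Rightarrow> complex) \<Rightarrow> real \<Rightarrow> nat list \<Rightarrow> ennreal" where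
  "double_cost T s u \<equiv> \<integral>\<^sup>+w. ennreal (2 * min_sq (norm (T w u * excess (w u)) / s)) \<partial>P"

lemma prob_P: "prob_space P" by (rule prob_space_PiM) (rule prob_Q)

lemma space_Q [simp]: "space (Q v) = UNIV"
  using sets_eq_imp_space_eq[OF sets_Q] by (simp add: space_PiM)

lemma space_P [simp]: "space P = UNIV"
  by (simp add: space_PiM)

lemma measurable_entry [measurable]: "(\<lambda>e. e j) \<in> borel_measurable (Q v)"
  by (subst measurable_cong_sets[OF sets_Q refl]) simp

lemma measurable_node [measurable]: "(\<lambda>w. w v) \<in> P \<rightarrow>\<^sub>M Q v"
  by simp

lemma measurable_node_entry [measurable]: "(\<lambda>w. w v j) \<in> borel_measurable P"
  by (rule measurable_compose[OF measurable_node measurable_entry])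

lemma measurable_node_weight [measurable]: "(\<lambda>w. node_weight w v) \<in> borel_measurable P"
  unfolding node_weight_def by measurable

lemma measurable_excess [measurable]: "excess \<in> borel_measurable (Q v)"
  unfolding excess_def[abs_def]
  by (intro borel_measurable_diff measurable_infsum) auto

lemma measurable_excess_node [measurable]: "(\<lambda>w. excess (w v)) \<in> borel_measurable P"
  by (rule measurable_compose[OF measurable_node measurable_excess])

lemma integrable_offspring_sum: "integrable (Q v) (\<lambda>e. \<Sum>\<^sub>\<infinity>j. e j)"
proof (rule integrableI_bounded)
  show "(\<lambda>e. \<Sum>\<^sub>\<infinity>j. e j) \<in> borel_measurable (Q v)"
    by (rule measurable_infsum) auto
  have "(\<integral>\<^sup>+e. ennreal (norm (\<Sum>\<^sub>\<infinity>j. e j)) \<partial>Q v) \<le> ennreal \<kappa>"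
    by (rule order_trans[OF nn_integral_mono[OF norm_infsum_le_nn_integral] abs_moment])
  then show "(\<integral>\<^sup>+e. ennreal (norm (\<Sum>\<^sub>\<infinity>j. e j)) \<partial>Q v) < \<infinity>"
    using ennreal_less_top le_less_trans by (metis infinity_ennreal_def)
qed

lemma integrable_excess: "integrable (Q v) excess"
  and integral_excess: "(\<integral>e. excess e \<partial>Q v) = 0"
proof -
  interpret prob_space "Q v" by (rule prob_Q)
  show "integrable (Q v) excess"
    unfolding excess_def[abs_def] using integrable_offspring_sum by simp
  show "(\<integral>e. excess e \<partial>Q v) = 0"
    unfolding excess_def using integrable_offspring_sum mean_one by (simp add: prob_space[unfolded space_Q])
qed

text \<open>
  The coefficient at \<open>v\<close> is unaffected by redrawing the offspring weights of \<open>v\<close> itself or of any other node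
  in the same or a later generation.
\<close>
definition predictable :: "((nat list \<Rightarrow> nat \<Rightarrow> complex) \<Rightarrow> nat list \<Rightarrow> 'c) \<Rightarrow> bool" where
  "predictable H \<longleftrightarrow> (\<forall>w v u e. length v \<le> length u \<longrightarrow> H (w(u := e)) v = H w v)"

lemma predictableD: "predictable H \<Longrightarrow> length v \<le> length u \<Longrightarrow> H (w(u := e)) v = H w v"
  by (simp add: predictable_def)

text \<open>
  The nodes are removed in order of decreasing length: the excess at a longest node is centred and
  independent of its coefficient and of all other terms of the sum.
\<close>
lemma huber_transform_finite:
  assumes meas [measurable]: "\<And>v. (\<lambda>w. H w v) \<in> borel_measurable P"
    and pred: "predictable H" and "finite A"
  shows "(\<integral>\<^sup>+w. ennreal (huber (\<Sum>u\<in>A. H w u * excess (w u))) \<partial>P)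
    \<le> (\<Sum>u\<in>A. \<integral>\<^sup>+w. ennreal (2 * min_sq (norm (H w u * excess (w u)))) \<partial>P)"
  using \<open>finite A\<close>
proof (induction A rule: finite_ranking_induct[where f = length])
  case empty
  then show ?case by simp
next
  case (insert x A)
  show ?case
  proof (cases "x \<in> A")
    case True
    then show ?thesis using insert.IH by (simp add: insert_absorb)
  next
    case False
    define G where "G w = (\<Sum>u\<in>A. H w u * excess (w u))" for w
    have [measurable]: "G \<in> borel_measurable P" unfolding G_def[abs_def] by measurable
    have Gx: "G (w(x := e)) = G w" for w e
      unfolding G_def
    proof (rule sum.cong)
      fix u assume "u \<in> A"
      then have "u \<noteq> x" "length u \<le> length x" using False insert.hyps by auto
      then show "H (w(x := e)) u * excess ((w(x := e)) u) = H w u * excess (w u)"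
        by (simp add: predictableD[OF pred])
    qed simp
    have Hx: "H (w(x := e)) x = H w x" for w e by (simp add: predictableD[OF pred])
    have "(\<integral>\<^sup>+w. ennreal (huber (\<Sum>u\<in>insert x A. H w u * excess (w u))) \<partial>P)
      = (\<integral>\<^sup>+w. ennreal (huber (G w + H w x * excess (w x))) \<partial>P)"
      using False insert.hyps by (simp add: G_def add.commute)
    also have "\<dots> = (\<integral>\<^sup>+w. \<integral>\<^sup>+e. ennreal (huber (G w + H w x * excess e)) \<partial>Q x \<partial>P)"
      by (subst nn_integral_PiM_resample[of Q _ x, OF prob_Q]) (simp_all add: Gx Hx)
    also have "\<dots> \<le> (\<integral>\<^sup>+w. ennreal (huber (G w)) + (\<integral>\<^sup>+e. ennreal (2 * min_sq (norm (H w x * excess e))) \<partial>Q x) \<partial>P)"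
      by (intro nn_integral_mono nn_integral_huber_increment prob_Q integrable_excess integral_excess)
    also have "\<dots> = (\<integral>\<^sup>+w. ennreal (huber (G w)) \<partial>P)
       + (\<integral>\<^sup>+w. (\<integral>\<^sup>+e. ennreal (2 * min_sq (norm (H w x * excess e))) \<partial>Q x) \<partial>P)"
    proof (rule nn_integral_add)
      interpret sigma_finite_measure "Q x" by (rule prob_space_imp_sigma_finite[OF prob_Q])
      show "(\<lambda>w. \<integral>\<^sup>+e. ennreal (2 * min_sq (norm (H w x * excess e))) \<partial>Q x) \<in> borel_measurable P"
        by measurable
    qed measurable
    also have "(\<integral>\<^sup>+w. (\<integral>\<^sup>+e. ennreal (2 * min_sq (norm (H w x * excess e))) \<partial>Q x) \<partial>P)
       = (\<integral>\<^sup>+w. ennreal (2 * min_sq (norm (H w x * excess (w x)))) \<partial>P)"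
      by (subst (2) nn_integral_PiM_resample[of Q _ x, OF prob_Q]) (simp_all add: Hx)
    also have "(\<integral>\<^sup>+w. ennreal (huber (G w)) \<partial>P)
      \<le> (\<Sum>u\<in>A. \<integral>\<^sup>+w. ennreal (2 * min_sq (norm (H w u * excess (w u)))) \<partial>P)"
      using insert.IH by (simp add: G_def)
    finally show ?thesis using False insert.hyps by (simp add: add.commute add_right_mono)
  qed
qed

lemma filterlim_finite_exhaustion:
  fixes B :: "nat list set"
  shows "filterlim (\<lambda>i. B \<inter> from_nat ` {..<i}) (finite_subsets_at_top B) sequentially"
  unfolding filterlim_iff eventually_finite_subsets_at_top
proof (intro allI impI)
  fix R :: "nat list set \<Rightarrow> bool"
  assume "\<exists>X. finite X \<and> X \<subseteq> B \<and> (\<forall>Y. finite Y \<and> X \<subseteq> Y \<and> Y \<subseteq> B \<longrightarrow> R Y)"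
  then obtain X where X: "finite X" "X \<subseteq> B" "\<forall>Y. finite Y \<and> X \<subseteq> Y \<and> Y \<subseteq> B \<longrightarrow> R Y"
    by (elim exE conjE)
  have "R (B \<inter> from_nat ` {..<i})" if i: "i \<ge> Suc (Max (insert 0 (to_nat ` X)))" for i
  proof (rule X(3)[rule_format], intro conjI)
    show "X \<subseteq> B \<inter> from_nat ` {..<i}"
    proof
      fix x assume x: "x \<in> X"
      then have "to_nat x \<le> Max (insert 0 (to_nat ` X))" using X(1) by (intro Max_ge) auto
      then have "to_nat x < i" using i by simp
      then have "from_nat (to_nat x) \<in> (from_nat ` {..<i} :: nat list set)" by (intro imageI) simp
      then have "x \<in> from_nat ` {..<i}" by simp
      then show "x \<in> B \<inter> from_nat ` {..<i}" using x X(2) by blast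
    qed
  qed auto
  then show "\<forall>\<^sub>F i in sequentially. R (B \<inter> from_nat ` {..<i})"
    by (rule eventually_sequentiallyI)
qed

lemma huber_transform:
  assumes meas [measurable]: "\<And>v. (\<lambda>w. H w v) \<in> borel_measurable P"
    and pred: "predictable H"
    and summ: "AE w in P. (\<lambda>u. H w u * excess (w u)) summable_on B"
  shows "(\<integral>\<^sup>+w. ennreal (huber (\<Sum>\<^sub>\<infinity>u\<in>B. H w u * excess (w u))) \<partial>P)
    \<le> (\<integral>\<^sup>+u. \<integral>\<^sup>+w. ennreal (2 * min_sq (norm (H w u * excess (w u)))) \<partial>P \<partial>count_space B)"
proof -
  define A where "A i = B \<inter> from_nat ` {..<i}" for i :: nat
  have fin: "finite (A i)" for i by (simp add: A_def)
  define c where "c u = (\<integral>\<^sup>+w. ennreal (2 * min_sq (norm (H w u * excess (w u)))) \<partial>P)" for u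
  have "(\<integral>\<^sup>+w. ennreal (huber (\<Sum>\<^sub>\<infinity>u\<in>B. H w u * excess (w u))) \<partial>P)
     = (\<integral>\<^sup>+w. liminf (\<lambda>i. ennreal (huber (\<Sum>u\<in>A i. H w u * excess (w u)))) \<partial>P)"
  proof (rule nn_integral_cong_AE)
    show "AE w in P. ennreal (huber (\<Sum>\<^sub>\<infinity>u\<in>B. H w u * excess (w u)))
        = liminf (\<lambda>i. ennreal (huber (\<Sum>u\<in>A i. H w u * excess (w u))))"
      using summ
    proof eventually_elim
      case (elim w)
      then have "((\<lambda>u. H w u * excess (w u)) has_sum (\<Sum>\<^sub>\<infinity>u\<in>B. H w u * excess (w u))) B"
        by (rule has_sum_infsum)
      then have "(\<lambda>i. \<Sum>u\<in>A i. H w u * excess (w u)) \<longlonglongrightarrow> (\<Sum>\<^sub>\<infinity>u\<in>B. H w u * excess (w u))"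
        unfolding has_sum_def A_def by (rule filterlim_compose[OF _ filterlim_finite_exhaustion])
      then have "(\<lambda>i. ennreal (huber (\<Sum>u\<in>A i. H w u * excess (w u))))
          \<longlonglongrightarrow> ennreal (huber (\<Sum>\<^sub>\<infinity>u\<in>B. H w u * excess (w u)))"
        by (intro tendsto_ennrealI isCont_tendsto_compose[OF continuous_huber])
      then show ?case by (simp add: lim_imp_Liminf)
    qed
  qed
  also have "\<dots> \<le> liminf (\<lambda>i. \<integral>\<^sup>+w. ennreal (huber (\<Sum>u\<in>A i. H w u * excess (w u))) \<partial>P)"
    by (rule nn_integral_liminf) measurable
  also have "\<dots> \<le> liminf (\<lambda>i::nat. \<integral>\<^sup>+u. c u \<partial>count_space B)"
  proof (rule Liminf_mono, rule always_eventually, rule allI)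
    fix i
    have "(\<integral>\<^sup>+w. ennreal (huber (\<Sum>u\<in>A i. H w u * excess (w u))) \<partial>P) \<le> (\<Sum>u\<in>A i. c u)"
      unfolding c_def by (rule huber_transform_finite[OF meas pred fin])
    also have "\<dots> = (\<integral>\<^sup>+u. c u * indicator (A i) u \<partial>count_space UNIV)"
      by (simp add: nn_integral_count_space_indicator[symmetric] nn_integral_count_space_finite fin)
    also have "\<dots> \<le> (\<integral>\<^sup>+u. c u * indicator B u \<partial>count_space UNIV)"
      by (intro nn_integral_mono) (auto simp: A_def split: split_indicator)
    finally show "(\<integral>\<^sup>+w. ennreal (huber (\<Sum>u\<in>A i. H w u * excess (w u))) \<partial>P) \<le> (\<integral>\<^sup>+u. c u \<partial>count_space B)"
      by (simp add: nn_integral_count_space_indicator)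
  qed
  finally show ?thesis by (simp add: c_def Liminf_const)
qed

text \<open>
  For \<open>T = node_weight\<close> this is the difference of the additive sums of the generations \<open>k\<close> and \<open>m\<close>.
\<close>
definition increment :: "((nat list \<Rightarrow> nat \<Rightarrow> complex) \<Rightarrow> nat list \<Rightarrow> complex) \<Rightarrow> nat \<Rightarrow> nat \<Rightarrow>
    (nat list \<Rightarrow> nat \<Rightarrow> complex) \<Rightarrow> complex" where
  "increment T m k w = (\<Sum>\<^sub>\<infinity>u\<in>{u. m \<le> length u \<and> length u < k}. T w u * excess (w u))"

lemma measurable_increment [measurable]:
  assumes [measurable]: "\<And>v. (\<lambda>w. T w v) \<in> borel_measurable P"
  shows "increment T m k \<in> borel_measurable P"
  unfolding increment_def[abs_def] by (rule measurable_infsum) simp_all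

lemma increment_upd:
  assumes "predictable T" "k \<le> length u"
  shows "increment T m k (w(u := e)) = increment T m k w"
  unfolding increment_def using assms(2)
  by (intro infsum_cong) (auto simp: predictableD[OF assms(1)])

text \<open>
  A stopped transform is again a transform: multiplying the coefficients by the indicator that
  the level \<open>s\<close> has not been exceeded so far keeps them predictable, and at time \<open>n\<close> the transform
  then has the value of the first increment above \<open>s\<close>. Hence the bound for a fixed time controls the
  supremum.
\<close>
lemma maximal_inequality:
  assumes meas [measurable]: "\<And>v. (\<lambda>w. T w v) \<in> borel_measurable P"
    and pred: "predictable T"
    and summ: "AE w in P. \<forall>n. (\<lambda>u. T w u * excess (w u)) summable_on {u :: nat list. length u < n}"
    and s: "s > 0"
  shows "emeasure P {w. \<exists>k\<ge>m. norm (increment T m k w) > s} * ennreal (sqrt 2 - 1)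
    \<le> (\<integral>\<^sup>+u. double_cost T s u \<partial>count_space {u :: nat list. m \<le> length u})"
    (is "_ \<le> ?R")
proof -
  define E where "E n = {w. \<exists>k\<ge>m. k \<le> n \<and> norm (increment T m k w) > s}" for n
  have E [measurable]: "E n \<in> sets P" for n
  proof -
    have "E n = {w \<in> space P. \<exists>k\<in>{m..n}. norm (increment T m k w) > s}"
      unfolding E_def by (simp add: Bex_def conj_assoc)
    also have "\<dots> \<in> sets P" by measurable
    finally show ?thesis .
  qed
  have bound: "emeasure P (E n) * ennreal (sqrt 2 - 1) \<le> ?R" for n
  proof -
    \<comment> \<open>the coefficients are stopped at the first exceedance and scaled by s\<close>
    define ok where "ok w u \<longleftrightarrow> m \<le> length u \<and> length u < n \<and> (\<forall>k\<in>{m..length u}. norm (increment T m k w) \<le> s)"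
      for w and u :: "nat list"
    define H where "H w u = (if ok w u then T w u / complex_of_real s else 0)" for w u
    define B where "B = {u :: nat list. m \<le> length u \<and> length u < n}"
    have Hm [measurable]: "(\<lambda>w. H w u) \<in> borel_measurable P" for u
      unfolding H_def ok_def by measurable
    have Hp: "predictable H"
      unfolding predictable_def H_def ok_def
      by (auto simp: predictableD[OF pred] increment_upd[OF pred])
    have Hle: "norm (H w u * excess (w u)) \<le> norm (T w u * excess (w u)) / s" for w u
      using s by (auto simp: H_def norm_mult norm_divide)
    have Hs: "AE w in P. (\<lambda>u. H w u * excess (w u)) summable_on B"
      using summ
    proof eventually_elim
      case (elim w)
      then have "(\<lambda>u. T w u * excess (w u)) summable_on {u :: nat list. length u < n}" by blast
      then have "(\<lambda>u. T w u * excess (w u)) summable_on B"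
        by (rule summable_on_subset_banach) (auto simp: B_def)
      then have "(\<lambda>u. norm (T w u * excess (w u)) * (1 / s)) summable_on B"
        unfolding summable_on_iff_abs_summable_on_complex by (rule summable_on_cmult_left)
      then have "(\<lambda>u. norm (H w u * excess (w u))) summable_on B"
        by (rule summable_on_comparison_test) (use Hle in auto)
      then show ?case by (rule abs_summable_summable)
    qed
    \<comment> \<open>after division by s the stopped transform has modulus at least 1, where huber is at least sqrt 2 - 1\<close>
    have big: "sqrt 2 - 1 \<le> huber (\<Sum>\<^sub>\<infinity>u\<in>B. H w u * excess (w u))" if w: "w \<in> E n" for w
    proof -
      define k where "k = (LEAST k. m \<le> k \<and> norm (increment T m k w) > s)"
      obtain k' where k': "m \<le> k'" "k' \<le> n" "norm (increment T m k' w) > s" using w by (auto simp: E_def)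
      have k: "m \<le> k" "norm (increment T m k w) > s"
        using LeastI[of "\<lambda>k. m \<le> k \<and> norm (increment T m k w) > s" k'] k' unfolding k_def by auto
      have kn: "k \<le> n"
        using Least_le[of "\<lambda>k. m \<le> k \<and> norm (increment T m k w) > s" k'] k' unfolding k_def by auto
      have before: "norm (increment T m i w) \<le> s" if "m \<le> i" "i < k" for i
        using not_less_Least[of i "\<lambda>k. m \<le> k \<and> norm (increment T m k w) > s"] that unfolding k_def by auto
      have ok: "ok w u \<longleftrightarrow> m \<le> length u \<and> length u < k" if "u \<in> B" for u
        using that k kn before unfolding ok_def B_def by (auto simp: not_le[symmetric])
      have "(\<Sum>\<^sub>\<infinity>u\<in>B. H w u * excess (w u))
         = (\<Sum>\<^sub>\<infinity>u\<in>{u. m \<le> length u \<and> length u < k}. (1 / complex_of_real s) * (T w u * excess (w u)))"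
      proof (rule infsum_cong_neutral)
        fix u assume "u \<in> {u. m \<le> length u \<and> length u < k} - B"
        then show "1 / complex_of_real s * (T w u * excess (w u)) = 0" using kn by (auto simp: B_def)
      qed (use ok in \<open>auto simp: H_def\<close>)
      also have "\<dots> = (1 / complex_of_real s) * increment T m k w"
        unfolding increment_def by (rule infsum_cmult_right')
      finally have "norm (\<Sum>\<^sub>\<infinity>u\<in>B. H w u * excess (w u)) = norm (increment T m k w) / s"
        using s by (simp add: norm_mult norm_divide)
      then have "1 \<le> norm (\<Sum>\<^sub>\<infinity>u\<in>B. H w u * excess (w u))" using k s by simp
      then have "2 \<le> 1 + (norm (\<Sum>\<^sub>\<infinity>u\<in>B. H w u * excess (w u)))\<^sup>2"
        using one_le_power[of "norm (\<Sum>\<^sub>\<infinity>u\<in>B. H w u * excess (w u))" 2] by simp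
      then show ?thesis unfolding huber_def by simp
    qed
    have "emeasure P (E n) * ennreal (sqrt 2 - 1) = (\<integral>\<^sup>+w. ennreal (sqrt 2 - 1) * indicator (E n) w \<partial>P)"
      by (subst nn_integral_cmult) (simp_all add: mult.commute)
    also have "\<dots> \<le> (\<integral>\<^sup>+w. ennreal (huber (\<Sum>\<^sub>\<infinity>u\<in>B. H w u * excess (w u))) \<partial>P)"
      by (intro nn_integral_mono) (auto split: split_indicator intro!: ennreal_leI big)
    also have "\<dots> \<le> (\<integral>\<^sup>+u. \<integral>\<^sup>+w. ennreal (2 * min_sq (norm (H w u * excess (w u)))) \<partial>P \<partial>count_space B)"
      by (rule huber_transform[OF Hm Hp Hs])
    also have "\<dots> \<le> (\<integral>\<^sup>+u. double_cost T s u \<partial>count_space B)"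
      by (intro nn_integral_mono ennreal_leI mult_left_mono min_sq_mono Hle) auto
    also have "\<dots> \<le> ?R"
      by (subst (1 2) nn_integral_count_space_indicator)
         (auto simp: B_def intro!: nn_integral_mono split: split_indicator)
    finally show ?thesis .
  qed
  have "{w. \<exists>k\<ge>m. norm (increment T m k w) > s} = (\<Union>n. E n)" by (auto simp: E_def)
  moreover have "incseq E" by (auto simp: E_def incseq_def intro: order_trans)
  ultimately have "emeasure P {w. \<exists>k\<ge>m. norm (increment T m k w) > s} = (SUP n. emeasure P (E n))"
    using SUP_emeasure_incseq[of E P] by (simp add: image_subset_iff)
  then have "emeasure P {w. \<exists>k\<ge>m. norm (increment T m k w) > s} * ennreal (sqrt 2 - 1)
     = (SUP n. emeasure P (E n) * ennreal (sqrt 2 - 1))"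
    by (simp add: SUP_mult_right_ennreal)
  also have "\<dots> \<le> ?R" by (rule SUP_least) (rule bound)
  finally show ?thesis .
qed

end

section \<open>Additive sums over the generations\<close>

context cascade begin

lemma nn_integral_children:
  assumes f [measurable]: "f \<in> borel_measurable P"
    and indep: "\<And>w e. f (w(v := e)) = f w"
    and g [measurable]: "g \<in> borel_measurable borel"
  shows "(\<integral>\<^sup>+j. \<integral>\<^sup>+w. f w * g (w v j) \<partial>P \<partial>count_space UNIV)
    = (\<integral>\<^sup>+w. f w \<partial>P) * (\<integral>\<^sup>+e. \<integral>\<^sup>+j. g (e j) \<partial>count_space UNIV \<partial>Q v)"
proof -
  have m: "(\<lambda>e. \<integral>\<^sup>+j. g (e j) \<partial>count_space UNIV) \<in> borel_measurable (Q v)"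
    by (rule measurable_nn_integral_count) simp_all
  have "(\<integral>\<^sup>+j. \<integral>\<^sup>+w. f w * g (w v j) \<partial>P \<partial>count_space UNIV)
    = (\<integral>\<^sup>+w. \<integral>\<^sup>+j. f w * g (w v j) \<partial>count_space UNIV \<partial>P)"
    by (rule nn_integral_count_space_nn_integral[symmetric]) simp_all
  also have "\<dots> = (\<integral>\<^sup>+w. f w * (\<integral>\<^sup>+j. g (w v j) \<partial>count_space UNIV) \<partial>P)"
    by (simp add: nn_integral_cmult)
  also have "\<dots> = (\<integral>\<^sup>+w. f w \<partial>P) * (\<integral>\<^sup>+e. \<integral>\<^sup>+j. g (e j) \<partial>count_space UNIV \<partial>Q v)"
    by (rule nn_integral_PiM_resample_mult[where g = "\<lambda>e. \<integral>\<^sup>+j. g (e j) \<partial>count_space UNIV"])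
       (use prob_Q m indep in simp_all)
  finally show ?thesis .
qed

lemma level_abs_moment:
  "(\<integral>\<^sup>+v. mean_abs v \<partial>count_space (level n)) \<le> ennreal \<kappa> ^ n"
proof (induction n)
  case 0
  interpret prob_space P by (rule prob_P)
  show ?case
    using emeasure_space_1 by (simp add: level_0 nn_integral_count_space_finite)
next
  case (Suc n)
  have "(\<integral>\<^sup>+v. mean_abs v \<partial>count_space (level (Suc n)))
    = (\<integral>\<^sup>+v. \<integral>\<^sup>+j. \<integral>\<^sup>+w. ennreal (norm (node_weight w v)) * ennreal (norm (w v j)) \<partial>P \<partial>count_space UNIV \<partial>count_space (level n))"
    by (simp add: nn_integral_level_Suc norm_mult ennreal_mult)
  also have "\<dots> = (\<integral>\<^sup>+v. (mean_abs v) * (\<integral>\<^sup>+e. \<integral>\<^sup>+j. ennreal (norm (e j)) \<partial>count_space UNIV \<partial>Q v) \<partial>count_space (level n))"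
    by (intro nn_integral_cong nn_integral_children) (simp_all add: node_weight_upd)
  also have "\<dots> \<le> (\<integral>\<^sup>+v. (mean_abs v) * ennreal \<kappa> \<partial>count_space (level n))"
    by (intro nn_integral_mono mult_left_mono abs_moment) simp
  also have "\<dots> = (\<integral>\<^sup>+v. (mean_abs v) \<partial>count_space (level n)) * ennreal \<kappa>"
    by (simp add: nn_integral_multc)
  also have "\<dots> \<le> ennreal \<kappa> ^ n * ennreal \<kappa>"
    by (intro mult_right_mono Suc.IH) simp
  finally show ?case by (simp add: mult.commute)
qed

definition level_summable :: "(nat list \<Rightarrow> nat \<Rightarrow> complex) \<Rightarrow> bool" where
  "level_summable w \<longleftrightarrow> (\<forall>n. node_weight w summable_on level n)"

lemma AE_level_summable: "AE w in P. level_summable w"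
  unfolding level_summable_def AE_all_countable summable_on_iff_nn_integral
proof
  fix n
  have [measurable]: "(\<lambda>w. \<integral>\<^sup>+v. ennreal (norm (node_weight w v)) \<partial>count_space (level n)) \<in> borel_measurable P"
    by (rule measurable_nn_integral_count) simp_all
  have "(\<integral>\<^sup>+w. \<integral>\<^sup>+v. ennreal (norm (node_weight w v)) \<partial>count_space (level n) \<partial>P)
    = (\<integral>\<^sup>+v. mean_abs v \<partial>count_space (level n))"
    by (rule nn_integral_count_space_nn_integral) simp_all
  also have "\<dots> \<le> ennreal \<kappa> ^ n" by (rule level_abs_moment)
  also have "\<dots> < \<infinity>" by (simp add: power_less_top_ennreal)
  finally have "(\<integral>\<^sup>+w. \<integral>\<^sup>+v. ennreal (norm (node_weight w v)) \<partial>count_space (level n) \<partial>P) \<noteq> \<infinity>" by simp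
  then have "AE w in P. (\<integral>\<^sup>+v. ennreal (norm (node_weight w v)) \<partial>count_space (level n)) \<noteq> \<infinity>"
    by (intro nn_integral_PInf_AE) simp_all
  then show "AE w in P. (\<integral>\<^sup>+v. ennreal (norm (node_weight w v)) \<partial>count_space (level n)) < \<infinity>"
    by eventually_elim (simp add: less_top)
qed

definition level_sum :: "nat \<Rightarrow> (nat list \<Rightarrow> nat \<Rightarrow> complex) \<Rightarrow> complex" where
  "level_sum n w = (\<Sum>\<^sub>\<infinity>v\<in>level n. node_weight w v)"

lemma measurable_level_sum [measurable]: "level_sum n \<in> borel_measurable P"
  unfolding level_sum_def[abs_def] by (rule measurable_infsum) simp_all

text \<open>
  The sum over a generation arises from the previous one by replacing each node by its children,
  whose weights sum to that of the node times one plus the excess.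
\<close>
lemma level_sum_step:
  assumes "level_summable w"
  shows "(\<lambda>v. node_weight w v * excess (w v)) summable_on level n"
    and "(\<Sum>\<^sub>\<infinity>v\<in>level n. node_weight w v * excess (w v)) = level_sum (Suc n) w - level_sum n w"
proof -
  have s0: "node_weight w summable_on level n" and s1: "node_weight w summable_on level (Suc n)"
    using assms by (auto simp: level_summable_def)
  have s2: "(\<lambda>p. node_weight w (case p of (v, j) \<Rightarrow> v @ [j])) summable_on level n \<times> UNIV"
    using s1 by (subst summable_on_reindex_bij_betw[OF bij_betw_level_Suc])
  then have s3: "(\<lambda>(v, j). node_weight w v * w v j) summable_on level n \<times> UNIV"
    by (simp add: case_prod_unfold)
  have ch: "(\<Sum>\<^sub>\<infinity>j. node_weight w v * w v j) = node_weight w v * (excess (w v) + 1)" for v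
    by (simp add: infsum_cmult_right' excess_def)
  have s4: "(\<lambda>v. node_weight w v * (excess (w v) + 1)) summable_on level n"
    using summable_on_Sigma_banach[OF s3] by (simp add: ch)
  have "level_sum (Suc n) w = (\<Sum>\<^sub>\<infinity>p\<in>level n \<times> UNIV. node_weight w (case p of (v, j) \<Rightarrow> v @ [j]))"
    unfolding level_sum_def by (subst infsum_reindex_bij_betw[OF bij_betw_level_Suc]) simp
  also have "\<dots> = (\<Sum>\<^sub>\<infinity>v\<in>level n. node_weight w v * (excess (w v) + 1))"
    using infsum_Sigma'_banach[OF s3] by (simp add: ch case_prod_unfold)
  finally have e: "(\<Sum>\<^sub>\<infinity>v\<in>level n. node_weight w v * (excess (w v) + 1)) = level_sum (Suc n) w" ..
  have eq: "node_weight w v * excess (w v) = node_weight w v * (excess (w v) + 1) + - node_weight w v" for v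
    by (simp add: algebra_simps)
  have s5: "(\<lambda>v. - node_weight w v) summable_on level n" using s0 by (simp add: summable_on_uminus)
  show "(\<lambda>v. node_weight w v * excess (w v)) summable_on level n"
    unfolding eq by (rule summable_on_add[OF s4 s5])
  show "(\<Sum>\<^sub>\<infinity>v\<in>level n. node_weight w v * excess (w v)) = level_sum (Suc n) w - level_sum n w"
    unfolding eq infsum_add[OF s4 s5] e by (simp add: infsum_uminus level_sum_def)
qed

lemma summable_below_level:
  assumes "level_summable w"
  shows "(\<lambda>v. node_weight w v * excess (w v)) summable_on {u. length u < n}"
proof (induction n)
  case (Suc n)
  have "{u :: nat list. length u < Suc n} = {u. length u < n} \<union> level n" by (auto simp: level_def)
  moreover have "{u :: nat list. length u < n} \<inter> level n = {}" by (auto simp: level_def)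
  ultimately show ?case
    using summable_on_Un_disjoint[OF Suc level_sum_step(1)[OF assms]] by simp
qed simp

lemma increment_node_weight:
  assumes "level_summable w" "m \<le> k"
  shows "increment node_weight m k w = level_sum k w - level_sum m w"
  using assms(2)
proof (induction k rule: dec_induct)
  case base
  have "{u :: nat list. m \<le> length u \<and> length u < m} = {}" by auto
  then have "increment node_weight m m w = 0" by (simp only: increment_def infsum_empty)
  then show ?case by simp
next
  case (step k)
  have eq: "{u :: nat list. m \<le> length u \<and> length u < Suc k} = {u. m \<le> length u \<and> length u < k} \<union> level k"
    using step.hyps by (auto simp: level_def)
  have s: "(\<lambda>v. node_weight w v * excess (w v)) summable_on {u. m \<le> length u \<and> length u < k}"
    by (rule summable_on_subset_banach[OF summable_below_level[OF assms(1), of k]]) auto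
  have "increment node_weight m (Suc k) w
    = increment node_weight m k w + (\<Sum>\<^sub>\<infinity>v\<in>level k. node_weight w v * excess (w v))"
    unfolding increment_def eq
    by (rule infsum_Un_disjoint[OF s level_sum_step(1)[OF assms(1)]]) (auto simp: level_def)
  then show ?case using step.IH level_sum_step(2)[OF assms(1)] by simp
qed

lemma level_sum_0 [simp]: "level_sum 0 w = 1"
  by (simp add: level_sum_def level_0)

text \<open>
  A line of descent is killed when it first reaches a weight above \<open>t\<close>.
\<close>
definition alive :: "real \<Rightarrow> (nat list \<Rightarrow> nat \<Rightarrow> complex) \<Rightarrow> nat list \<Rightarrow> bool" where
  "alive t w v \<longleftrightarrow> (\<forall>k\<le>length v. norm (node_weight w (take k v)) \<le> t)"

lemma alive_snoc: "alive t w (v @ [j]) \<longleftrightarrow> alive t w v \<and> norm (node_weight w v * w v j) \<le> t"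
  unfolding alive_def by (auto simp: le_Suc_eq simp flip: node_weight_snoc)

lemma alive_upd: "length v \<le> length u \<Longrightarrow> alive t (w(u := e)) v = alive t w v"
  unfolding alive_def by (auto simp: node_weight_upd)

lemma measurable_alive [measurable]: "Measurable.pred P (\<lambda>w. alive t w v)"
  unfolding alive_def by measurable

definition truncated_weight :: "real \<Rightarrow> (nat list \<Rightarrow> nat \<Rightarrow> complex) \<Rightarrow> nat list \<Rightarrow> complex" where
  "truncated_weight t w v = (if alive t w v then node_weight w v else 0)"

lemma measurable_truncated_weight [measurable]: "(\<lambda>w. truncated_weight t w v) \<in> borel_measurable P"
  unfolding truncated_weight_def by measurable

lemma predictable_truncated_weight: "predictable (truncated_weight t)"
  by (simp add: predictable_def truncated_weight_def alive_upd node_weight_upd)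

end

section \<open>The spine and the truncated weights\<close>

text \<open>
  The law \<open>\<nu>\<close> is that of the logarithm of a child's weight when the child is chosen with
  probability proportional to the \<open>\<alpha>\<close>-th power of the modulus of the weight. It is a probability
  measure by the criticality of \<open>\<alpha>\<close>.
\<close>
locale spinal_cascade = cascade Q \<kappa> + random_walk \<nu>
  for Q \<kappa> \<nu> +
  fixes \<alpha> :: real and \<rho> :: "complex measure"
  assumes alpha: "1 < \<alpha>" "\<alpha> < 2"
    and spine: "\<And>v g. g \<in> borel_measurable borel \<Longrightarrow>
      (\<integral>\<^sup>+e. \<integral>\<^sup>+j. ennreal (norm (e j) powr \<alpha>) * g (ln (norm (e j))) \<partial>count_space UNIV \<partial>Q v) = (\<integral>\<^sup>+s. g s \<partial>\<nu>)"
    and steps_down: "emeasure \<nu> {..<0} \<noteq> 0"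
    and excess_law: "\<And>v. distr (Q v) borel excess = \<rho>"
    and excess_moment: "(\<integral>\<^sup>+z. ennreal (norm z powr \<alpha> * (1 + log_plus (norm z))\<^sup>2) \<partial>\<rho>) < \<infinity>"
begin

abbreviation (input) alive_mean :: "real \<Rightarrow> (real \<Rightarrow> ennreal) \<Rightarrow> nat list \<Rightarrow> ennreal" where
  "alive_mean t g v \<equiv>
     \<integral>\<^sup>+w. (if alive t w v then ennreal (norm (node_weight w v) powr \<alpha>) * g (ln (norm (node_weight w v))) else 0) \<partial>P"

abbreviation (input) truncated_cost :: "real \<Rightarrow> real \<Rightarrow> nat list \<Rightarrow> ennreal" where
  "truncated_cost t s u \<equiv> \<integral>\<^sup>+w. ennreal (min_sq (norm (truncated_weight t w u * excess (w u)) / s)) \<partial>P"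

lemma spine_children:
  assumes f [measurable]: "f \<in> borel_measurable P"
    and indep: "\<And>w e. f (w(v := e)) = f w"
  shows "(\<integral>\<^sup>+j. \<integral>\<^sup>+w. f w * ennreal (norm (w v j) powr \<alpha>) \<partial>P \<partial>count_space UNIV) = (\<integral>\<^sup>+w. f w \<partial>P)"
proof -
  have "(\<integral>\<^sup>+j. \<integral>\<^sup>+w. f w * ennreal (norm (w v j) powr \<alpha>) \<partial>P \<partial>count_space UNIV)
    = (\<integral>\<^sup>+w. f w \<partial>P) * (\<integral>\<^sup>+e. \<integral>\<^sup>+j. ennreal (norm (e j) powr \<alpha>) \<partial>count_space UNIV \<partial>Q v)"
    by (rule nn_integral_children[where g = "\<lambda>z. ennreal (norm z powr \<alpha>)"]) (simp_all add: indep)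
  also have "(\<integral>\<^sup>+e. \<integral>\<^sup>+j. ennreal (norm (e j) powr \<alpha>) \<partial>count_space UNIV \<partial>Q v) = 1"
    using spine[of "\<lambda>_. 1" v] emeasure_space_1 by simp
  finally show ?thesis by simp
qed

text \<open>
  The \<open>\<alpha>\<close>-mass of the nodes that are alive in generation \<open>n\<close> passes to their children: the mass \<open>c n\<close>
  of those that cross the level \<open>t\<close> is lost, the rest is alive in generation \<open>n + 1\<close>. So the lost masses
  sum to at most \<open>1\<close>, and each crossing carries a mass of at least \<open>t powr \<alpha>\<close>.
\<close>
lemma first_crossing_bound:
  assumes "t \<ge> 1"
  shows "emeasure P {w. \<exists>v. norm (node_weight w v) > t} \<le> ennreal (t powr - \<alpha>)"
proof -
  define a where "a n = (\<integral>\<^sup>+v. \<integral>\<^sup>+w. (if alive t w v then ennreal (norm (node_weight w v) powr \<alpha>) else 0) \<partial>P \<partial>count_space (level n))" for n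
  define q where "q v j w = (if alive t w v \<and> norm (node_weight w v * w v j) > t
      then ennreal (norm (node_weight w v * w v j) powr \<alpha>) else 0)" for v j w
  have qm [measurable]: "q v j \<in> borel_measurable P" for v j unfolding q_def[abs_def] by measurable
  define c where "c n = (\<integral>\<^sup>+v. \<integral>\<^sup>+j. \<integral>\<^sup>+w. q v j w \<partial>P \<partial>count_space UNIV \<partial>count_space (level n))" for n
  have step: "c n + a (Suc n) = a n" for n
  proof -
    have "c n + a (Suc n) = (\<integral>\<^sup>+v. \<integral>\<^sup>+j. \<integral>\<^sup>+w. q v j w
        + (if alive t w (v @ [j]) then ennreal (norm (node_weight w (v @ [j])) powr \<alpha>) else 0) \<partial>P \<partial>count_space UNIV \<partial>count_space (level n))"
      unfolding a_def c_def nn_integral_level_Suc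
      by (simp add: nn_integral_add del: node_weight_snoc)
    also have "\<dots> = (\<integral>\<^sup>+v. \<integral>\<^sup>+j. \<integral>\<^sup>+w. (if alive t w v then ennreal (norm (node_weight w v) powr \<alpha>) else 0) * ennreal (norm (w v j) powr \<alpha>) \<partial>P \<partial>count_space UNIV \<partial>count_space (level n))"
      by (intro nn_integral_cong) (auto simp: q_def alive_snoc norm_mult powr_mult ennreal_mult)
    also have "\<dots> = a n"
      unfolding a_def by (intro nn_integral_cong spine_children) (auto simp: alive_upd node_weight_upd)
    finally show ?thesis .
  qed
  interpret PP: prob_space P by (rule prob_P)
  have a0: "a 0 = 1"
    using assms PP.emeasure_space_1
    by (simp add: a_def level_0 nn_integral_count_space_finite alive_def)
  have tele: "(\<Sum>n<m. c n) + a m = 1" for m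
  proof (induction m)
    case (Suc m)
    have "(\<Sum>n<Suc m. c n) + a (Suc m) = (\<Sum>n<m. c n) + (c m + a (Suc m))" by (simp add: add.assoc)
    then show ?case using step Suc by simp
  qed (simp add: a0)
  have "(\<Sum>n. c n) \<le> 1"
  proof (rule suminf_le_const)
    fix m
    show "(\<Sum>n<m. c n) \<le> 1" using tele[of m] by (metis le_iff_add)
  qed simp
  define X where "X = {w. \<exists>v. norm (node_weight w v) > t}"
  have X [measurable]: "X \<in> sets P"
  proof -
    have "X = {w \<in> space P. \<exists>v. norm (node_weight w v) > t}" by (simp add: X_def)
    also have "\<dots> \<in> sets P" by measurable
    finally show ?thesis .
  qed
  have point: "ennreal (t powr \<alpha>) * indicator X w \<le> (\<integral>\<^sup>+v. \<integral>\<^sup>+j. q v j w \<partial>count_space UNIV \<partial>count_space UNIV)" for w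
  proof (cases "w \<in> X")
    case True
    then obtain v0 where "norm (node_weight w v0) > t" by (auto simp: X_def)
    then obtain v where v: "norm (node_weight w v) > t"
        "\<And>u. norm (node_weight w u) > t \<Longrightarrow> length v \<le> length u"
      using ex_has_least_nat[of "\<lambda>v. norm (node_weight w v) > t" v0 length] by blast
    have "v \<noteq> []" using v(1) assms by auto
    then obtain u j where uj: "v = u @ [j]" by (metis rev_exhaust)
    have al: "alive t w u"
      unfolding alive_def
    proof (intro allI impI leI notI)
      fix k assume "t < norm (node_weight w (take k u))"
      from v(2)[OF this] show False by (simp add: uj)
    qed
    have "t powr \<alpha> \<le> norm (node_weight w v) powr \<alpha>"
      using v(1) assms alpha by (intro powr_mono2) auto
    then have "ennreal (t powr \<alpha>) \<le> q u j w"
      using al v(1) by (simp add: q_def uj ennreal_leI)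
    also have "\<dots> \<le> (\<integral>\<^sup>+j. q u j w \<partial>count_space UNIV)"
      by (rule nn_integral_ge_point) simp
    also have "\<dots> \<le> (\<integral>\<^sup>+v. \<integral>\<^sup>+j. q v j w \<partial>count_space UNIV \<partial>count_space UNIV)"
      by (rule nn_integral_ge_point[where p = "\<lambda>v. \<integral>\<^sup>+j. q v j w \<partial>count_space UNIV"]) simp
    finally show ?thesis using True by simp
  qed simp
  have "ennreal (t powr \<alpha>) * emeasure P X = (\<integral>\<^sup>+w. ennreal (t powr \<alpha>) * indicator X w \<partial>P)"
    by (simp add: nn_integral_cmult)
  also have "\<dots> \<le> (\<integral>\<^sup>+w. \<integral>\<^sup>+v. \<integral>\<^sup>+j. q v j w \<partial>count_space UNIV \<partial>count_space UNIV \<partial>P)"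
    by (intro nn_integral_mono point)
  also have "\<dots> = (\<integral>\<^sup>+v. \<integral>\<^sup>+w. \<integral>\<^sup>+j. q v j w \<partial>count_space UNIV \<partial>P \<partial>count_space UNIV)"
    by (rule nn_integral_count_space_nn_integral) (auto intro!: measurable_nn_integral_count)
  also have "\<dots> = (\<integral>\<^sup>+v. \<integral>\<^sup>+j. \<integral>\<^sup>+w. q v j w \<partial>P \<partial>count_space UNIV \<partial>count_space UNIV)"
    by (intro nn_integral_cong nn_integral_count_space_nn_integral) auto
  also have "\<dots> = (\<Sum>n. c n)"
    unfolding c_def by (rule nn_integral_all_levels)
  also have "\<dots> \<le> 1" by fact
  finally have le: "ennreal (t powr \<alpha>) * emeasure P X \<le> 1" .
  have "emeasure P X = ennreal (t powr - \<alpha>) * (ennreal (t powr \<alpha>) * emeasure P X)"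
    using assms by (simp add: mult.assoc[symmetric] ennreal_mult[symmetric] powr_add[symmetric])
  also have "\<dots> \<le> ennreal (t powr - \<alpha>) * 1" by (intro mult_left_mono le) simp
  finally show ?thesis by (simp add: X_def)
qed

text \<open>
  Both sides satisfy the same recursion in \<open>n\<close>: by the definition of \<open>\<nu>\<close>, adding the children of a node
  amounts to adding a step of the walk.
\<close>
lemma many_to_one:
  assumes g [measurable]: "g \<in> borel_measurable borel" and t: "t > 0"
  shows "(\<integral>\<^sup>+v. alive_mean t g v \<partial>count_space (level n))
    = (killed_mean (ln t) n g)"
  using g
proof (induction n arbitrary: g)
  case 0
  interpret PP: prob_space P by (rule prob_P)
  interpret PS: prob_space S by (rule prob_S)
  have al: "alive t w [] = (1 \<le> t)" for w by (simp add: alive_def)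
  have wl: "(\<forall>k\<le>0. walk x k \<le> ln t) = (1 \<le> t)" for x using t by simp
  have none: "All ((<) (0 :: nat)) = False" using less_irrefl by blast
  show ?case
    unfolding level_0 using t PP.emeasure_space_1 PS.emeasure_space_1
    by (cases "1 \<le> t") (simp_all add: nn_integral_count_space_finite al none)
next
  case (Suc n)
  define G where "G x = (\<integral>\<^sup>+s. (if x + s \<le> ln t then g (x + s) else 0) \<partial>\<nu>)" for x
  have Gm [measurable]: "G \<in> borel_measurable borel"
  proof -
    have "(\<lambda>y. if y \<le> ln t then g y else 0) \<in> borel_measurable borel"
      using Suc.prems by measurable
    moreover have "(\<lambda>p. fst p + snd p) \<in> borel \<Otimes>\<^sub>M borel \<rightarrow>\<^sub>M (borel :: real measure)"
      by (intro borel_measurable_add measurable_fst measurable_snd)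
    ultimately have "(\<lambda>p. if fst p + snd p \<le> ln t then g (fst p + snd p) else 0) \<in> borel_measurable (borel \<Otimes>\<^sub>M borel)"
      by (rule measurable_compose[rotated])
    then have "(\<lambda>p. if fst p + snd p \<le> ln t then g (fst p + snd p) else 0) \<in> borel_measurable (borel \<Otimes>\<^sub>M \<nu>)"
      by (subst measurable_cong_sets[OF sets_pair_measure_cong[OF refl sets_eq] refl])
    then show ?thesis
      unfolding G_def[abs_def] by (intro borel_measurable_nn_integral) (simp add: case_prod_beta)
  qed
  have child: "(\<integral>\<^sup>+j. alive_mean t g (v @ [j]) \<partial>count_space UNIV)
     = (alive_mean t G v)" for v
  proof -
    define F where "F w e = (\<integral>\<^sup>+j. (if alive t w v \<and> norm (node_weight w v * e j) \<le> t then ennreal (norm (node_weight w v * e j) powr \<alpha>) * g (ln (norm (node_weight w v * e j))) else 0) \<partial>count_space UNIV)" for w and e :: "nat \<Rightarrow> complex"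
    have tm: "(\<lambda>w. if alive t w v \<and> norm (node_weight w v * w v j) \<le> t then ennreal (norm (node_weight w v * w v j) powr \<alpha>) * g (ln (norm (node_weight w v * w v j))) else 0) \<in> borel_measurable P" for j
    proof -
      have [measurable]: "g \<in> borel_measurable borel" by (rule Suc.prems)
      show ?thesis by measurable
    qed
    have Fm: "(\<lambda>w. F w (w v)) \<in> borel_measurable P"
      unfolding F_def by (rule measurable_nn_integral_count[OF _ tm]) simp
    have inner: "(\<integral>\<^sup>+e. F w e \<partial>Q v) = (if alive t w v then ennreal (norm (node_weight w v) powr \<alpha>) * G (ln (norm (node_weight w v))) else 0)" for w
    proof (cases "alive t w v \<and> node_weight w v \<noteq> 0")
      case True
      define y where "y = norm (node_weight w v)"
      have y: "y > 0" using True by (simp add: y_def)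
      define h where "h s = (if ln y + s \<le> ln t then g (ln y + s) else 0)" for s
      have hm [measurable]: "h \<in> borel_measurable borel"
        using Suc.prems unfolding h_def[abs_def] by measurable
      have "F w e = (\<integral>\<^sup>+j. ennreal (y powr \<alpha>) * (ennreal (norm (e j) powr \<alpha>) * h (ln (norm (e j)))) \<partial>count_space UNIV)" for e
        unfolding F_def
      proof (intro nn_integral_cong)
        fix j
        show "(if alive t w v \<and> norm (node_weight w v * e j) \<le> t then ennreal (norm (node_weight w v * e j) powr \<alpha>) * g (ln (norm (node_weight w v * e j))) else 0)
          = ennreal (y powr \<alpha>) * (ennreal (norm (e j) powr \<alpha>) * h (ln (norm (e j))))"
        proof (cases "e j = 0")
          case False
          then have pos: "y * norm (e j) > 0" using y by simp
          have "ln (y * norm (e j)) = ln y + ln (norm (e j))"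
            using y False by (simp add: ln_mult)
          moreover have "y * norm (e j) \<le> t \<longleftrightarrow> ln (y * norm (e j)) \<le> ln t"
            using pos t by simp
          ultimately show ?thesis
            using True by (simp add: norm_mult y_def[symmetric] h_def powr_mult ennreal_mult mult.assoc)
        qed simp
      qed
      then have "(\<integral>\<^sup>+e. F w e \<partial>Q v) = ennreal (y powr \<alpha>) * (\<integral>\<^sup>+e. \<integral>\<^sup>+j. ennreal (norm (e j) powr \<alpha>) * h (ln (norm (e j))) \<partial>count_space UNIV \<partial>Q v)"
        by (simp add: nn_integral_cmult measurable_nn_integral_count)
      also have "\<dots> = ennreal (y powr \<alpha>) * G (ln y)"
        by (subst spine[OF hm]) (simp add: G_def h_def[abs_def])
      finally show ?thesis using True by (simp add: y_def)
    next
      case False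
      have "F w e = (\<integral>\<^sup>+(j :: nat). 0 \<partial>count_space UNIV)" for e
        unfolding F_def using False by (intro nn_integral_cong) auto
      then show ?thesis using False by auto
    qed
    have "(\<integral>\<^sup>+j. alive_mean t g (v @ [j]) \<partial>count_space UNIV)
      = (\<integral>\<^sup>+w. F w (w v) \<partial>P)"
      unfolding F_def alive_snoc node_weight_snoc
      by (rule nn_integral_count_space_nn_integral[OF _ tm, symmetric]) simp
    also have "\<dots> = (\<integral>\<^sup>+w. \<integral>\<^sup>+e. F (w(v := e)) ((w(v := e)) v) \<partial>Q v \<partial>P)"
      by (rule nn_integral_PiM_resample[OF prob_Q Fm])
    also have "\<dots> = (\<integral>\<^sup>+w. \<integral>\<^sup>+e. F w e \<partial>Q v \<partial>P)"
      by (simp add: F_def alive_upd node_weight_upd cong: if_cong)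
    finally show ?thesis by (simp add: inner)
  qed
  have wm: "(\<lambda>x. if \<forall>k\<le>Suc n. walk x k \<le> ln t then g (walk x (Suc n)) else 0) \<in> borel_measurable S"
    using Suc.prems by measurable
  have "(\<integral>\<^sup>+v. alive_mean t g v \<partial>count_space (level (Suc n)))
    = (killed_mean (ln t) n G)"
    unfolding nn_integral_level_Suc child by (rule Suc.IH[OF Gm])
  also have "\<dots> = (\<integral>\<^sup>+x. \<integral>\<^sup>+s. (if \<forall>k\<le>Suc n. walk (x(n := s)) k \<le> ln t then g (walk (x(n := s)) (Suc n)) else 0) \<partial>\<nu> \<partial>S)"
  proof (intro nn_integral_cong)
    fix x :: "nat \<Rightarrow> real"
    show "(if \<forall>k\<le>n. walk x k \<le> ln t then G (walk x n) else 0)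
      = (\<integral>\<^sup>+s. (if \<forall>k\<le>Suc n. walk (x(n := s)) k \<le> ln t then g (walk (x(n := s)) (Suc n)) else 0) \<partial>\<nu>)"
    proof -
      define B where "B \<longleftrightarrow> (\<forall>k\<le>n. walk x k \<le> ln t)"
      have iff: "(\<forall>k\<le>Suc n. walk (x(n := s)) k \<le> ln t) \<longleftrightarrow> B \<and> walk x n + s \<le> ln t" for s
        by (auto simp: B_def le_Suc_eq walk_upd walk_Suc)
      have last: "walk (x(n := s)) (Suc n) = walk x n + s" for s
        by (simp add: walk_upd walk_Suc)
      show ?thesis
        unfolding iff last B_def[symmetric] by (cases B) (simp_all add: G_def)
    qed
  qed
  also have "\<dots> = (killed_mean (ln t) (Suc n) g)"
    by (rule nn_integral_PiM_resample[symmetric, OF _ wm]) (rule prob_space_axioms)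
  finally show ?case .
qed

end

lemma log_plus_nonneg: "log_plus x \<ge> 0" and ln_le_log_plus: "x > 0 \<Longrightarrow> ln x \<le> log_plus x"
  by (simp_all add: log_plus_def)

lemma measurable_log_plus [measurable]: "log_plus \<in> borel_measurable borel"
  unfolding log_plus_def[abs_def] by measurable

lemma min_sq_le_powr:
  assumes "1 < \<alpha>" "\<alpha> < 2" "x > 0"
  shows "min_sq x \<le> x powr \<alpha> * min 1 (x powr (2 - \<alpha>))"
proof (cases "x \<le> 1")
  case True
  have "x\<^sup>2 = x powr \<alpha> * x powr (2 - \<alpha>)"
    using assms by (simp add: powr_add[symmetric])
  moreover have "x powr (2 - \<alpha>) \<le> 1" using True assms by (simp add: powr_le1)
  ultimately show ?thesis by (simp add: min_sq_def min_def)
next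
  case False
  have "x powr 1 \<le> x powr \<alpha>" using False assms by (intro powr_mono) auto
  moreover have "x powr (2 - \<alpha>) \<ge> 1" using False assms by (simp add: ge_one_powr_ge_zero)
  ultimately show ?thesis using assms by (simp add: min_sq_def min_def)
qed

text \<open>
  The exponents \<open>2\<close> and \<open>1\<close> of \<open>min_sq\<close> lie on either side of \<open>\<alpha>\<close>, so \<open>\<alpha>\<close>-th powers can be taken out.
  What remains decays in the distance of \<open>ln y\<close> below the barrier \<open>ln t\<close>, once this distance exceeds the
  size of \<open>d\<close> on the logarithmic scale.
\<close>
lemma min_sq_le_decay:
  assumes "1 < \<alpha>" "\<alpha> < 2" "t > 0" "y > 0" "d \<ge> 0"
  shows "min_sq (y * d / t) \<le> t powr - \<alpha> * d powr \<alpha> * y powr \<alpha> * decay (2 - \<alpha>) (log_plus d) (ln t - ln y)"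
proof (cases "d = 0")
  case False
  then have d: "d > 0" using assms by simp
  define x where "x = y * d / t"
  have x: "x > 0" using assms d by (simp add: x_def)
  have "ln x = ln y + ln d - ln t" using assms d by (simp add: x_def ln_mult ln_div)
  then have "(2 - \<alpha>) * ln x \<le> (2 - \<alpha>) * (- ((ln t - ln y) - log_plus d))"
    using ln_le_log_plus[OF d] assms by (intro mult_left_mono) auto
  then have "x powr (2 - \<alpha>) \<le> exp (- (2 - \<alpha>) * ((ln t - ln y) - log_plus d))"
    using x by (simp add: powr_def algebra_simps)
  then have le: "min 1 (x powr (2 - \<alpha>)) \<le> decay (2 - \<alpha>) (log_plus d) (ln t - ln y)"
    unfolding decay_def by (intro min.mono) auto
  have "x powr \<alpha> = t powr - \<alpha> * d powr \<alpha> * y powr \<alpha>"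
    using assms d by (simp add: x_def powr_mult powr_divide powr_minus_divide)
  moreover have "x powr \<alpha> * min 1 (x powr (2 - \<alpha>)) \<le> x powr \<alpha> * decay (2 - \<alpha>) (log_plus d) (ln t - ln y)"
    by (intro mult_left_mono le) simp
  ultimately show ?thesis using min_sq_le_powr[OF assms(1,2) x] by (simp add: x_def)
qed simp

lemma ennreal_eq_0_if_le:
  fixes x :: ennreal
  assumes "\<And>i. x \<le> y i" "y \<longlonglongrightarrow> 0"
  shows "x = 0"
  using LIMSEQ_le_const[OF assms(2), of x] assms(1) by auto

context spinal_cascade begin

lemma prob_rho: "prob_space \<rho>"
proof -
  interpret Q0: prob_space "Q []" by (rule prob_Q)
  show ?thesis unfolding excess_law[of "[]", symmetric] by (rule Q0.prob_space_distr) simp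
qed

lemma sets_rho: "sets \<rho> = sets borel"
  unfolding excess_law[of "[]", symmetric] by simp

text \<open>
  The total cost of all alive nodes at scale \<open>t\<close>. Given the excess, whose modulus is \<open>d\<close>, the
  previous estimate and the many-to-one formula bound it by \<open>t powr -\<alpha> * d powr \<alpha>\<close> times a Green function
  of width \<open>log_plus d\<close>. It is here that logarithmic moments of the offspring sum are needed.
\<close>
lemma truncated_sum_bound:
  "\<exists>C\<ge>0. \<forall>t\<ge>1. (\<integral>\<^sup>+u. truncated_cost t t u \<partial>count_space UNIV)
     \<le> ennreal (C * t powr - \<alpha>)"
proof -
  have "2 - \<alpha> > 0" using alpha by simp
  note green = green_bound[OF this steps_down]
  obtain C0 where C00: "C0 \<ge> 0" and C0r: "\<forall>r\<ge>0. \<forall>b.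
      (\<Sum>n. killed_mean b n (\<lambda>y. ennreal (decay (2 - \<alpha>) r (b - y)))) \<le> ennreal (C0 * (1 + r)\<^sup>2)"
    using green by (elim exE conjE)
  note C0 = C00 C0r[rule_format]
  define K where "K = enn2real (\<integral>\<^sup>+z. ennreal (norm z powr \<alpha> * (1 + log_plus (norm z))\<^sup>2) \<partial>\<rho>)"
  have K: "(\<integral>\<^sup>+z. ennreal (norm z powr \<alpha> * (1 + log_plus (norm z))\<^sup>2) \<partial>\<rho>) = ennreal K"
    using excess_moment unfolding K_def by simp
  show ?thesis
  proof (intro exI[of _ "C0 * K"] conjI allI impI)
    show "0 \<le> C0 * K" using C00 by (simp add: K_def)
    fix t :: real assume t: "t \<ge> 1"
    define A where "A z = ennreal (t powr - \<alpha> * norm z powr \<alpha>)" for z :: complex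
    define dec where "dec z s = ennreal (decay (2 - \<alpha>) (log_plus (norm z)) (ln t - s))" for z :: complex and s
    have Am: "A \<in> borel_measurable \<rho>"
      unfolding A_def[abs_def] by (subst measurable_cong_sets[OF sets_rho refl]) measurable
    define g where "g s = (\<integral>\<^sup>+z. A z * dec z s \<partial>\<rho>)" for s
    interpret R: prob_space \<rho> by (rule prob_rho)
    interpret PS: prob_space S by (rule prob_S)
    have "(\<lambda>p. A (snd p) * dec (snd p) (fst p)) \<in> borel_measurable (borel \<Otimes>\<^sub>M borel)"
      unfolding A_def dec_def decay_def by measurable
    then have "(\<lambda>p. A (snd p) * dec (snd p) (fst p)) \<in> borel_measurable (borel \<Otimes>\<^sub>M \<rho>)"
      by (subst measurable_cong_sets[OF sets_pair_measure_cong[OF refl sets_rho] refl])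
    then have gm: "g \<in> borel_measurable borel"
      unfolding g_def[abs_def]
      by (intro sigma_finite_measure.borel_measurable_nn_integral[OF prob_space_imp_sigma_finite[OF prob_rho]])
         (simp add: case_prod_beta)
    have node: "(truncated_cost t t u)
      \<le> (alive_mean t g u)" for u
    proof -
      have fm: "(\<lambda>w. ennreal (min_sq (norm (truncated_weight t w u * excess (w u)) / t))) \<in> borel_measurable P"
        by measurable
      have "(truncated_cost t t u)
        = (\<integral>\<^sup>+w. \<integral>\<^sup>+e. ennreal (min_sq (norm (truncated_weight t w u * excess e) / t)) \<partial>Q u \<partial>P)"
        by (subst nn_integral_PiM_resample[OF prob_Q fm, of u])
           (simp add: predictableD[OF predictable_truncated_weight])
      also have "\<dots> = (\<integral>\<^sup>+w. \<integral>\<^sup>+z. ennreal (min_sq (norm (truncated_weight t w u * z) / t)) \<partial>\<rho> \<partial>P)"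
        by (simp add: excess_law[of u, symmetric] nn_integral_distr)
      also have "\<dots> \<le> (alive_mean t g u)"
      proof (intro nn_integral_mono)
        fix w
        show "(\<integral>\<^sup>+z. ennreal (min_sq (norm (truncated_weight t w u * z) / t)) \<partial>\<rho>)
          \<le> (if alive t w u then ennreal (norm (node_weight w u) powr \<alpha>) * g (ln (norm (node_weight w u))) else 0)"
        proof (cases "alive t w u \<and> node_weight w u \<noteq> 0")
          case True
          define y where "y = norm (node_weight w u)"
          have y: "y > 0" using True by (simp add: y_def)
          have dm: "(\<lambda>z. A z * dec z (ln y)) \<in> borel_measurable \<rho>"
            unfolding A_def dec_def decay_def by (subst measurable_cong_sets[OF sets_rho refl]) measurable
          have "(\<integral>\<^sup>+z. ennreal (min_sq (norm (truncated_weight t w u * z) / t)) \<partial>\<rho>)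
            \<le> (\<integral>\<^sup>+z. ennreal (y powr \<alpha>) * (A z * dec z (ln y)) \<partial>\<rho>)"
          proof (intro nn_integral_mono)
            fix z
            have "min_sq (norm (truncated_weight t w u * z) / t) \<le> t powr - \<alpha> * norm z powr \<alpha> * y powr \<alpha> * decay (2 - \<alpha>) (log_plus (norm z)) (ln t - ln y)"
              using min_sq_le_decay[of \<alpha> t y "norm z"] alpha t y True
              by (simp add: truncated_weight_def norm_mult y_def)
            also have "\<dots> = y powr \<alpha> * ((t powr - \<alpha> * norm z powr \<alpha>) * decay (2 - \<alpha>) (log_plus (norm z)) (ln t - ln y))"
              by (simp add: mult.assoc mult.left_commute)
            finally have "ennreal (min_sq (norm (truncated_weight t w u * z) / t))
                \<le> ennreal (y powr \<alpha> * ((t powr - \<alpha> * norm z powr \<alpha>) * decay (2 - \<alpha>) (log_plus (norm z)) (ln t - ln y)))"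
              by (rule ennreal_leI)
            also have "\<dots> = ennreal (y powr \<alpha>) * (A z * dec z (ln y))"
              unfolding A_def dec_def by (simp add: ennreal_mult decay_pos[THEN less_imp_le])
            finally show "ennreal (min_sq (norm (truncated_weight t w u * z) / t)) \<le> ennreal (y powr \<alpha>) * (A z * dec z (ln y))" .
          qed
          also have "\<dots> = ennreal (y powr \<alpha>) * g (ln y)"
            unfolding g_def by (rule nn_integral_cmult[OF dm])
          finally show ?thesis using True by (simp add: y_def)
        next
          case False
          then have "truncated_weight t w u = 0" by (auto simp: truncated_weight_def)
          then show ?thesis by simp
        qed
      qed
      finally show ?thesis .
    qed
    have "(\<integral>\<^sup>+u. truncated_cost t t u \<partial>count_space UNIV)
      \<le> (\<integral>\<^sup>+u. alive_mean t g u \<partial>count_space UNIV)"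
      by (intro nn_integral_mono node)
    also have "\<dots> = (\<Sum>n. killed_mean (ln t) n g)"
      unfolding nn_integral_all_levels using t by (intro suminf_cong many_to_one gm) auto
    also have "\<dots> = (\<Sum>n. \<integral>\<^sup>+z. A z * (killed_mean (ln t) n (dec z)) \<partial>\<rho>)"
    proof (intro suminf_cong)
      fix n
      interpret PR: pair_sigma_finite S \<rho> ..
      define J where "J x = (if \<forall>k\<le>n. walk x k \<le> ln t then 1 else 0 :: ennreal)" for x
      have Jm [measurable]: "J \<in> borel_measurable S" unfolding J_def[abs_def] by measurable
      have pm: "(\<lambda>p. A (snd p) * (J (fst p) * dec (snd p) (walk (fst p) n))) \<in> borel_measurable (S \<Otimes>\<^sub>M \<rho>)"
        unfolding A_def dec_def decay_def
        by (subst measurable_cong_sets[OF sets_pair_measure_cong[OF refl sets_rho] refl]) measurable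
      have "(killed_mean (ln t) n g)
        = (\<integral>\<^sup>+x. \<integral>\<^sup>+z. A z * (J x * dec z (walk x n)) \<partial>\<rho> \<partial>S)"
        by (intro nn_integral_cong) (auto simp: J_def g_def)
      also have "\<dots> = (\<integral>\<^sup>+z. \<integral>\<^sup>+x. A z * (J x * dec z (walk x n)) \<partial>S \<partial>\<rho>)"
        using PR.Fubini[of "\<lambda>p. A (snd p) * (J (fst p) * dec (snd p) (walk (fst p) n))"] pm by simp
      also have "\<dots> = (\<integral>\<^sup>+z. A z * (killed_mean (ln t) n (dec z)) \<partial>\<rho>)"
      proof (intro nn_integral_cong)
        fix z
        have jm: "(\<lambda>x. J x * dec z (walk x n)) \<in> borel_measurable S" unfolding dec_def by measurable
        have "(\<integral>\<^sup>+x. A z * (J x * dec z (walk x n)) \<partial>S) = A z * (\<integral>\<^sup>+x. J x * dec z (walk x n) \<partial>S)"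
          by (rule nn_integral_cmult[OF jm])
        also have "(\<integral>\<^sup>+x. J x * dec z (walk x n) \<partial>S) = (killed_mean (ln t) n (dec z))"
          by (intro nn_integral_cong) (auto simp: J_def)
        finally show "(\<integral>\<^sup>+x. A z * (J x * dec z (walk x n)) \<partial>S)
          = A z * (killed_mean (ln t) n (dec z))" .
      qed
      finally show "(killed_mean (ln t) n g)
        = (\<integral>\<^sup>+z. A z * (killed_mean (ln t) n (dec z)) \<partial>\<rho>)" .
    qed
    also have "\<dots> = (\<integral>\<^sup>+z. (\<Sum>n. A z * (killed_mean (ln t) n (dec z))) \<partial>\<rho>)"
    proof (rule nn_integral_suminf[symmetric])
      fix n
      have "(\<lambda>p. if \<forall>k\<le>n. walk (snd p) k \<le> ln t then dec (fst p) (walk (snd p) n) else 0) \<in> borel_measurable (\<rho> \<Otimes>\<^sub>M S)"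
        unfolding dec_def decay_def
        by (subst measurable_cong_sets[OF sets_pair_measure_cong[OF sets_rho refl] refl]) measurable
      then have "(\<lambda>z. killed_mean (ln t) n (dec z)) \<in> borel_measurable \<rho>"
        by (intro sigma_finite_measure.borel_measurable_nn_integral[OF prob_space_imp_sigma_finite[OF prob_S]])
           (simp add: case_prod_beta)
      then show "(\<lambda>z. A z * (killed_mean (ln t) n (dec z))) \<in> borel_measurable \<rho>"
        using Am by (intro borel_measurable_times_ennreal)
    qed
    also have "\<dots> \<le> (\<integral>\<^sup>+z. ennreal (C0 * t powr - \<alpha>) * ennreal (norm z powr \<alpha> * (1 + log_plus (norm z))\<^sup>2) \<partial>\<rho>)"
    proof (intro nn_integral_mono)
      fix z
      have "(\<Sum>n. A z * (killed_mean (ln t) n (dec z)))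
        = A z * (\<Sum>n. killed_mean (ln t) n (dec z))"
        by simp
      also have "\<dots> \<le> A z * ennreal (C0 * (1 + log_plus (norm z))\<^sup>2)"
        unfolding dec_def by (intro mult_left_mono C0(2) log_plus_nonneg) simp
      also have "\<dots> = ennreal (C0 * t powr - \<alpha>) * ennreal (norm z powr \<alpha> * (1 + log_plus (norm z))\<^sup>2)"
        unfolding A_def using C0(1) by (simp add: ennreal_mult[symmetric] mult_ac)
      finally show "(\<Sum>n. A z * (killed_mean (ln t) n (dec z)))
        \<le> ennreal (C0 * t powr - \<alpha>) * ennreal (norm z powr \<alpha> * (1 + log_plus (norm z))\<^sup>2)" .
    qed
    also have "\<dots> = ennreal (C0 * t powr - \<alpha>) * ennreal K"
    proof (subst nn_integral_cmult)
      show "(\<lambda>z. ennreal (norm z powr \<alpha> * (1 + log_plus (norm z))\<^sup>2)) \<in> borel_measurable \<rho>"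
        by (subst measurable_cong_sets[OF sets_rho refl]) measurable
    qed (simp add: K)
    also have "\<dots> = ennreal (C0 * K * t powr - \<alpha>)"
      using C0(1) by (simp add: ennreal_mult[symmetric] K_def mult_ac)
    finally show "(\<integral>\<^sup>+u. truncated_cost t t u \<partial>count_space UNIV)
      \<le> ennreal (C0 * K * t powr - \<alpha>)" .
  qed
qed

end

section \<open>Tails and almost sure convergence\<close>

context spinal_cascade begin

lemma truncated_weight_eq:
  assumes "\<And>v. norm (node_weight w v) \<le> t"
  shows "truncated_weight t w = node_weight w"
  using assms by (simp add: fun_eq_iff truncated_weight_def alive_def)

lemma truncated_summable:
  "AE w in P. \<forall>n. (\<lambda>u. truncated_weight t w u * excess (w u)) summable_on {u :: nat list. length u < n}"
  using AE_level_summable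
proof eventually_elim
  case (elim w)
  show ?case
  proof
    fix n
    have "(\<lambda>u. norm (node_weight w u * excess (w u))) summable_on {u :: nat list. length u < n}"
      using summable_below_level[OF elim, of n] unfolding summable_on_iff_abs_summable_on_complex .
    then have "(\<lambda>u. norm (truncated_weight t w u * excess (w u))) summable_on {u :: nat list. length u < n}"
      by (rule summable_on_comparison_test) (auto simp: truncated_weight_def)
    then show "(\<lambda>u. truncated_weight t w u * excess (w u)) summable_on {u :: nat list. length u < n}"
      by (rule abs_summable_summable)
  qed
qed

lemma truncated_maximal:
  assumes "s > 0"
  shows "emeasure P {w. \<exists>k\<ge>m. norm (increment (truncated_weight t) m k w) > s} * ennreal (sqrt 2 - 1)
    \<le> (\<integral>\<^sup>+u. double_cost (truncated_weight t) s u \<partial>count_space {u :: nat list. m \<le> length u})"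
  by (rule maximal_inequality[OF measurable_truncated_weight predictable_truncated_weight truncated_summable assms])

lemma measurable_exceed [measurable]:
  "{w. \<exists>k\<ge>m. norm (increment (truncated_weight t) m k w) > s} \<in> sets P"
proof -
  have "{w. \<exists>k\<ge>m. norm (increment (truncated_weight t) m k w) > s}
    = {w \<in> space P. \<exists>k\<in>{m..}. norm (increment (truncated_weight t) m k w) > s}" by auto
  also have "\<dots> \<in> sets P" by measurable
  finally show ?thesis .
qed

lemma measurable_node_weight_exceed [measurable]: "{w. \<exists>v. norm (node_weight w v) > t} \<in> sets P"
proof -
  have "{w. \<exists>v. norm (node_weight w v) > t} = {w \<in> space P. \<exists>v. norm (node_weight w v) > t}" by simp
  also have "\<dots> \<in> sets P" by measurable
  finally show ?thesis .
qed

lemma measurable_level_sum_exceed [measurable]: "{w. \<exists>n. norm (level_sum n w - 1) > t} \<in> sets P"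
proof -
  have "{w. \<exists>n. norm (level_sum n w - 1) > t} = {w \<in> space P. \<exists>n. norm (level_sum n w - 1) > t}" by simp
  also have "\<dots> \<in> sets P" by measurable
  finally show ?thesis .
qed

lemma le_of_mult_sqrt2:
  fixes x y :: ennreal
  assumes "x * ennreal (sqrt 2 - 1) \<le> y"
  shows "x \<le> ennreal (1 / (sqrt 2 - 1)) * y"
proof -
  have p: "sqrt 2 - 1 > (0::real)" by simp
  have "x = ennreal (1 / (sqrt 2 - 1)) * (x * ennreal (sqrt 2 - 1))"
    using p by (simp add: mult.left_commute ennreal_mult[symmetric])
  also have "\<dots> \<le> ennreal (1 / (sqrt 2 - 1)) * y" by (intro mult_left_mono assms) simp
  finally show ?thesis .
qed

text \<open>
  As long as no weight exceeds \<open>t\<close> the truncation has no effect. Both the exceptional event and the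
  probability that the truncated martingale exceeds \<open>t\<close> are of order \<open>t powr -\<alpha>\<close>.
\<close>
lemma level_sum_tail:
  "\<exists>C\<ge>0. \<forall>t\<ge>1. emeasure P {w. \<exists>n. norm (level_sum n w - 1) > t} \<le> ennreal (C * t powr - \<alpha>)"
proof -
  obtain C where C0: "C \<ge> 0" and Cr: "\<forall>t\<ge>1. (\<integral>\<^sup>+u. truncated_cost t t u \<partial>count_space UNIV)
     \<le> ennreal (C * t powr - \<alpha>)"
    using truncated_sum_bound by (elim exE conjE)
  define C' where "C' = 1 + 2 / (sqrt 2 - 1) * C"
  have s2: "sqrt 2 - 1 > (0::real)" by simp
  show ?thesis
  proof (intro exI[of _ C'] conjI allI impI)
    show "0 \<le> C'" using C0 s2 unfolding C'_def by (intro add_nonneg_nonneg mult_nonneg_nonneg divide_nonneg_nonneg) auto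
    fix t :: real assume t: "t \<ge> 1"
    define A where "A = {w. \<exists>v. norm (node_weight w v) > t}"
    define B where "B = {w. \<exists>k\<ge>0. norm (increment (truncated_weight t) 0 k w) > t}"
    have Am: "A \<in> sets P" and Bm: "B \<in> sets P" unfolding A_def B_def by measurable
    have "AE w in P. w \<in> {w. \<exists>n. norm (level_sum n w - 1) > t} \<longrightarrow> w \<in> A \<union> B"
      using AE_level_summable
    proof eventually_elim
      case (elim w)
      show ?case
      proof (intro impI, rule ccontr)
        assume *: "w \<in> {w. \<exists>n. norm (level_sum n w - 1) > t}" "w \<notin> A \<union> B"
        then have tw: "truncated_weight t w = node_weight w"
          by (intro truncated_weight_eq) (auto simp: A_def not_less)
        obtain n where n: "norm (level_sum n w - 1) > t" using * by auto
        have "increment (truncated_weight t) 0 n w = increment node_weight 0 n w"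
          unfolding increment_def tw ..
        also have "\<dots> = level_sum n w - 1" using increment_node_weight[OF elim, of 0 n] by simp
        finally have "norm (increment (truncated_weight t) 0 n w) > t" using n by simp
        then show False using * by (auto simp: B_def)
      qed
    qed
    then have "emeasure P {w. \<exists>n. norm (level_sum n w - 1) > t} \<le> emeasure P (A \<union> B)"
      by (rule emeasure_mono_AE) (use Am Bm in auto)
    also have "\<dots> \<le> emeasure P A + emeasure P B" by (rule emeasure_subadditive[OF Am Bm])
    also have "\<dots> \<le> ennreal (t powr - \<alpha>) + ennreal (2 / (sqrt 2 - 1) * C * t powr - \<alpha>)"
    proof (rule add_mono)
      show "emeasure P A \<le> ennreal (t powr - \<alpha>)" unfolding A_def by (rule first_crossing_bound[OF t])
      have "emeasure P B * ennreal (sqrt 2 - 1)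
        \<le> (\<integral>\<^sup>+u. double_cost (truncated_weight t) t u \<partial>count_space UNIV)"
        using truncated_maximal[of t 0 t] t unfolding B_def by simp
      also have "\<dots> = ennreal 2 * (\<integral>\<^sup>+u. truncated_cost t t u \<partial>count_space UNIV)"
        using t by (simp add: ennreal_mult min_sq_nonneg nn_integral_cmult)
      also have "\<dots> \<le> ennreal 2 * ennreal (C * t powr - \<alpha>)"
        using Cr t by (intro mult_left_mono) auto
      finally have "emeasure P B \<le> ennreal (1 / (sqrt 2 - 1)) * (ennreal 2 * ennreal (C * t powr - \<alpha>))"
        by (rule le_of_mult_sqrt2)
      also have "\<dots> = ennreal (2 / (sqrt 2 - 1) * C * t powr - \<alpha>)"
      proof -
        have "ennreal 2 * ennreal (C * t powr - \<alpha>) = ennreal (2 * (C * t powr - \<alpha>))"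
          using C0 by (intro ennreal_mult[symmetric]) auto
        moreover have "ennreal (1 / (sqrt 2 - 1)) * ennreal (2 * (C * t powr - \<alpha>)) = ennreal (1 / (sqrt 2 - 1) * (2 * (C * t powr - \<alpha>)))"
          using C0 by (intro ennreal_mult[symmetric]) auto
        ultimately show ?thesis by (simp add: mult.assoc)
      qed
      finally show "emeasure P B \<le> ennreal (2 / (sqrt 2 - 1) * C * t powr - \<alpha>)" .
    qed
    also have "\<dots> = ennreal (t powr - \<alpha> + 2 / (sqrt 2 - 1) * C * t powr - \<alpha>)"
      using C0 s2 by (intro ennreal_plus[symmetric] mult_nonneg_nonneg divide_nonneg_nonneg) auto
    also have "\<dots> = ennreal (C' * t powr - \<alpha>)" by (simp add: C'_def ring_distribs)
    finally show "emeasure P {w. \<exists>n. norm (level_sum n w - 1) > t} \<le> ennreal (C' * t powr - \<alpha>)" .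
  qed
qed

lemma min_sq_rescale:
  assumes "s > 0" "t > 0" "x \<ge> 0"
  shows "min_sq (x / s) \<le> max ((t / s)\<^sup>2) (t / s) * min_sq (x / t)"
proof -
  have e: "x / s = (t / s) * (x / t)" using assms by simp
  show ?thesis
  proof (cases "x / t \<le> 1")
    case True
    have "(x / t)\<^sup>2 \<le> x / t" using mult_right_mono[of "x / t" 1 "x / t"] True assms unfolding power2_eq_square by simp
    then have m: "min_sq (x / t) = (x / t)\<^sup>2" by (simp add: min_sq_def)
    have "min_sq (x / s) \<le> (t / s)\<^sup>2 * (x / t)\<^sup>2" unfolding min_sq_def e power_mult_distrib by simp
    also have "\<dots> \<le> max ((t / s)\<^sup>2) (t / s) * (x / t)\<^sup>2" by (intro mult_right_mono) auto
    finally show ?thesis unfolding m .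
  next
    case False
    have "x / t \<le> (x / t)\<^sup>2" using mult_right_mono[of 1 "x / t" "x / t"] False assms unfolding power2_eq_square by simp
    then have m: "min_sq (x / t) = x / t" by (simp add: min_sq_def)
    have "min_sq (x / s) \<le> (t / s) * (x / t)" unfolding min_sq_def e by simp
    also have "\<dots> \<le> max ((t / s)\<^sup>2) (t / s) * (x / t)" using assms by (intro mult_right_mono) auto
    finally show ?thesis unfolding m .
  qed
qed

text \<open>
  At any fixed scale \<open>s\<close> the costs are summable over the tree, being comparable to those at scale \<open>t\<close>.
\<close>
lemma truncated_tail_vanishes:
  assumes t: "t \<ge> 1" and s: "s > 0"
  shows "(\<lambda>m. \<integral>\<^sup>+u. double_cost (truncated_weight t) s u \<partial>count_space {u :: nat list. m \<le> length u}) \<longlonglongrightarrow> 0"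
proof -
  obtain C where C0: "C \<ge> 0" and Cr: "\<forall>t\<ge>1. (\<integral>\<^sup>+u. truncated_cost t t u \<partial>count_space UNIV)
     \<le> ennreal (C * t powr - \<alpha>)"
    using truncated_sum_bound by (elim exE conjE)
  define a where "a u = (double_cost (truncated_weight t) s u)" for u
  define c where "c = 2 * max ((t / s)\<^sup>2) (t / s)"
  have c: "c \<ge> 0" unfolding c_def by (simp add: le_max_iff_disj)
  have "(\<integral>\<^sup>+u. a u \<partial>count_space UNIV)
    \<le> (\<integral>\<^sup>+u. \<integral>\<^sup>+w. ennreal c * ennreal (min_sq (norm (truncated_weight t w u * excess (w u)) / t)) \<partial>P \<partial>count_space UNIV)"
    unfolding a_def
  proof (intro nn_integral_mono)
    fix u w
    have "2 * min_sq (norm (truncated_weight t w u * excess (w u)) / s)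
      \<le> c * min_sq (norm (truncated_weight t w u * excess (w u)) / t)"
      using min_sq_rescale[of s t "norm (truncated_weight t w u * excess (w u))"] s t by (simp add: c_def)
    then show "ennreal (2 * min_sq (norm (truncated_weight t w u * excess (w u)) / s))
       \<le> ennreal c * ennreal (min_sq (norm (truncated_weight t w u * excess (w u)) / t))"
      using c t by (subst ennreal_mult[symmetric]) (auto intro!: min_sq_nonneg ennreal_leI)
  qed
  also have "\<dots> = ennreal c * (\<integral>\<^sup>+u. truncated_cost t t u \<partial>count_space UNIV)"
    by (simp add: nn_integral_cmult)
  also have "\<dots> \<le> ennreal c * ennreal (C * t powr - \<alpha>)"
    using Cr t by (intro mult_left_mono) auto
  also have "\<dots> < \<infinity>" by (simp add: ennreal_mult_less_top)
  finally have fin: "(\<integral>\<^sup>+u. a u \<partial>count_space UNIV) < \<infinity>" .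
  have "(\<lambda>m. \<integral>\<^sup>+u. a u * indicator {u :: nat list. m \<le> length u} u \<partial>count_space UNIV) \<longlonglongrightarrow> (\<integral>\<^sup>+(u :: nat list). 0 \<partial>count_space UNIV)"
  proof (rule nn_integral_dominated_convergence[where w = a])
    show "AE u in count_space UNIV. (\<lambda>m. a u * indicator {u :: nat list. m \<le> length u} u) \<longlonglongrightarrow> 0"
    proof (rule AE_I2)
      fix u :: "nat list"
      have "\<forall>\<^sub>F m in sequentially. a u * indicator {u :: nat list. m \<le> length u} u = 0"
        by (rule eventually_sequentiallyI[of "Suc (length u)"]) auto
      then show "(\<lambda>m. a u * indicator {u :: nat list. m \<le> length u} u) \<longlonglongrightarrow> 0"
        by (rule tendsto_eventually)
    qed
  qed (use fin in \<open>auto split: split_indicator\<close>)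
  then show ?thesis by (simp add: a_def nn_integral_count_space_indicator)
qed

lemma AE_truncated_cauchy:
  assumes t: "t \<ge> 1" and s: "s > 0"
  shows "AE w in P. \<exists>m. \<forall>k\<ge>m. norm (increment (truncated_weight t) m k w) \<le> s"
proof -
  define X where "X m = {w. \<exists>k\<ge>m. norm (increment (truncated_weight t) m k w) > s}" for m
  have X: "X m \<in> sets P" for m unfolding X_def by measurable
  have I: "(\<Inter>m. X m) \<in> sets P" using X by auto
  have lim: "(\<lambda>m. ennreal (1 / (sqrt 2 - 1)) * (\<integral>\<^sup>+u. double_cost (truncated_weight t) s u \<partial>count_space {u :: nat list. m \<le> length u})) \<longlonglongrightarrow> 0"
    using ennreal_tendsto_cmult[OF _ truncated_tail_vanishes[OF t s], of "ennreal (1 / (sqrt 2 - 1))"] by simp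
  have "emeasure P (\<Inter>m. X m) = 0"
  proof (rule ennreal_eq_0_if_le[OF _ lim])
    fix m
    have "emeasure P (\<Inter>m. X m) \<le> emeasure P (X m)" by (intro emeasure_mono X) auto
    also have "\<dots> \<le> ennreal (1 / (sqrt 2 - 1)) * (\<integral>\<^sup>+u. double_cost (truncated_weight t) s u \<partial>count_space {u :: nat list. m \<le> length u})"
      unfolding X_def by (rule le_of_mult_sqrt2, rule truncated_maximal[OF s])
    finally show "emeasure P (\<Inter>m. X m) \<le> ennreal (1 / (sqrt 2 - 1)) * (\<integral>\<^sup>+u. double_cost (truncated_weight t) s u \<partial>count_space {u :: nat list. m \<le> length u})" .
  qed
  then have "AE w in P. w \<notin> (\<Inter>m. X m)" using I by (intro AE_not_in) auto
  then show ?thesis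
    by eventually_elim (auto simp: X_def not_less)
qed

lemma AE_bounded_weights: "AE w in P. \<exists>i::nat. \<forall>v. norm (node_weight w v) \<le> real (Suc i)"
proof -
  define X where "X i = {w. \<exists>v. norm (node_weight w v) > real (Suc i)}" for i
  have X: "X i \<in> sets P" for i unfolding X_def by measurable
  have "(\<lambda>i. real (Suc i) powr - \<alpha>) \<longlonglongrightarrow> 0"
    using alpha by (intro tendsto_neg_powr filterlim_compose[OF filterlim_real_sequentially filterlim_Suc]) auto
  then have lim: "(\<lambda>i. ennreal (real (Suc i) powr - \<alpha>)) \<longlonglongrightarrow> 0"
    using tendsto_ennrealI by fastforce
  have "emeasure P (\<Inter>i. X i) = 0"
  proof (rule ennreal_eq_0_if_le[OF _ lim])
    fix i
    have "emeasure P (\<Inter>i. X i) \<le> emeasure P (X i)" by (intro emeasure_mono X) auto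
    also have "\<dots> \<le> ennreal (real (Suc i) powr - \<alpha>)" unfolding X_def by (rule first_crossing_bound) simp
    finally show "emeasure P (\<Inter>i. X i) \<le> ennreal (real (Suc i) powr - \<alpha>)" .
  qed
  then have "AE w in P. w \<notin> (\<Inter>i. X i)" using X by (intro AE_not_in) auto
  then show ?thesis by eventually_elim (auto simp: X_def not_less)
qed

lemma AE_level_sum_convergent: "AE w in P. convergent (\<lambda>n. level_sum n w)"
proof -
  have "AE w in P. \<forall>i j. \<exists>m. \<forall>k\<ge>m. norm (increment (truncated_weight (real (Suc i))) m k w) \<le> inverse (real (Suc j))"
    unfolding AE_all_countable by (intro allI AE_truncated_cauchy) auto
  then show ?thesis using AE_level_summable AE_bounded_weights
  proof eventually_elim
    case (elim w)
    then obtain i :: nat where i: "\<And>v. norm (node_weight w v) \<le> real (Suc i)" by blast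
    have tw: "truncated_weight (real (Suc i)) w = node_weight w" by (rule truncated_weight_eq[OF i])
    have "Cauchy (\<lambda>n. level_sum n w)"
    proof (rule CauchyI)
      fix e :: real assume e: "0 < e"
      then have "0 < e / 2" by simp
      then obtain j where j: "inverse (real (Suc j)) < e / 2" using reals_Archimedean by blast
      obtain m where m: "\<And>k. k \<ge> m \<Longrightarrow> norm (increment (truncated_weight (real (Suc i))) m k w) \<le> inverse (real (Suc j))"
        using elim(1) by blast
      have close: "norm (level_sum k w - level_sum m w) < e / 2" if "k \<ge> m" for k
      proof -
        have "increment (truncated_weight (real (Suc i))) m k w = increment node_weight m k w"
          unfolding increment_def tw ..
        then show ?thesis using m[OF that] j increment_node_weight[OF elim(2) that] by simp
      qed
      show "\<exists>M. \<forall>p\<ge>M. \<forall>q\<ge>M. norm (level_sum p w - level_sum q w) < e"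
      proof (intro exI allI impI)
        fix p q assume "m \<le> p" "m \<le> q"
        have "norm (level_sum p w - level_sum q w) \<le> norm (level_sum p w - level_sum m w) + norm (level_sum q w - level_sum m w)"
          using norm_triangle_ineq4[of "level_sum p w - level_sum m w" "level_sum q w - level_sum m w"] by simp
        then show "norm (level_sum p w - level_sum q w) < e" using close[OF \<open>m \<le> p\<close>] close[OF \<open>m \<le> q\<close>] by simp
      qed
    qed
    then show ?case by (simp add: Cauchy_convergent_iff)
  qed
qed

end

section \<open>Convergence in the mean and non-degeneracy\<close>

lemma powr_add_le:
  fixes a b :: real
  assumes "a \<ge> 0" "b \<ge> 0" "p > 0"
  shows "(a + b) powr p \<le> 2 powr p * (a powr p + b powr p)"
proof -
  have "(a + b) powr p \<le> (2 * max a b) powr p" using assms by (intro powr_mono2) auto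
  also have "\<dots> = 2 powr p * max a b powr p" using assms by (intro powr_mult)
  also have "\<dots> \<le> 2 powr p * (a powr p + b powr p)"
    by (intro mult_left_mono) (auto simp: max_def)
  finally show ?thesis .
qed

lemma cnj_sgn_mult: "cnj (sgn z) * z = complex_of_real (norm z)"
proof (cases "z = 0")
  case False
  have "cnj (sgn z) * z = (z * cnj z) / complex_of_real (norm z)"
    by (simp add: sgn_div_norm scaleR_conv_of_real divide_inverse mult_ac)
  also have "\<dots> = complex_of_real ((norm z)\<^sup>2) / complex_of_real (norm z)"
    by (simp only: complex_norm_square)
  also have "\<dots> = complex_of_real (norm z)"
    using False by (simp add: power2_eq_square)
  finally show ?thesis .
qed simp

lemma integral_PiM_resample:
  fixes f :: "_ \<Rightarrow> complex"
  assumes Q: "\<And>i. prob_space (Q i)" and f: "integrable (PiM UNIV Q) f"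
  shows "(\<integral>w. f w \<partial>PiM UNIV Q) = (\<integral>w. (\<integral>e. f (w(i := e)) \<partial>Q i) \<partial>PiM UNIV Q)"
proof -
  interpret P: prob_space "PiM UNIV Q" by (rule prob_space_PiM) (rule Q)
  interpret Qi: prob_space "Q i" by (rule Q)
  interpret PP: pair_sigma_finite "Q i" "PiM UNIV Q" ..
  have eq: "distr (Q i \<Otimes>\<^sub>M PiM UNIV Q) (PiM UNIV Q) (\<lambda>(e, w). w(i := e)) = PiM UNIV Q"
    using distr_pair_PiM_eq_PiM[of UNIV Q i] Q by simp
  have fm: "f \<in> borel_measurable (PiM UNIV Q)" using f by simp
  have int: "integrable (Q i \<Otimes>\<^sub>M PiM UNIV Q) (\<lambda>p. f ((snd p)(i := fst p)))"
    using integrable_distr[OF measurable_fun_upd_UNIV[of i Q], of f] f unfolding eq by (simp add: case_prod_beta)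
  have "(\<integral>w. f w \<partial>PiM UNIV Q) = (\<integral>p. f ((snd p)(i := fst p)) \<partial>(Q i \<Otimes>\<^sub>M PiM UNIV Q))"
    using integral_distr[OF measurable_fun_upd_UNIV[of i Q] fm] unfolding eq by (simp add: case_prod_beta)
  also have "\<dots> = (\<integral>w. (\<integral>e. f (w(i := e)) \<partial>Q i) \<partial>PiM UNIV Q)"
    using PP.integral_snd[of "\<lambda>e w. f (w(i := e))"] int by (simp add: case_prod_unfold)
  finally show ?thesis .
qed

context cascade begin

lemma excess_abs_moment: "(\<integral>\<^sup>+e. ennreal (norm (excess e)) \<partial>Q v) \<le> (ennreal \<kappa> + 1)"
proof -
  interpret QQ: prob_space "Q v" by (rule prob_Q)
  have "(\<integral>\<^sup>+e. ennreal (norm (excess e)) \<partial>Q v)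
    \<le> (\<integral>\<^sup>+e. (\<integral>\<^sup>+j. ennreal (norm (e j)) \<partial>count_space UNIV) + 1 \<partial>Q v)"
  proof (intro nn_integral_mono)
    fix e :: "nat \<Rightarrow> complex"
    have "ennreal (norm (excess e)) \<le> ennreal (norm (\<Sum>\<^sub>\<infinity>j. e j) + 1)"
      unfolding excess_def using norm_triangle_ineq4[of "\<Sum>\<^sub>\<infinity>j. e j" 1] by (intro ennreal_leI) simp
    also have "\<dots> = ennreal (norm (\<Sum>\<^sub>\<infinity>j. e j)) + 1" by simp
    also have "\<dots> \<le> (\<integral>\<^sup>+j. ennreal (norm (e j)) \<partial>count_space UNIV) + 1"
      by (intro add_right_mono norm_infsum_le_nn_integral)
    finally show "ennreal (norm (excess e)) \<le> (\<integral>\<^sup>+j. ennreal (norm (e j)) \<partial>count_space UNIV) + 1" .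
  qed
  also have "\<dots> = (\<integral>\<^sup>+e. (\<integral>\<^sup>+j. ennreal (norm (e j)) \<partial>count_space UNIV) \<partial>Q v) + 1"
    using QQ.emeasure_space_1 by (subst nn_integral_add) (auto intro!: measurable_nn_integral_count)
  also have "\<dots> \<le> ennreal \<kappa> + 1" by (intro add_right_mono abs_moment)
  finally show ?thesis .
qed

lemma node_term_moment:
  "(\<integral>\<^sup>+w. ennreal (norm (node_weight w u * excess (w u))) \<partial>P)
    \<le> (mean_abs u) * (ennreal \<kappa> + 1)"
proof -
  have "(\<integral>\<^sup>+w. ennreal (norm (node_weight w u * excess (w u))) \<partial>P)
    = (\<integral>\<^sup>+w. ennreal (norm (node_weight w u)) * ennreal (norm (excess (w u))) \<partial>P)"
    by (simp add: norm_mult ennreal_mult)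
  also have "\<dots> = (mean_abs u) * (\<integral>\<^sup>+e. ennreal (norm (excess e)) \<partial>Q u)"
    by (rule nn_integral_PiM_resample_mult[where g = "\<lambda>e. ennreal (norm (excess e))"])
       (use prob_Q in \<open>simp_all add: node_weight_upd\<close>)
  also have "\<dots> \<le> (mean_abs u) * (ennreal \<kappa> + 1)"
    by (intro mult_left_mono excess_abs_moment) simp
  finally show ?thesis .
qed

text \<open>
  The martingale property, tested against bounded functions of the weights up to generation \<open>n\<close>.
\<close>
lemma level_sum_martingale:
  assumes Y [measurable]: "Y \<in> borel_measurable P" and bd: "\<And>w. norm (Y w) \<le> 1"
    and indep: "\<And>w u e. n \<le> length u \<Longrightarrow> Y (w(u := e)) = Y w"
  shows "integrable P (\<lambda>w. Y w * (level_sum (Suc n) w - level_sum n w))"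
    and "(\<integral>w. Y w * (level_sum (Suc n) w - level_sum n w) \<partial>P) = 0"
proof -
  interpret PP: prob_space P by (rule prob_P)
  define h where "h w u = Y w * (node_weight w u * excess (w u))" for w u
  have hm: "(\<lambda>w. h w u) \<in> borel_measurable P" for u unfolding h_def by measurable
  interpret C: sigma_finite_measure "count_space (level n)"
    by (rule sigma_finite_measure_count_space_countable) simp
  interpret PC: pair_sigma_finite P "count_space (level n)" ..
  have hp: "(\<lambda>p. h (fst p) (snd p)) \<in> borel_measurable (P \<Otimes>\<^sub>M count_space (level n))"
    by (rule measurable_count_pair) (simp_all add: hm)
  have ae: "AE w in P. Y w * (level_sum (Suc n) w - level_sum n w) = (\<integral>u. h w u \<partial>count_space (level n))"
    using AE_level_summable
  proof eventually_elim
    case (elim w)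
    have "Y w * (level_sum (Suc n) w - level_sum n w) = (\<Sum>\<^sub>\<infinity>u\<in>level n. Y w * (node_weight w u * excess (w u)))"
      by (simp add: level_sum_step(2)[OF elim, symmetric] infsum_cmult_right')
    then show ?case by (simp add: h_def infsum_eq_integral)
  qed
  have fin: "(\<integral>\<^sup>+w. ennreal (norm (h w u)) \<partial>P) \<le> (mean_abs u) * (ennreal \<kappa> + 1)" for u
  proof -
    have "norm (h w u) \<le> norm (node_weight w u * excess (w u))" for w
      unfolding h_def norm_mult[of "Y w"] using mult_right_mono[OF bd, of "norm (node_weight w u * excess (w u))" w] by simp
    then show ?thesis by (intro order_trans[OF nn_integral_mono node_term_moment] ennreal_leI)
  qed
  have int: "integrable (P \<Otimes>\<^sub>M count_space (level n)) (\<lambda>p. h (fst p) (snd p))"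
  proof (rule integrableI_bounded[OF hp])
    have "(\<integral>\<^sup>+p. ennreal (norm (h (fst p) (snd p))) \<partial>(P \<Otimes>\<^sub>M count_space (level n)))
      = (\<integral>\<^sup>+w. \<integral>\<^sup>+u. ennreal (norm (h w u)) \<partial>count_space (level n) \<partial>P)"
      using C.nn_integral_fst[of "\<lambda>p. ennreal (norm (h (fst p) (snd p)))" P] hp by simp
    also have "\<dots> = (\<integral>\<^sup>+u. \<integral>\<^sup>+w. ennreal (norm (h w u)) \<partial>P \<partial>count_space (level n))"
      using hm by (intro nn_integral_count_space_nn_integral) simp_all
    also have "\<dots> \<le> (\<integral>\<^sup>+u. (mean_abs u) * (ennreal \<kappa> + 1) \<partial>count_space (level n))"
      by (intro nn_integral_mono fin)
    also have "\<dots> \<le> ennreal \<kappa> ^ n * (ennreal \<kappa> + 1)"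
      by (simp add: nn_integral_multc mult_right_mono level_abs_moment)
    also have "\<dots> < \<infinity>" by (simp add: ennreal_mult_less_top power_less_top_ennreal)
    finally show "(\<integral>\<^sup>+p. ennreal (norm (h (fst p) (snd p))) \<partial>(P \<Otimes>\<^sub>M count_space (level n))) < \<infinity>" .
  qed
  have mm: "(\<lambda>w. Y w * (level_sum (Suc n) w - level_sum n w)) \<in> borel_measurable P" by measurable
  have im: "integrable P (\<lambda>w. \<integral>u. h w u \<partial>count_space (level n))"
    using PC.integrable_fst'[OF int] by simp
  have eqi: "integrable P (\<lambda>w. Y w * (level_sum (Suc n) w - level_sum n w)) = integrable P (\<lambda>w. \<integral>u. h w u \<partial>count_space (level n))"
    by (rule integrable_cong_AE) (use mm im ae in auto)
  then show "integrable P (\<lambda>w. Y w * (level_sum (Suc n) w - level_sum n w))" using im by simp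
  have zero: "(\<integral>w. h w u \<partial>P) = 0" if u: "u \<in> level n" for u
  proof -
    have hi: "integrable P (\<lambda>w. h w u)"
    proof (rule integrableI_bounded[OF hm])
      have "(mean_abs u)
        \<le> (\<integral>\<^sup>+v. mean_abs v \<partial>count_space (level n))"
        by (rule nn_integral_ge_point[where p = "\<lambda>v. mean_abs v"]) (rule u)
      also have "\<dots> \<le> ennreal \<kappa> ^ n" by (rule level_abs_moment)
      finally have "(\<integral>\<^sup>+w. ennreal (norm (h w u)) \<partial>P) \<le> ennreal \<kappa> ^ n * (ennreal \<kappa> + 1)"
        by (intro order_trans[OF fin] mult_right_mono) simp_all
      also have "\<dots> < \<infinity>" by (simp add: ennreal_mult_less_top power_less_top_ennreal)
      finally show "(\<integral>\<^sup>+w. ennreal (norm (h w u)) \<partial>P) < \<infinity>" .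
    qed
    have "(\<integral>w. h w u \<partial>P) = (\<integral>w. (\<integral>e. h (w(u := e)) u \<partial>Q u) \<partial>P)"
      by (rule integral_PiM_resample[OF prob_Q hi])
    also have "\<dots> = (\<integral>w. (\<integral>e. Y w * node_weight w u * excess e \<partial>Q u) \<partial>P)"
      using u indep by (simp add: h_def node_weight_upd level_def mult.assoc)
    also have "\<dots> = 0" by (simp add: integral_excess)
    finally show ?thesis .
  qed
  have "(\<integral>w. Y w * (level_sum (Suc n) w - level_sum n w) \<partial>P) = (\<integral>w. \<integral>u. h w u \<partial>count_space (level n) \<partial>P)"
    by (rule integral_cong_AE) (use mm im ae in auto)
  also have "\<dots> = (\<integral>u. \<integral>w. h w u \<partial>P \<partial>count_space (level n))"
    using PC.Fubini_integral[of "\<lambda>w u. h w u"] int by (simp add: case_prod_unfold)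
  also have "\<dots> = (\<integral>u. 0 \<partial>count_space (level n))"
    by (rule Bochner_Integration.integral_cong) (simp_all add: zero)
  finally show "(\<integral>w. Y w * (level_sum (Suc n) w - level_sum n w) \<partial>P) = 0" by simp
qed

end

context spinal_cascade begin

definition limit_sum :: "(nat list \<Rightarrow> nat \<Rightarrow> complex) \<Rightarrow> complex" where
  "limit_sum w = lim (\<lambda>n. level_sum n w)"

lemma measurable_limit_sum [measurable]: "limit_sum \<in> borel_measurable P"
  unfolding limit_sum_def[abs_def] by (rule borel_measurable_lim_metric) simp

lemma AE_tendsto_limit_sum: "AE w in P. (\<lambda>n. level_sum n w) \<longlonglongrightarrow> limit_sum w"
  using AE_level_sum_convergent by eventually_elim (simp add: limit_sum_def convergent_LIMSEQ_iff)

text \<open>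
  A dyadic decomposition of the supremum, with the tail estimate for each dyadic level.
\<close>
lemma level_sum_dominated:
  assumes p: "0 < p" "p < \<alpha>"
  shows "\<exists>g \<in> borel_measurable P. (\<integral>\<^sup>+w. g w \<partial>P) < \<infinity> \<and> (\<forall>n w. ennreal (norm (level_sum n w - 1) powr p) \<le> g w)"
proof -
  interpret PP: prob_space P by (rule prob_P)
  obtain C where C0: "C \<ge> 0" and Cr: "\<forall>t\<ge>1. emeasure P {w. \<exists>n. norm (level_sum n w - 1) > t} \<le> ennreal (C * t powr - \<alpha>)"
    using level_sum_tail by (elim exE conjE)
  define X where "X k = {w. \<exists>n. norm (level_sum n w - 1) > 2 ^ k}" for k :: nat
  have X [measurable]: "X k \<in> sets P" for k unfolding X_def by measurable
  \<comment> \<open>the k-th summand dominates the values between 2 ^ k and 2 ^ (k + 1)\<close>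
  define g where "g w = 1 + (\<Sum>k. ennreal ((2 ^ Suc k) powr p) * indicator (X k) w)" for w
  have gm: "g \<in> borel_measurable P" unfolding g_def[abs_def] by measurable
  define q where "q = 2 powr (p - \<alpha>)"
  have q: "0 < q" "q < 1" unfolding q_def using p by (auto simp: powr_less_one)
  have pw: "((2::real) ^ Suc k) powr p * (C * (2 ^ k) powr - \<alpha>) = 2 powr p * C * q ^ k" for k
  proof -
    have "((2::real) ^ Suc k) powr p = 2 powr p * 2 powr (real k * p)"
      by (simp add: powr_realpow[symmetric] powr_powr powr_add[symmetric] powr_mult ring_distribs)
    moreover have "((2::real) ^ k) powr - \<alpha> = 2 powr (- real k * \<alpha>)"
      by (simp add: powr_realpow[symmetric] powr_powr)
    moreover have "q ^ k = 2 powr (real k * p) * 2 powr (- real k * \<alpha>)"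
      unfolding q_def by (simp add: powr_realpow[symmetric] powr_powr powr_add[symmetric] algebra_simps)
    ultimately show ?thesis by simp
  qed
  have "(\<integral>\<^sup>+w. g w \<partial>P) = 1 + (\<Sum>k. ennreal ((2 ^ Suc k) powr p) * emeasure P (X k))"
    unfolding g_def using PP.emeasure_space_1
    by (subst nn_integral_add) (simp_all add: nn_integral_suminf nn_integral_cmult del: power_Suc)
  also have "\<dots> \<le> 1 + (\<Sum>k. ennreal (2 powr p * C * q ^ k))"
  proof (intro add_left_mono suminf_le)
    fix k
    have "ennreal ((2 ^ Suc k) powr p) * emeasure P (X k) \<le> ennreal ((2 ^ Suc k) powr p) * ennreal (C * (2 ^ k) powr - \<alpha>)"
      unfolding X_def using Cr by (intro mult_left_mono) auto
    also have "\<dots> = ennreal (2 powr p * C * q ^ k)"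
      using C0 by (subst ennreal_mult[symmetric]) (simp_all only: pw, simp_all)
    finally show "ennreal ((2 ^ Suc k) powr p) * emeasure P (X k) \<le> ennreal (2 powr p * C * q ^ k)" .
  qed simp_all
  also have "\<dots> < \<infinity>"
  proof -
    have "summable (\<lambda>k. 2 powr p * C * q ^ k)" using q by (intro summable_mult summable_geometric) simp
    then have "(\<Sum>k. ennreal (2 powr p * C * q ^ k)) = ennreal (\<Sum>k. 2 powr p * C * q ^ k)"
      using C0 q by (intro suminf_ennreal2) auto
    then show ?thesis by simp
  qed
  finally have fin: "(\<integral>\<^sup>+w. g w \<partial>P) < \<infinity>" .
  have dom: "ennreal (norm (level_sum n w - 1) powr p) \<le> g w" for n w
  proof (cases "norm (level_sum n w - 1) \<le> 1")
    case True
    then have "norm (level_sum n w - 1) powr p \<le> 1" using p by (intro powr_le1) auto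
    then have "ennreal (norm (level_sum n w - 1) powr p) \<le> 1" by (simp add: ennreal_le_1)
    also have "\<dots> \<le> g w" by (simp add: g_def)
    finally show ?thesis .
  next
    case False
    define x where "x = norm (level_sum n w - 1)"
    obtain i where "x < 2 ^ i" using real_arch_pow[of 2 x] by auto
    then have ex: "\<exists>k. x \<le> 2 ^ k" by (auto intro: less_imp_le)
    define j where "j = (LEAST k. x \<le> 2 ^ k)"
    have j: "x \<le> 2 ^ j" unfolding j_def by (rule LeastI_ex[OF ex])
    have "j \<noteq> 0" using j False unfolding x_def by (cases j) auto
    then obtain k where k: "j = Suc k" by (cases j) auto
    have "\<not> x \<le> 2 ^ k" using not_less_Least[of k "\<lambda>k. x \<le> 2 ^ k"] k unfolding j_def by simp
    then have wX: "w \<in> X k" unfolding X_def x_def by (auto simp: not_le)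
    have "x powr p \<le> (2 ^ Suc k) powr p" using j p unfolding k by (intro powr_mono2) (auto simp: x_def)
    then have "ennreal (x powr p) \<le> (\<Sum>k\<in>{k}. ennreal ((2 ^ Suc k) powr p) * indicator (X k) w)"
      using wX by (simp add: ennreal_leI del: power_Suc)
    also have "\<dots> \<le> (\<Sum>k. ennreal ((2 ^ Suc k) powr p) * indicator (X k) w)"
      by (rule sum_le_suminf) auto
    also have "\<dots> \<le> g w" by (simp add: g_def)
    finally show ?thesis unfolding x_def .
  qed
  show ?thesis using gm fin dom by blast
qed

lemma level_sum_converges_in_Lp:
  assumes p: "0 < p" "p < \<alpha>"
  shows "converges_in_Lp P p level_sum limit_sum"
proof -
  interpret PP: prob_space P by (rule prob_P)
  obtain g where g [measurable]: "g \<in> borel_measurable P" and gi: "(\<integral>\<^sup>+w. g w \<partial>P) < \<infinity>"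
    and gd: "\<forall>n w. ennreal (norm (level_sum n w - 1) powr p) \<le> g w"
    using level_sum_dominated[OF p] by (elim bexE conjE)
  have gl: "AE w in P. ennreal (norm (limit_sum w - 1) powr p) \<le> g w"
    using AE_tendsto_limit_sum
  proof eventually_elim
    case (elim w)
    have "(\<lambda>n. norm (level_sum n w - 1) powr p) \<longlonglongrightarrow> norm (limit_sum w - 1) powr p"
      using p by (intro tendsto_powr' tendsto_norm tendsto_diff elim tendsto_const) auto
    then have "(\<lambda>n. ennreal (norm (level_sum n w - 1) powr p)) \<longlonglongrightarrow> ennreal (norm (limit_sum w - 1) powr p)"
      by (rule tendsto_ennrealI)
    then show ?case by (rule LIMSEQ_le_const2) (use gd in auto)
  qed
  have sum_le: "ennreal (norm (a + b) powr p) \<le> ennreal (2 powr p) * (x + y)"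
    if "ennreal (norm a powr p) \<le> x" "ennreal (norm b powr p) \<le> y" for a b :: complex and x y
  proof -
    have "norm (a + b) powr p \<le> (norm a + norm b) powr p"
      using p by (intro powr_mono2 norm_triangle_ineq) auto
    also have "\<dots> \<le> 2 powr p * (norm a powr p + norm b powr p)" using p by (intro powr_add_le) auto
    finally have "ennreal (norm (a + b) powr p) \<le> ennreal (2 powr p * (norm a powr p + norm b powr p))"
      by (rule ennreal_leI)
    also have "\<dots> = ennreal (2 powr p) * (ennreal (norm a powr p) + ennreal (norm b powr p))"
      by (simp add: ennreal_mult)
    also have "\<dots> \<le> ennreal (2 powr p) * (x + y)" using that by (intro mult_left_mono add_mono) auto
    finally show ?thesis .
  qed
  have fin1: "(\<integral>\<^sup>+w. ennreal (2 powr p) * (g w + 1) \<partial>P) < \<infinity>"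
    using gi PP.emeasure_space_1 by (simp add: nn_integral_cmult nn_integral_add ennreal_mult_less_top)
  have fin2: "(\<integral>\<^sup>+w. ennreal (2 powr p) * (g w + g w) \<partial>P) < \<infinity>"
    using gi by (simp add: nn_integral_cmult nn_integral_add ennreal_mult_less_top)
  show ?thesis
    unfolding converges_in_Lp_def in_Lp_def
  proof (intro conjI allI)
    fix n
    have "(\<integral>\<^sup>+w. ennreal (norm (level_sum n w) powr p) \<partial>P) \<le> (\<integral>\<^sup>+w. ennreal (2 powr p) * (g w + 1) \<partial>P)"
    proof (intro nn_integral_mono)
      fix w
      show "ennreal (norm (level_sum n w) powr p) \<le> ennreal (2 powr p) * (g w + 1)"
        using sum_le[of "level_sum n w - 1" "g w" 1 1] gd by simp
    qed
    then show "(\<integral>\<^sup>+w. ennreal (norm (level_sum n w) powr p) \<partial>P) < \<infinity>" using fin1 by (rule le_less_trans)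
  next
    have "(\<integral>\<^sup>+w. ennreal (norm (limit_sum w) powr p) \<partial>P) \<le> (\<integral>\<^sup>+w. ennreal (2 powr p) * (g w + 1) \<partial>P)"
    proof (intro nn_integral_mono_AE)
      show "AE w in P. ennreal (norm (limit_sum w) powr p) \<le> ennreal (2 powr p) * (g w + 1)"
        using gl
      proof eventually_elim
        case (elim w)
        then show ?case using sum_le[of "limit_sum w - 1" "g w" 1 1] by simp
      qed
    qed
    then show "(\<integral>\<^sup>+w. ennreal (norm (limit_sum w) powr p) \<partial>P) < \<infinity>" using fin1 by (rule le_less_trans)
  next
    have "(\<lambda>n. \<integral>\<^sup>+w. ennreal (norm (level_sum n w - limit_sum w) powr p) \<partial>P) \<longlonglongrightarrow> (\<integral>\<^sup>+w. 0 \<partial>P)"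
    proof (rule nn_integral_dominated_convergence[where w = "\<lambda>w. ennreal (2 powr p) * (g w + g w)"])
      show "AE w in P. ennreal (norm (level_sum n w - limit_sum w) powr p) \<le> ennreal (2 powr p) * (g w + g w)" for n
        using gl
      proof eventually_elim
        case (elim w)
        have "ennreal (norm (- (limit_sum w - 1)) powr p) \<le> g w" using elim by (simp only: norm_minus_cancel)
        then show ?case using sum_le[of "level_sum n w - 1" "g w" "- (limit_sum w - 1)" "g w"] gd by simp
      qed
      show "AE w in P. (\<lambda>n. ennreal (norm (level_sum n w - limit_sum w) powr p)) \<longlonglongrightarrow> 0"
        using AE_tendsto_limit_sum
      proof eventually_elim
        case (elim w)
        have "(\<lambda>n. norm (level_sum n w - limit_sum w)) \<longlonglongrightarrow> 0"
          using elim by (simp add: LIM_zero tendsto_norm_zero)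
        then have "(\<lambda>n. norm (level_sum n w - limit_sum w) powr p) \<longlonglongrightarrow> 0 powr p"
          using p by (intro tendsto_powr' tendsto_const) auto
        then have "(\<lambda>n. ennreal (norm (level_sum n w - limit_sum w) powr p)) \<longlonglongrightarrow> ennreal (0 powr p)"
          by (rule tendsto_ennrealI)
        then show ?case by simp
      qed
    qed (use fin2 in auto)
    then show "(\<lambda>n. \<integral>\<^sup>+w. ennreal (norm (level_sum n w - limit_sum w) powr p) \<partial>P) \<longlonglongrightarrow> 0" by simp
  qed measurable
qed

text \<open>
  By the martingale property and convergence in the mean, the limit \<open>c\<close> satisfies
  \<open>E[Y (Z_m - c)] = 0\<close> for bounded \<open>Y\<close> depending on the first \<open>m\<close> generations. With \<open>m = 0\<close> this gives
  \<open>c = 1\<close>, and with \<open>m = 1\<close> and \<open>Y\<close> the conjugate phase of \<open>Z_1 - 1\<close> it gives \<open>Z_1 = 1\<close> almost surely.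
\<close>
lemma limit_sum_nondegenerate:
  assumes "\<not> (AE e in Q []. (\<Sum>\<^sub>\<infinity>j. e j) = 1)"
  shows "\<not> (\<exists>c. AE w in P. limit_sum w = c)"
proof
  interpret PP: prob_space P by (rule prob_P)
  assume "\<exists>c. AE w in P. limit_sum w = c"
  then obtain c where c: "AE w in P. limit_sum w = c" ..
  have Lp: "converges_in_Lp P 1 level_sum limit_sum"
    using alpha by (intro level_sum_converges_in_Lp) auto
  have int [simp]: "integrable P (level_sum n)" for n
    using Lp unfolding converges_in_Lp_def in_Lp_def by (intro integrableI_bounded) auto
  have vanish: "(\<integral>w. Y w * (level_sum m w - c) \<partial>P) = 0"
    if Y [measurable]: "Y \<in> borel_measurable P" and bd: "\<And>w. norm (Y w) \<le> 1"
      and indep: "\<And>w u e. m \<le> length u \<Longrightarrow> Y (w(u := e)) = Y w" for Y m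
  proof -
    have iY: "integrable P (\<lambda>w. Y w * (level_sum n w - c))" for n
    proof (rule Bochner_Integration.integrable_bound[where f = "\<lambda>w. level_sum n w - c"])
      show "AE w in P. norm (Y w * (level_sum n w - c)) \<le> norm (level_sum n w - c)"
        using bd by (intro AE_I2) (simp add: norm_mult mult_left_le_one_le)
    qed auto
    have const: "(\<integral>w. Y w * (level_sum n w - c) \<partial>P) = (\<integral>w. Y w * (level_sum m w - c) \<partial>P)" if "m \<le> n" for n
      using that
    proof (induction n rule: dec_induct)
      case (step n)
      have ind: "\<And>w u e. n \<le> length u \<Longrightarrow> Y (w(u := e)) = Y w" using indep step.hyps by auto
      have "(\<integral>w. Y w * (level_sum (Suc n) w - c) \<partial>P)
        = (\<integral>w. Y w * (level_sum n w - c) + Y w * (level_sum (Suc n) w - level_sum n w) \<partial>P)"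
        by (simp add: algebra_simps)
      also have "\<dots> = (\<integral>w. Y w * (level_sum n w - c) \<partial>P)"
        using level_sum_martingale[OF Y bd ind] iY by simp
      finally show ?case using step.IH by simp
    qed simp
    have le: "ennreal (norm (\<integral>w. Y w * (level_sum m w - c) \<partial>P))
      \<le> (\<integral>\<^sup>+w. ennreal (norm (level_sum n w - limit_sum w) powr 1) \<partial>P)" if "m \<le> n" for n
    proof -
      have "ennreal (norm (\<integral>w. Y w * (level_sum m w - c) \<partial>P))
        \<le> (\<integral>\<^sup>+w. ennreal (norm (Y w * (level_sum n w - c))) \<partial>P)"
        unfolding const[OF that, symmetric] by (rule integral_norm_bound_ennreal[OF iY])
      also have "\<dots> \<le> (\<integral>\<^sup>+w. ennreal (norm (level_sum n w - limit_sum w) powr 1) \<partial>P)"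
      proof (rule nn_integral_mono_AE)
        show "AE w in P. ennreal (norm (Y w * (level_sum n w - c))) \<le> ennreal (norm (level_sum n w - limit_sum w) powr 1)"
          using c
        proof eventually_elim
          case (elim w)
          then show ?case
            using bd[of w] by (intro ennreal_leI) (simp add: norm_mult mult_left_le_one_le)
        qed
      qed
      finally show ?thesis .
    qed
    have "ennreal (norm (\<integral>w. Y w * (level_sum m w - c) \<partial>P)) \<le> 0"
    proof (rule LIMSEQ_le_const)
      show "(\<lambda>n. \<integral>\<^sup>+w. ennreal (norm (level_sum n w - limit_sum w) powr 1) \<partial>P) \<longlonglongrightarrow> 0"
        using Lp unfolding converges_in_Lp_def by blast
    qed (use le in blast)
    then show ?thesis by simp
  qed
  have c1: "c = 1"
    using vanish[of "\<lambda>_. 1" 0] PP.prob_space by simp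
  define Y where "Y w = cnj (sgn (level_sum 1 w - 1))" for w
  have Ym: "Y \<in> borel_measurable P"
  proof -
    have "(\<lambda>w. sgn (level_sum 1 w - 1)) \<in> borel_measurable P"
      unfolding sgn_div_norm by measurable
    moreover have "cnj \<in> borel_measurable borel"
      by (intro borel_measurable_continuous_onI continuous_intros)
    ultimately show ?thesis unfolding Y_def[abs_def] by (rule measurable_compose)
  qed
  have "(\<integral>w. Y w * (level_sum 1 w - c) \<partial>P) = 0"
  proof (rule vanish[OF Ym])
    show "norm (Y w) \<le> 1" for w by (simp add: Y_def norm_sgn)
    show "Y (w(u := e)) = Y w" if "1 \<le> length u" for w u e
    proof -
      have "level_sum 1 (w(u := e)) = level_sum 1 w"
        unfolding level_sum_def using that by (intro infsum_cong) (simp add: node_weight_upd level_def)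
      then show ?thesis by (simp add: Y_def)
    qed
  qed
  moreover have "Y w * (level_sum 1 w - c) = complex_of_real (norm (level_sum 1 w - 1))" for w
    unfolding Y_def c1 by (rule cnj_sgn_mult)
  ultimately have "(\<integral>w. norm (level_sum 1 w - 1) \<partial>P) = 0" by simp
  then have "AE w in P. norm (level_sum 1 w - 1) = 0"
    by (subst (asm) integral_nonneg_eq_0_iff_AE) auto
  then have "AE w in P. (\<Sum>\<^sub>\<infinity>j. w [] j) = 1"
    using AE_level_summable
  proof eventually_elim
    case (elim w)
    have "level_sum 1 w - 1 = excess (w [])"
      using level_sum_step(2)[OF elim(2), of 0] by (simp add: level_0)
    then show ?case using elim(1) by (simp add: excess_def)
  qed
  then have ae: "AE e in distr P (Q []) (\<lambda>w. w []). (\<Sum>\<^sub>\<infinity>j. e j) = 1"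
  proof (subst AE_distr_iff)
    show "{e \<in> space (Q []). (\<Sum>\<^sub>\<infinity>j. e j) = 1} \<in> sets (Q [])"
      using measurable_infsum[of "UNIV :: nat set" "\<lambda>j e. e j" "Q []"] by measurable
  qed auto
  have "distr P (Q []) (\<lambda>w. w []) = Q []"
    by (rule distr_PiM_component) (simp_all add: prob_Q)
  then have "AE e in Q []. (\<Sum>\<^sub>\<infinity>j. e j) = 1"
    by (rule subst[where P = "\<lambda>R. AE e in R. (\<Sum>\<^sub>\<infinity>j. e j) = 1"]) (rule ae)
  then show False using assms by blast
qed

end

section \<open>Enumerated point processes and Campbell's formula\<close>

lemma infsum_ennreal_eq_nn_integral:
  fixes f :: "nat \<Rightarrow> ennreal"
  shows "infsum f UNIV = (\<integral>\<^sup>+j. f j \<partial>count_space UNIV)"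
proof -
  have "f summable_on UNIV" by (rule nonneg_summable_on_complete) simp
  then have "(f has_sum infsum f UNIV) UNIV" by (rule has_sum_infsum)
  then have "f sums infsum f UNIV" by (rule has_sum_imp_sums)
  then show ?thesis by (simp add: nn_integral_count_space_nat sums_unique)
qed

text \<open>
  The point with number \<open>j + 1\<close> is given the index \<open>j\<close>, so that the children of a node are indexed by
  all natural numbers; missing points have mark \<open>0\<close>.
\<close>
definition marks_of :: "(real ^ 'd \<Rightarrow> 'c :: zero) \<Rightarrow> enat \<times> (nat \<Rightarrow> real ^ 'd) \<Rightarrow> nat \<Rightarrow> 'c" where
  "marks_of f p j = (if enat (Suc j) \<le> fst p then f (snd p (Suc j)) else 0)"

lemma measurable_marks_of:
  fixes f :: "real ^ 'd \<Rightarrow> 'c :: {zero, topological_space}"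
  assumes f: "f \<in> borel_measurable borel"
  shows "marks_of f \<in> enumeration_space \<rightarrow>\<^sub>M PiM UNIV (\<lambda>_. borel)"
proof (rule measurable_PiM_single')
  fix j
  show "(\<lambda>p. marks_of f p j) \<in> borel_measurable (enumeration_space :: (enat \<times> (nat \<Rightarrow> real ^ 'd)) measure)"
    unfolding enumeration_space_def marks_of_def
  proof (intro measurable_If measurable_compose[OF _ f] measurable_compose[OF measurable_snd measurable_component_singleton])
    show "{p \<in> space (count_space UNIV \<Otimes>\<^sub>M (\<Pi>\<^sub>M j\<in>{1..}. borel)). enat (Suc j) \<le> fst p}
      \<in> sets (count_space UNIV \<Otimes>\<^sub>M (\<Pi>\<^sub>M j\<in>{1::nat..}. borel))"
      by (rule predE, rule measurable_compose[OF measurable_fst, where g = "\<lambda>k. enat (Suc j) \<le> k"]) simp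
  qed auto
qed simp

definition point_marks ::
    "('a \<Rightarrow> enat) \<Rightarrow> (nat \<Rightarrow> 'a \<Rightarrow> real ^ 'd) \<Rightarrow> (real ^ 'd \<Rightarrow> 'c :: zero) \<Rightarrow> 'a \<Rightarrow> nat \<Rightarrow> 'c" where
  "point_marks n x f \<omega> j = (if enat (Suc j) \<le> n \<omega> then f (x (Suc j) \<omega>) else 0)"

locale enumerated_process = prob_space M for M :: "'a measure" +
  fixes n :: "'a \<Rightarrow> enat" and x :: "nat \<Rightarrow> 'a \<Rightarrow> real ^ 'd"
  assumes enumerated: "enumerated_points n x \<in> M \<rightarrow>\<^sub>M enumeration_space"
begin

abbreviation marks :: "(real ^ 'd \<Rightarrow> 'c :: zero) \<Rightarrow> 'a \<Rightarrow> nat \<Rightarrow> 'c" where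
  "marks \<equiv> point_marks n x"

lemma marks_eq: "marks f \<omega> = marks_of f (enumerated_points n x \<omega>)"
  by (simp add: fun_eq_iff point_marks_def marks_of_def enumerated_points_def)

lemma measurable_marks_seq:
  fixes f :: "real ^ 'd \<Rightarrow> 'c :: {zero, topological_space}"
  assumes "f \<in> borel_measurable borel"
  shows "marks f \<in> M \<rightarrow>\<^sub>M PiM UNIV (\<lambda>_. borel)"
  unfolding marks_eq[abs_def] by (rule measurable_compose[OF enumerated measurable_marks_of[OF assms]])

lemma measurable_marks [measurable]:
  fixes f :: "real ^ 'd \<Rightarrow> 'c :: {zero, topological_space}"
  assumes "f \<in> borel_measurable borel"
  shows "(\<lambda>\<omega>. marks f \<omega> j) \<in> borel_measurable M"
  by (rule measurable_compose[OF measurable_marks_seq[OF assms] measurable_component_singleton]) simp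

lemma nn_integral_point_process:
  assumes [measurable]: "g \<in> borel_measurable borel"
  shows "(\<integral>\<^sup>+y. g y \<partial>point_process n x \<omega>) = (\<integral>\<^sup>+j. marks g \<omega> j \<partial>count_space UNIV)"
proof -
  define A where "A = {j. 1 \<le> j \<and> enat j \<le> n \<omega>}"
  have "(\<integral>\<^sup>+y. g y \<partial>point_process n x \<omega>) = (\<integral>\<^sup>+j. g (x j \<omega>) \<partial>count_space A)"
    unfolding point_process_def A_def by (subst nn_integral_distr) auto
  also have "\<dots> = (\<integral>\<^sup>+j. g (x (Suc j) \<omega>) \<partial>count_space {j. enat (Suc j) \<le> n \<omega>})"
  proof (rule nn_integral_bij_count_space[symmetric])
    show "bij_betw Suc {j. enat (Suc j) \<le> n \<omega>} A"
      by (rule bij_betwI[where g = "\<lambda>j. j - 1"]) (auto simp: A_def)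
  qed
  also have "\<dots> = (\<integral>\<^sup>+j. marks g \<omega> j \<partial>count_space UNIV)"
    by (subst nn_integral_count_space_indicator)
       (auto simp: point_marks_def intro!: nn_integral_cong split: split_indicator)
  finally show ?thesis .
qed

lemma emeasure_point_process:
  assumes "B \<in> sets borel"
  shows "emeasure (point_process n x \<omega>) B = (\<integral>\<^sup>+j. marks (indicator B) \<omega> j \<partial>count_space UNIV)"
  using nn_integral_point_process[of "indicator B" \<omega>] assms by (simp add: point_process_def)

lemma measurable_point_process:
  "B \<in> sets borel \<Longrightarrow> (\<lambda>\<omega>. emeasure (point_process n x \<omega>) B) \<in> borel_measurable M"
  by (simp add: emeasure_point_process measurable_nn_integral_count)

lemma measurable_random_measure:
  "(\<lambda>\<omega>. \<lambda>B\<in>sets borel. emeasure (point_process n x \<omega>) B) \<in> M \<rightarrow>\<^sub>M (\<Pi>\<^sub>M B\<in>sets borel. borel)"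
  by (rule measurable_restrict) (rule measurable_point_process)

lemma sets_intensity [measurable_cong]: "sets (intensity M n x) = sets borel"
  unfolding intensity_def by (simp add: sets.sigma_sets_eq[of borel, simplified])

lemma emeasure_intensity:
  assumes "B \<in> sets borel"
  shows "emeasure (intensity M n x) B = (\<integral>\<^sup>+\<omega>. emeasure (point_process n x \<omega>) B \<partial>M)"
  unfolding intensity_def
proof (rule emeasure_measure_of_sigma)
  show "sigma_algebra UNIV (sets (borel :: (real ^ 'd) measure))"
    using sets.sigma_algebra_axioms[of "borel :: (real ^ 'd) measure"] by simp
  show "countably_additive (sets borel) (\<lambda>B. \<integral>\<^sup>+\<omega>. emeasure (point_process n x \<omega>) B \<partial>M)"
  proof (rule countably_additiveI)
    fix A :: "nat \<Rightarrow> (real ^ 'd) set"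
    assume A: "range A \<subseteq> sets borel" "disjoint_family A" "(\<Union>i. A i) \<in> sets borel"
    have "(\<Sum>i. \<integral>\<^sup>+\<omega>. emeasure (point_process n x \<omega>) (A i) \<partial>M)
      = (\<integral>\<^sup>+\<omega>. (\<Sum>i. emeasure (point_process n x \<omega>) (A i)) \<partial>M)"
      by (rule nn_integral_suminf[symmetric]) (use A measurable_point_process in auto)
    also have "\<dots> = (\<integral>\<^sup>+\<omega>. emeasure (point_process n x \<omega>) (\<Union>i. A i) \<partial>M)"
      by (intro nn_integral_cong suminf_emeasure) (use A in \<open>auto simp: point_process_def\<close>)
    finally show "(\<Sum>i. \<integral>\<^sup>+\<omega>. emeasure (point_process n x \<omega>) (A i) \<partial>M)
      = (\<integral>\<^sup>+\<omega>. emeasure (point_process n x \<omega>) (\<Union>i. A i) \<partial>M)" .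
  qed
qed (use assms in \<open>auto simp: positive_def\<close>)

text \<open>
  The intensity as an image of the product of the probability measure with counting measure; this
  reduces Campbell's formula to Fubini's theorem.
\<close>
lemma intensity_eq_distr:
  "intensity M n x
    = distr (density (M \<Otimes>\<^sub>M count_space UNIV) (\<lambda>p. marks (\<lambda>_. 1) (fst p) (snd p))) borel (\<lambda>p. marks id (fst p) (snd p))"
  (is "_ = distr (density ?N ?h) borel ?X")
proof (rule measure_eqI)
  interpret C: sigma_finite_measure "count_space (UNIV :: nat set)"
    by (rule sigma_finite_measure_count_space_countable) simp
  have h [measurable]: "?h \<in> borel_measurable ?N"
    by (rule measurable_count_pair[of UNIV "\<lambda>j \<omega>. marks (\<lambda>_. 1) \<omega> j"]) (simp_all add: measurable_marks)
  have X [measurable]: "?X \<in> borel_measurable ?N"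
    by (rule measurable_count_pair[of UNIV "\<lambda>j \<omega>. marks id \<omega> j"]) (simp_all add: measurable_marks id_def)
  fix B assume "B \<in> sets (intensity M n x)"
  then have B [measurable]: "B \<in> sets borel" by (simp add: sets_intensity)
  have "emeasure (distr (density ?N ?h) borel ?X) B = (\<integral>\<^sup>+p. ?h p * indicator B (?X p) \<partial>?N)"
  proof -
    have "emeasure (distr (density ?N ?h) borel ?X) B = (\<integral>\<^sup>+y. indicator B y \<partial>distr (density ?N ?h) borel ?X)"
      by (rule nn_integral_indicator[symmetric]) simp
    also have "\<dots> = (\<integral>\<^sup>+p. indicator B (?X p) \<partial>density ?N ?h)"
      by (rule nn_integral_distr) simp_all
    also have "\<dots> = (\<integral>\<^sup>+p. ?h p * indicator B (?X p) \<partial>?N)"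
      by (rule nn_integral_density) simp_all
    finally show ?thesis .
  qed
  also have "\<dots> = (\<integral>\<^sup>+\<omega>. \<integral>\<^sup>+j. marks (\<lambda>_. 1) \<omega> j * indicator B (marks id \<omega> j) \<partial>count_space UNIV \<partial>M)"
    using C.nn_integral_fst[of "\<lambda>p. ?h p * indicator B (?X p)" M] by simp
  also have "\<dots> = (\<integral>\<^sup>+\<omega>. \<integral>\<^sup>+j. marks (indicator B) \<omega> j \<partial>count_space UNIV \<partial>M)"
    by (intro nn_integral_cong) (simp add: point_marks_def)
  also have "\<dots> = emeasure (intensity M n x) B"
    by (simp add: emeasure_intensity emeasure_point_process)
  finally show "emeasure (intensity M n x) B = emeasure (distr (density ?N ?h) borel ?X) B" ..
qed (simp add: sets_intensity)

lemma campbell: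
  assumes [measurable]: "g \<in> borel_measurable borel"
  shows "(\<integral>\<^sup>+y. g y \<partial>intensity M n x) = (\<integral>\<^sup>+\<omega>. \<integral>\<^sup>+j. marks g \<omega> j \<partial>count_space UNIV \<partial>M)"
proof -
  interpret C: sigma_finite_measure "count_space (UNIV :: nat set)"
    by (rule sigma_finite_measure_count_space_countable) simp
  let ?N = "M \<Otimes>\<^sub>M count_space (UNIV :: nat set)"
  have h [measurable]: "(\<lambda>p. marks (\<lambda>_. 1 :: ennreal) (fst p) (snd p)) \<in> borel_measurable ?N"
    by (rule measurable_count_pair[of UNIV "\<lambda>j \<omega>. marks (\<lambda>_. 1) \<omega> j"]) (simp_all add: measurable_marks)
  have X [measurable]: "(\<lambda>p. marks id (fst p) (snd p)) \<in> borel_measurable ?N"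
    by (rule measurable_count_pair[of UNIV "\<lambda>j \<omega>. marks id \<omega> j"]) (simp_all add: measurable_marks id_def)
  have "(\<integral>\<^sup>+y. g y \<partial>intensity M n x)
    = (\<integral>\<^sup>+p. marks (\<lambda>_. 1) (fst p) (snd p) * g (marks id (fst p) (snd p)) \<partial>?N)"
    by (simp add: intensity_eq_distr nn_integral_distr nn_integral_density)
  also have "\<dots> = (\<integral>\<^sup>+\<omega>. \<integral>\<^sup>+j. marks (\<lambda>_. 1) \<omega> j * g (marks id \<omega> j) \<partial>count_space UNIV \<partial>M)"
    using C.nn_integral_fst[of "\<lambda>p. marks (\<lambda>_. 1) (fst p) (snd p) * g (marks id (fst p) (snd p))" M] by simp
  also have "\<dots> = (\<integral>\<^sup>+\<omega>. \<integral>\<^sup>+j. marks g \<omega> j \<partial>count_space UNIV \<partial>M)"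
    by (intro nn_integral_cong) (simp add: point_marks_def)
  finally show ?thesis .
qed

lemma campbell_complex:
  fixes f :: "real ^ 'd \<Rightarrow> complex"
  assumes [measurable]: "f \<in> borel_measurable borel"
    and int: "(\<integral>\<^sup>+y. ennreal (norm (f y)) \<partial>intensity M n x) < \<infinity>"
  shows "(\<integral>\<omega>. (\<Sum>\<^sub>\<infinity>j. marks f \<omega> j) \<partial>M) = (\<integral>y. f y \<partial>intensity M n x)"
proof -
  interpret C: sigma_finite_measure "count_space (UNIV :: nat set)"
    by (rule sigma_finite_measure_count_space_countable) simp
  let ?N = "M \<Otimes>\<^sub>M count_space (UNIV :: nat set)"
  interpret PC: pair_sigma_finite M "count_space (UNIV :: nat set)" ..
  have h [measurable]: "(\<lambda>p. marks (\<lambda>_. 1 :: ennreal) (fst p) (snd p)) \<in> borel_measurable ?N"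
    by (rule measurable_count_pair[of UNIV "\<lambda>j \<omega>. marks (\<lambda>_. 1) \<omega> j"]) (simp_all add: measurable_marks)
  have h1 [measurable]: "(\<lambda>p. marks (\<lambda>_. 1 :: real) (fst p) (snd p)) \<in> borel_measurable ?N"
    by (rule measurable_count_pair[of UNIV "\<lambda>j \<omega>. marks (\<lambda>_. 1) \<omega> j"]) (simp_all add: measurable_marks)
  have X [measurable]: "(\<lambda>p. marks id (fst p) (snd p)) \<in> borel_measurable ?N"
    by (rule measurable_count_pair[of UNIV "\<lambda>j \<omega>. marks id \<omega> j"]) (simp_all add: measurable_marks id_def)
  have F [measurable]: "(\<lambda>p. marks f (fst p) (snd p)) \<in> borel_measurable ?N"
    by (rule measurable_count_pair[of UNIV "\<lambda>j \<omega>. marks f \<omega> j"]) (simp_all add: measurable_marks)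
  have e1: "marks (\<lambda>_. 1 :: ennreal) \<omega> j = ennreal (marks (\<lambda>_. 1) \<omega> j)" for \<omega> j by (simp add: point_marks_def)
  have "(\<integral>y. f y \<partial>intensity M n x)
    = (\<integral>p. marks (\<lambda>_. 1) (fst p) (snd p) *\<^sub>R f (marks id (fst p) (snd p)) \<partial>?N)"
  proof -
    have fX: "(\<lambda>p. f (marks id (fst p) (snd p))) \<in> borel_measurable ?N" by measurable
    have nn: "AE p in ?N. 0 \<le> marks (\<lambda>_. 1 :: real) (fst p) (snd p)" by (rule AE_I2) (simp add: point_marks_def)
    have "(\<integral>y. f y \<partial>intensity M n x)
      = (\<integral>p. f (marks id (fst p) (snd p)) \<partial>density ?N (\<lambda>p. ennreal (marks (\<lambda>_. 1) (fst p) (snd p))))"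
      unfolding intensity_eq_distr e1 by (rule integral_distr) simp_all
    also have "\<dots> = (\<integral>p. marks (\<lambda>_. 1) (fst p) (snd p) *\<^sub>R f (marks id (fst p) (snd p)) \<partial>?N)"
      by (rule integral_density[OF fX h1 nn])
    finally show ?thesis .
  qed
  also have "\<dots> = (\<integral>p. marks f (fst p) (snd p) \<partial>?N)"
    by (intro Bochner_Integration.integral_cong) (simp_all add: point_marks_def)
  also have "\<dots> = (\<integral>\<omega>. \<integral>j. marks f \<omega> j \<partial>count_space UNIV \<partial>M)"
  proof (rule PC.integral_fst'[symmetric, of "\<lambda>p. marks f (fst p) (snd p)", simplified])
    show "integrable ?N (\<lambda>p. marks f (fst p) (snd p))"
    proof (rule integrableI_bounded[OF F])
      have "(\<integral>\<^sup>+p. ennreal (norm (marks f (fst p) (snd p))) \<partial>?N) = (\<integral>\<^sup>+\<omega>. \<integral>\<^sup>+j. ennreal (norm (marks f \<omega> j)) \<partial>count_space UNIV \<partial>M)"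
        using C.nn_integral_fst[of "\<lambda>p. ennreal (norm (marks f (fst p) (snd p)))" M] by simp
      also have "\<dots> = (\<integral>\<^sup>+\<omega>. \<integral>\<^sup>+j. marks (\<lambda>y. ennreal (norm (f y))) \<omega> j \<partial>count_space UNIV \<partial>M)"
        by (intro nn_integral_cong) (simp add: point_marks_def)
      also have "\<dots> < \<infinity>" using int by (simp add: campbell)
      finally show "(\<integral>\<^sup>+p. ennreal (norm (marks f (fst p) (snd p))) \<partial>?N) < \<infinity>" .
    qed
  qed
  also have "\<dots> = (\<integral>\<omega>. (\<Sum>\<^sub>\<infinity>j. marks f \<omega> j) \<partial>M)"
    by (simp add: infsum_eq_integral)
  finally show ?thesis ..
qed

lemma intensity_from_law:
  assumes "B \<in> sets borel"
  shows "emeasure (intensity M n x) B = (\<integral>\<^sup>+q. q B \<partial>point_process_law M n x)"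
  unfolding point_process_law_def emeasure_intensity[OF assms]
  by (subst nn_integral_distr[OF measurable_random_measure]) (use assms in auto)

end

text \<open>
  The integral of \<open>g\<close> against a measure, as a measurable function of the values of this measure on
  Borel sets. The simple functions that approximate \<open>g\<close> are chosen once, independently of the measure.
\<close>
definition functional_integral :: "('b :: topological_space \<Rightarrow> ennreal) \<Rightarrow> ('b set \<Rightarrow> ennreal) \<Rightarrow> ennreal" where
  "functional_integral g q =
     (let s = (SOME s. incseq s \<and> (\<forall>i. simple_function borel (s i)) \<and> (\<forall>y. (SUP i. s i y) = g y))
      in SUP i. \<Sum>z\<in>range (s i). z * q (s i -` {z}))"

lemma functional_integral:
  fixes g :: "'b :: topological_space \<Rightarrow> ennreal"
  assumes g: "g \<in> borel_measurable borel"
  shows "functional_integral g \<in> borel_measurable (\<Pi>\<^sub>M B\<in>sets borel. borel)"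
    and "sets m = sets borel \<Longrightarrow> functional_integral g (\<lambda>B\<in>sets borel. emeasure m B) = (\<integral>\<^sup>+y. g y \<partial>m)"
proof -
  define s where "s = (SOME s. incseq s \<and> (\<forall>i. simple_function borel (s i)) \<and> (\<forall>y. (SUP i. s i y) = g y))"
  have "\<exists>s. incseq s \<and> (\<forall>i. simple_function borel (s i)) \<and> (\<forall>y. (SUP i. s i y) = g y)"
    by (rule borel_measurable_implies_simple_function_sequence'[OF g]) blast
  then have "incseq s \<and> (\<forall>i. simple_function borel (s i)) \<and> (\<forall>y. (SUP i. s i y) = g y)"
    unfolding s_def by (rule someI_ex)
  then have s: "incseq s" "\<And>i. simple_function borel (s i)" "\<And>y. (SUP i. s i y) = g y" by auto
  have fi: "functional_integral g q = (SUP i. \<Sum>z\<in>range (s i). z * q (s i -` {z}))" for q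
    unfolding functional_integral_def s_def Let_def ..
  have B: "s i -` {z} \<in> sets borel" for i z
    using simple_functionD(2)[OF s(2)[of i], of "{z}"] by simp
  have "(\<lambda>q. SUP i. \<Sum>z\<in>range (s i). z * q (s i -` {z})) \<in> borel_measurable (\<Pi>\<^sub>M B\<in>sets (borel :: 'b measure). borel)"
    using B by (intro borel_measurable_SUP borel_measurable_sum borel_measurable_times_ennreal measurable_component_singleton) auto
  then show "functional_integral g \<in> borel_measurable (\<Pi>\<^sub>M B\<in>sets borel. borel)"
    using fi by (simp add: fun_eq_iff[symmetric] measurable_cong[of _ "functional_integral g"])
  assume m: "sets m = sets borel"
  then have sp: "space m = UNIV" using sets_eq_imp_space_eq[OF m] by simp
  have sm: "simple_function m (s i)" for i
    using s(2)[of i] m sp by (simp add: simple_function_def)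
  have "(\<integral>\<^sup>+y. g y \<partial>m) = (\<integral>\<^sup>+y. (SUP i. s i y) \<partial>m)" by (simp add: s(3))
  also have "\<dots> = (SUP i. \<integral>\<^sup>+y. s i y \<partial>m)"
    by (rule nn_integral_monotone_convergence_SUP[OF s(1)]) (rule borel_measurable_simple_function[OF sm])
  also have "\<dots> = (SUP i. \<Sum>z\<in>range (s i). z * emeasure m (s i -` {z}))"
    by (simp add: nn_integral_eq_simple_integral[OF sm] simple_integral_def sp)
  also have "\<dots> = functional_integral g (\<lambda>B\<in>sets borel. emeasure m B)"
    unfolding fi using B by simp
  finally show "functional_integral g (\<lambda>B\<in>sets borel. emeasure m B) = (\<integral>\<^sup>+y. g y \<partial>m)" ..
qed

text \<open>
  The integral of a complex function against a measure, again as a function of the values of the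
  measure. Since the offspring sum is such a functional of the point process, its law is determined
  by the law of the random measure, whatever the enumeration of the points.
\<close>
definition sum_functional :: "('b :: topological_space \<Rightarrow> complex) \<Rightarrow> ('b set \<Rightarrow> ennreal) \<Rightarrow> complex" where
  "sum_functional f q =
     (if functional_integral (\<lambda>y. ennreal (norm (f y))) q < \<infinity>
      then Complex (enn2real (functional_integral (\<lambda>y. ennreal (Re (f y))) q) - enn2real (functional_integral (\<lambda>y. ennreal (- Re (f y))) q))
                   (enn2real (functional_integral (\<lambda>y. ennreal (Im (f y))) q) - enn2real (functional_integral (\<lambda>y. ennreal (- Im (f y))) q))
      else 0)"

lemma measurable_sum_functional:
  fixes f :: "'b :: topological_space \<Rightarrow> complex"
  assumes [measurable]: "f \<in> borel_measurable borel"
  shows "sum_functional f \<in> borel_measurable (\<Pi>\<^sub>M B\<in>sets borel. borel)"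
proof -
  have [measurable]: "functional_integral (\<lambda>y. ennreal (norm (f y))) \<in> borel_measurable (\<Pi>\<^sub>M B\<in>sets borel. borel)"
    "functional_integral (\<lambda>y. ennreal (Re (f y))) \<in> borel_measurable (\<Pi>\<^sub>M B\<in>sets borel. borel)"
    "functional_integral (\<lambda>y. ennreal (- Re (f y))) \<in> borel_measurable (\<Pi>\<^sub>M B\<in>sets borel. borel)"
    "functional_integral (\<lambda>y. ennreal (Im (f y))) \<in> borel_measurable (\<Pi>\<^sub>M B\<in>sets borel. borel)"
    "functional_integral (\<lambda>y. ennreal (- Im (f y))) \<in> borel_measurable (\<Pi>\<^sub>M B\<in>sets borel. borel)"
    by (rule functional_integral; measurable)+
  show ?thesis unfolding sum_functional_def[abs_def] Complex_eq by measurable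
qed

context enumerated_process begin

lemma infsum_marks_eq_functional:
  fixes f :: "real ^ 'd \<Rightarrow> complex"
  assumes f [measurable]: "f \<in> borel_measurable borel"
  shows "(\<Sum>\<^sub>\<infinity>j. marks f \<omega> j) = sum_functional f (\<lambda>B\<in>sets borel. emeasure (point_process n x \<omega>) B)"
proof -
  have sets: "sets (point_process n x \<omega>) = sets borel" by (simp add: point_process_def)
  have F: "functional_integral (\<lambda>y. ennreal (h (f y))) (\<lambda>B\<in>sets borel. emeasure (point_process n x \<omega>) B)
      = (\<integral>\<^sup>+j. ennreal (h (marks f \<omega> j)) \<partial>count_space UNIV)"
    if [measurable]: "h \<in> borel_measurable borel" and h0: "h 0 = 0" for h :: "complex \<Rightarrow> real"
  proof -
    have gm: "(\<lambda>y. ennreal (h (f y))) \<in> borel_measurable borel" by measurable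
    have "functional_integral (\<lambda>y. ennreal (h (f y))) (\<lambda>B\<in>sets borel. emeasure (point_process n x \<omega>) B)
      = (\<integral>\<^sup>+j. marks (\<lambda>y. ennreal (h (f y))) \<omega> j \<partial>count_space UNIV)"
      by (simp add: functional_integral(2)[OF gm sets] nn_integral_point_process[OF gm])
    also have "\<dots> = (\<integral>\<^sup>+j. ennreal (h (marks f \<omega> j)) \<partial>count_space UNIV)"
      by (intro nn_integral_cong) (simp add: point_marks_def h0)
    finally show ?thesis .
  qed
  show ?thesis
  proof (cases "(\<integral>\<^sup>+j. ennreal (norm (marks f \<omega> j)) \<partial>count_space UNIV) < \<infinity>")
    case True
    then have int: "integrable (count_space UNIV) (marks f \<omega>)"
      by (simp add: integrable_iff_bounded)
    have R: "Re (\<Sum>\<^sub>\<infinity>j. marks f \<omega> j) = enn2real (\<integral>\<^sup>+j. ennreal (Re (marks f \<omega> j)) \<partial>count_space UNIV)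
        - enn2real (\<integral>\<^sup>+j. ennreal (- Re (marks f \<omega> j)) \<partial>count_space UNIV)"
      unfolding infsum_eq_integral integral_Re[OF int, symmetric]
      by (rule real_lebesgue_integral_def[OF integrable_Re[OF int]])
    have I: "Im (\<Sum>\<^sub>\<infinity>j. marks f \<omega> j) = enn2real (\<integral>\<^sup>+j. ennreal (Im (marks f \<omega> j)) \<partial>count_space UNIV)
        - enn2real (\<integral>\<^sup>+j. ennreal (- Im (marks f \<omega> j)) \<partial>count_space UNIV)"
      unfolding infsum_eq_integral integral_Im[OF int, symmetric]
      by (rule real_lebesgue_integral_def[OF integrable_Im[OF int]])
    show ?thesis
      using True unfolding sum_functional_def
      by (intro complex_eqI) (simp_all add: F[of norm] F[of Re] F[of "\<lambda>z. - Re z"] F[of Im] F[of "\<lambda>z. - Im z"] R I)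
  next
    case False
    then have "\<not> marks f \<omega> summable_on UNIV" by (simp add: summable_on_iff_nn_integral)
    then show ?thesis using False by (simp add: infsum_not_exists sum_functional_def F[of norm])
  qed
qed

lemma distr_infsum_marks:
  fixes f :: "real ^ 'd \<Rightarrow> complex"
  assumes f: "f \<in> borel_measurable borel"
  shows "distr M borel (\<lambda>\<omega>. \<Sum>\<^sub>\<infinity>j. marks f \<omega> j) = distr (point_process_law M n x) borel (sum_functional f)"
  unfolding point_process_law_def infsum_marks_eq_functional[OF f]
  by (subst distr_distr[OF measurable_sum_functional[OF f] measurable_random_measure]) (simp add: comp_def)

end

section \<open>The branching random walk as a cascade\<close>

lemma log_plus_mono: "0 \<le> x \<Longrightarrow> x \<le> y \<Longrightarrow> log_plus x \<le> log_plus y"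
  unfolding log_plus_def by (auto simp: le_max_iff_disj)

text \<open>
  For \<open>|z| > e\<close> the logarithm is at least \<open>1\<close>, so that \<open>1 + log_plus |z - 1|\<close> is at most three times the
  logarithm of \<open>|z|\<close> and the exponent \<open>2\<close> may be enlarged to \<open>2 + \<epsilon>\<close>.
\<close>
lemma excess_moment_bound:
  fixes z :: complex
  assumes "0 < \<alpha>" "0 < \<epsilon>"
  shows "norm (z - 1) powr \<alpha> * (1 + log_plus (norm (z - 1)))\<^sup>2
    \<le> 4 powr \<alpha> * (1 + log_plus 4)\<^sup>2 + 9 * 2 powr \<alpha> * (norm z powr \<alpha> * log_plus (norm z) powr (2 + \<epsilon>))"
proof (cases "norm z \<le> exp 1")
  case True
  have x: "norm (z - 1) \<le> 4" using True exp_le norm_triangle_ineq4[of z 1] by simp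
  have "norm (z - 1) powr \<alpha> * (1 + log_plus (norm (z - 1)))\<^sup>2 \<le> 4 powr \<alpha> * (1 + log_plus 4)\<^sup>2"
    using x assms log_plus_nonneg
    by (intro mult_mono powr_mono2 power_mono add_left_mono log_plus_mono) (auto intro!: add_nonneg_nonneg)
  then show ?thesis by (simp add: add_increasing2)
next
  case False
  then have z: "norm z > exp 1" by simp
  have e1: "exp (1::real) > 1" by simp
  then have z1: "norm z > 1" using z by linarith
  then have z0: "z \<noteq> 0" by auto
  define y where "y = ln (norm z)"
  have "ln (exp 1) \<le> y" unfolding y_def using z z1 by (subst ln_le_cancel_iff) auto
  then have y: "y \<ge> 1" by simp
  have lp: "log_plus (norm z) = y" using y z0 by (simp add: log_plus_def y_def)
  have x: "norm (z - 1) \<le> 2 * norm z" using z1 norm_triangle_ineq4[of z 1] by simp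
  have "log_plus (norm (z - 1)) \<le> log_plus (2 * norm z)" by (intro log_plus_mono x) simp
  also have "\<dots> = ln 2 + y" using z0 z1 y by (simp add: log_plus_def ln_mult y_def)
  also have "\<dots> \<le> 2 * y" using ln_2_less_1 y by linarith
  finally have l: "1 + log_plus (norm (z - 1)) \<le> 3 * y" using y by simp
  have "norm (z - 1) powr \<alpha> * (1 + log_plus (norm (z - 1)))\<^sup>2 \<le> (2 * norm z) powr \<alpha> * (3 * y)\<^sup>2"
    using x l assms log_plus_nonneg[of "norm (z - 1)"]
    by (intro mult_mono powr_mono2 power_mono) auto
  also have "\<dots> = 9 * 2 powr \<alpha> * (norm z powr \<alpha> * y\<^sup>2)"
    by (simp add: powr_mult power_mult_distrib)
  also have "\<dots> \<le> 9 * 2 powr \<alpha> * (norm z powr \<alpha> * y powr (2 + \<epsilon>))"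
  proof -
    have "y powr 2 \<le> y powr (2 + \<epsilon>)" using y assms by (intro powr_mono) auto
    then have "y\<^sup>2 \<le> y powr (2 + \<epsilon>)" using y by simp
    then show ?thesis by (intro mult_left_mono) auto
  qed
  finally show ?thesis unfolding lp by (simp add: add_increasing)
qed

lemma generation_length: "u \<in> generation N \<omega> n \<Longrightarrow> length u = n \<and> u \<in> lists {1..}"
proof (induction n arbitrary: u)
  case (Suc n)
  then obtain v j where v: "u = v @ [j]" "v \<in> generation N \<omega> n" "1 \<le> j" by auto
  then show ?case using Suc.IH[OF v(2)] by simp
qed simp

lemma generation_snoc:
  "u @ [i] \<in> generation N \<omega> (Suc n) \<longleftrightarrow> u \<in> generation N \<omega> n \<and> 1 \<le> i \<and> enat i \<le> N u \<omega>"
  by auto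

lemma position_snoc: "position X (u @ [i]) \<omega> = position X u \<omega> + X u i \<omega>"
  unfolding position_def by (simp add: nth_append)

lemma cpairing_add: "cpairing l (a + b) = cpairing l a + cpairing l b"
  by (simp add: cpairing_def sum.distrib algebra_simps)

lemma cpairing_0 [simp]: "cpairing l 0 = 0"
  by (simp add: cpairing_def)

lemma measurable_cpairing [measurable]: "cpairing l \<in> borel_measurable borel"
proof -
  have "(\<lambda>x. x $ k) \<in> borel_measurable (borel :: (real ^ 'd) measure)" for k
    by (intro borel_measurable_continuous_onI continuous_intros)
  then show ?thesis unfolding cpairing_def[abs_def] by measurable
qed

lemma image_map_Suc_level: "map Suc ` level n = {u. length u = n \<and> u \<in> lists {1..}}"
proof (intro equalityI subsetI)
  fix u :: "nat list" assume u: "u \<in> {u. length u = n \<and> u \<in> lists {1..}}"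
  have "map (Suc \<circ> (\<lambda>i. i - 1)) u = u"
    by (rule map_idI) (use u in \<open>auto simp: in_lists_conv_set\<close>)
  then have "u = map Suc (map (\<lambda>i. i - 1) u)" by simp
  moreover have "map (\<lambda>i. i - 1) u \<in> level n" using u by (simp add: level_def)
  ultimately show "u \<in> map Suc ` level n" by blast
qed (auto simp: level_def)

text \<open>
  The nodes of the tree of positive integers are written as \<open>map Suc v\<close>. A node outside its
  generation has weight \<open>0\<close> on both sides, as some factor of the product vanishes.
\<close>
lemma weight_eq_node_weight:
  fixes X :: "nat list \<Rightarrow> nat \<Rightarrow> 'a \<Rightarrow> real ^ 'd"
  shows "weight \<mu> N X l (map Suc v) \<omega>
    = node_weight (\<lambda>v. point_marks (N (map Suc v)) (X (map Suc v)) (\<lambda>y. exp (- cpairing l y) / laplace \<mu> l) \<omega>) v"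
proof (induction v rule: rev_induct)
  case Nil
  then show ?case by (simp add: weight_def position_def)
next
  case (snoc j v)
  let ?w = "\<lambda>v. point_marks (N (map Suc v)) (X (map Suc v)) (\<lambda>y. exp (- cpairing l y) / laplace \<mu> l) \<omega>"
  have "node_weight ?w (v @ [j]) = weight \<mu> N X l (map Suc v) \<omega> * ?w v j"
    by (simp add: snoc.IH)
  also have "\<dots> = weight \<mu> N X l (map Suc v @ [Suc j]) \<omega>"
  proof (cases "map Suc v \<in> generation N \<omega> (length v) \<and> enat (Suc j) \<le> N (map Suc v) \<omega>")
    case True
    then have g: "map Suc v @ [Suc j] \<in> generation N \<omega> (Suc (length v))" unfolding generation_snoc by simp
    have "exp (- cpairing l (p + q)) = exp (- cpairing l p) * exp (- cpairing l q)" for p q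
      by (simp add: cpairing_add exp_add[symmetric])
    then show ?thesis
      using True g unfolding weight_def point_marks_def
      by (simp add: position_snoc divide_inverse mult_ac del: generation.simps)
  next
    case False
    then have "map Suc v @ [Suc j] \<notin> generation N \<omega> (Suc (length v))" unfolding generation_snoc by simp
    then show ?thesis
      using False unfolding weight_def point_marks_def
      by (auto simp del: generation.simps)
  qed
  finally show ?case by simp
qed

context branching_random_walk begin

lemma enumerated_node: "u \<in> lists {1..} \<Longrightarrow> enumerated_process M (N u) (X u)"
  using independent by unfold_locales (auto simp: indep_vars_def)

lemma enumerated_reference: "enumerated_process M0 N0 X0"
  using reference_measurable by unfold_locales

lemma intensity_node:
  assumes "u \<in> lists {1..}"
  shows "intensity M (N u) (X u) = intensity M0 N0 X0"
proof -
  interpret A: enumerated_process M "N u" "X u" by (rule enumerated_node[OF assms])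
  interpret B: enumerated_process M0 N0 X0 by (rule enumerated_reference)
  show ?thesis
  proof (rule measure_eqI)
    fix B assume "B \<in> sets (intensity M (N u) (X u))"
    then have "B \<in> sets borel" by (simp add: A.sets_intensity)
    then show "emeasure (intensity M (N u) (X u)) B = emeasure (intensity M0 N0 X0) B"
      by (simp add: A.intensity_from_law B.intensity_from_law identically_distributed[OF assms])
  qed (simp add: A.sets_intensity B.sets_intensity)
qed

definition environment :: "(real ^ 'd \<Rightarrow> complex) \<Rightarrow> 'a \<Rightarrow> nat list \<Rightarrow> nat \<Rightarrow> complex" where
  "environment f \<omega> v = point_marks (N (map Suc v)) (X (map Suc v)) f \<omega>"

definition offspring_law :: "(real ^ 'd \<Rightarrow> complex) \<Rightarrow> nat list \<Rightarrow> (nat \<Rightarrow> complex) measure" where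
  "offspring_law f v = distr M (PiM UNIV (\<lambda>_. borel)) (\<lambda>\<omega>. environment f \<omega> v)"

lemma map_Suc_lists: "map Suc v \<in> lists {1..}"
  by (auto simp: in_lists_conv_set)

lemma node_process: "enumerated_process M (N (map Suc v)) (X (map Suc v))"
  by (rule enumerated_node[OF map_Suc_lists])

lemma measurable_environment_node:
  "f \<in> borel_measurable borel \<Longrightarrow> (\<lambda>\<omega>. environment f \<omega> v) \<in> M \<rightarrow>\<^sub>M PiM UNIV (\<lambda>_. borel)"
  unfolding environment_def by (rule enumerated_process.measurable_marks_seq[OF node_process])

lemma measurable_environment:
  assumes "f \<in> borel_measurable borel"
  shows "environment f \<in> M \<rightarrow>\<^sub>M PiM UNIV (offspring_law f)"
  by (rule measurable_PiM_single')
     (use measurable_environment_node[OF assms] in \<open>auto simp: offspring_law_def space_PiM\<close>)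

text \<open>
  The independence of the nodes makes the family of all marks a product measure; the tuples of
  positive integers are reindexed by those of natural numbers.
\<close>
lemma environment_law:
  assumes f: "f \<in> borel_measurable borel"
  shows "distr M (PiM UNIV (offspring_law f)) (environment f) = PiM UNIV (offspring_law f)"
proof -
  define K where "K = lists {1 :: nat..}"
  define B where "B = (PiM UNIV (\<lambda>_ :: nat. borel) :: (nat \<Rightarrow> complex) measure)"
  define Y where "Y u \<omega> = marks_of f (enumerated_points (N u) (X u) \<omega>)" for u \<omega>
  have ind: "indep_vars (\<lambda>_. B) Y K"
    unfolding Y_def B_def K_def
    by (rule indep_vars_compose2[OF independent]) (rule measurable_marks_of[OF f])
  have rv: "Y u \<in> M \<rightarrow>\<^sub>M B" if "u \<in> K" for u
    using ind that by (auto simp: indep_vars_def)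
  have K0: "K \<noteq> {}" by (auto simp: K_def)
  have law: "distr M (PiM K (\<lambda>_. B)) (\<lambda>\<omega>. \<lambda>u\<in>K. Y u \<omega>) = PiM K (\<lambda>u. distr M B (Y u))"
    using ind indep_vars_iff_distr_eq_PiM'[where I = K and X = Y and M' = "\<lambda>_. B"] K0 rv by blast
  have env: "environment f \<omega> v = Y (map Suc v) \<omega>" for \<omega> v
    unfolding environment_def Y_def enumerated_process.marks_eq[OF node_process] ..
  have off: "offspring_law f = (\<lambda>v. distr M B (Y (map Suc v)))"
    by (simp add: fun_eq_iff offspring_law_def env B_def)
  have mK: "map Suc v \<in> K" for v unfolding K_def by (rule map_Suc_lists)
  have "PiM UNIV (offspring_law f)
    = distr (PiM K (\<lambda>u. distr M B (Y u))) (PiM UNIV (offspring_law f)) (\<lambda>\<omega>. \<lambda>v\<in>UNIV. \<omega> (map Suc v))"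
    unfolding off
    by (rule distr_PiM_reindex[symmetric, where f = "map Suc"])
       (auto intro!: prob_space_distr rv mK injI)
  also have "\<dots> = distr (distr M (PiM K (\<lambda>_. B)) (\<lambda>\<omega>. \<lambda>u\<in>K. Y u \<omega>)) (PiM UNIV (offspring_law f)) (\<lambda>\<omega>. \<lambda>v\<in>UNIV. \<omega> (map Suc v))"
    by (simp only: law)
  also have "\<dots> = distr M (PiM UNIV (offspring_law f)) ((\<lambda>\<omega>. \<lambda>v\<in>UNIV. \<omega> (map Suc v)) \<circ> (\<lambda>\<omega>. \<lambda>u\<in>K. Y u \<omega>))"
  proof (rule distr_distr)
    show "(\<lambda>\<omega>. \<lambda>u\<in>K. Y u \<omega>) \<in> M \<rightarrow>\<^sub>M PiM K (\<lambda>_. B)" by (rule measurable_restrict) (rule rv)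
    show "(\<lambda>\<omega>. \<lambda>v\<in>UNIV. \<omega> (map Suc v)) \<in> PiM K (\<lambda>_. B) \<rightarrow>\<^sub>M PiM UNIV (offspring_law f)"
      unfolding off
      by (rule measurable_restrict) (simp add: measurable_component_singleton[OF mK, where M = "\<lambda>_. B"])
  qed
  also have "(\<lambda>\<omega>. \<lambda>v\<in>UNIV. \<omega> (map Suc v)) \<circ> (\<lambda>\<omega>. \<lambda>u\<in>K. Y u \<omega>) = environment f"
    by (simp add: fun_eq_iff env mK)
  finally show ?thesis ..
qed

lemma nn_integral_offspring:
  assumes f [measurable]: "f \<in> borel_measurable borel" and g [measurable]: "g \<in> borel_measurable borel" and g0: "g 0 = 0"
  shows "(\<integral>\<^sup>+e. \<integral>\<^sup>+j. g (e j) \<partial>count_space UNIV \<partial>offspring_law f v) = (\<integral>\<^sup>+y. g (f y) \<partial>intensity M0 N0 X0)"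
proof -
  interpret A: enumerated_process M "N (map Suc v)" "X (map Suc v)" by (rule node_process)
  have gm: "(\<lambda>e. \<integral>\<^sup>+j. g (e j) \<partial>count_space UNIV) \<in> borel_measurable (PiM (UNIV :: nat set) (\<lambda>_. borel))"
    by (rule measurable_nn_integral_count) simp_all
  have gf: "(\<lambda>y. g (f y)) \<in> borel_measurable borel" by measurable
  have "(\<integral>\<^sup>+e. \<integral>\<^sup>+j. g (e j) \<partial>count_space UNIV \<partial>offspring_law f v)
    = (\<integral>\<^sup>+\<omega>. \<integral>\<^sup>+j. g (environment f \<omega> v j) \<partial>count_space UNIV \<partial>M)"
    unfolding offspring_law_def by (rule nn_integral_distr[OF measurable_environment_node[OF f]]) (use gm in simp)
  also have "\<dots> = (\<integral>\<^sup>+\<omega>. \<integral>\<^sup>+j. A.marks (\<lambda>y. g (f y)) \<omega> j \<partial>count_space UNIV \<partial>M)"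
    by (intro nn_integral_cong) (simp add: environment_def point_marks_def g0)
  also have "\<dots> = (\<integral>\<^sup>+y. g (f y) \<partial>intensity M (N (map Suc v)) (X (map Suc v)))"
    by (rule A.campbell[OF gf, symmetric])
  finally show ?thesis by (simp add: intensity_node[OF map_Suc_lists])
qed

text \<open>
  Everything that is required of the offspring laws is a functional of the intensity or of the
  law of the offspring sum. Downward steps of \<open>\<nu>\<close> exist because the integral of \<open>exp (-\<alpha> s)\<close> against
  \<open>\<nu>\<close> is the expected number of children, which exceeds \<open>1\<close>.
\<close>
lemma spinal_cascade_offspring:
  fixes f :: "real ^ 'd \<Rightarrow> complex" and \<alpha> :: real
  defines "\<mu> \<equiv> intensity M0 N0 X0"
  defines "\<nu> \<equiv> distr (density \<mu> (\<lambda>y. ennreal (norm (f y) powr \<alpha>))) borel (\<lambda>y. ln (norm (f y)))"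
  assumes f [measurable]: "f \<in> borel_measurable borel" and f0: "\<And>y. f y \<noteq> 0"
    and alpha: "1 < \<alpha>" "\<alpha> < 2"
    and abs: "(\<integral>\<^sup>+y. ennreal (norm (f y)) \<partial>\<mu>) \<le> ennreal \<kappa>"
    and mean: "(\<integral>y. f y \<partial>\<mu>) = 1"
    and one: "(\<integral>\<^sup>+y. ennreal (norm (f y) powr \<alpha>) \<partial>\<mu>) = 1"
    and super: "emeasure \<mu> UNIV > 1"
    and moment: "(\<integral>\<^sup>+\<omega>. ennreal (norm ((\<Sum>\<^sub>\<infinity>j. environment f \<omega> [] j) - 1) powr \<alpha> * (1 + log_plus (norm ((\<Sum>\<^sub>\<infinity>j. environment f \<omega> [] j) - 1)))\<^sup>2) \<partial>M) < \<infinity>"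
  shows "spinal_cascade (offspring_law f) \<kappa> \<nu> \<alpha> (distr (offspring_law f []) borel excess)"
proof -
  have sm [measurable_cong]: "sets \<mu> = sets borel"
    unfolding \<mu>_def by (rule enumerated_process.sets_intensity[OF enumerated_reference])
  have spm: "space \<mu> = UNIV" using sets_eq_imp_space_eq[OF sm] by simp
  have nu: "(\<integral>\<^sup>+s. g s \<partial>\<nu>) = (\<integral>\<^sup>+y. ennreal (norm (f y) powr \<alpha>) * g (ln (norm (f y))) \<partial>\<mu>)"
    if [measurable]: "g \<in> borel_measurable borel" for g
    unfolding \<nu>_def by (simp add: nn_integral_distr nn_integral_density)
  have sets_nu: "sets \<nu> = sets borel" by (simp add: \<nu>_def)
  have prob_nu: "prob_space \<nu>"
  proof (rule prob_spaceI)
    have "emeasure \<nu> (space \<nu>) = (\<integral>\<^sup>+s. 1 \<partial>\<nu>)" by simp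
    also have "\<dots> = 1" using one by (subst nu) simp_all
    finally show "emeasure \<nu> (space \<nu>) = 1" .
  qed
  have off_m: "excess \<in> borel_measurable (PiM UNIV (\<lambda>_. borel))"
    unfolding excess_def[abs_def] by (intro borel_measurable_diff measurable_infsum) auto
  have sum_m: "(\<lambda>e. \<Sum>\<^sub>\<infinity>j. e j) \<in> borel_measurable (PiM UNIV (\<lambda>_ :: nat. borel :: complex measure))"
    by (rule measurable_infsum) auto
  have step: "emeasure \<nu> {..<0} \<noteq> 0"
  proof
    assume z: "emeasure \<nu> {..<0} = 0"
    have "AE s in \<nu>. 0 \<le> s"
      using z by (intro AE_I[of _ _ "{..<0}"]) (auto simp: sets_nu)
    then have "(\<integral>\<^sup>+s. ennreal (exp (- \<alpha> * s)) \<partial>\<nu>) \<le> (\<integral>\<^sup>+s. 1 \<partial>\<nu>)"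
      using alpha by (intro nn_integral_mono_AE) (auto elim!: eventually_mono)
    also have "\<dots> = 1" using prob_space.emeasure_space_1[OF prob_nu] by simp
    finally have "(\<integral>\<^sup>+s. ennreal (exp (- \<alpha> * s)) \<partial>\<nu>) \<le> 1" .
    moreover have "(\<integral>\<^sup>+s. ennreal (exp (- \<alpha> * s)) \<partial>\<nu>) = emeasure \<mu> UNIV"
    proof -
      have "ennreal (norm (f y) powr \<alpha>) * ennreal (exp (- \<alpha> * ln (norm (f y)))) = 1" for y
        using f0[of y] by (simp add: powr_def ennreal_mult[symmetric] exp_add[symmetric])
      then have "(\<integral>\<^sup>+s. ennreal (exp (- \<alpha> * s)) \<partial>\<nu>) = (\<integral>\<^sup>+y. 1 \<partial>\<mu>)" by (subst nu) simp_all
      then show ?thesis by (simp add: spm)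
    qed
    ultimately show False using super by simp
  qed
  have mean_v: "(\<integral>e. (\<Sum>\<^sub>\<infinity>j. e j) \<partial>offspring_law f v) = 1" for v
  proof -
    interpret A: enumerated_process M "N (map Suc v)" "X (map Suc v)" by (rule node_process)
    have "(\<integral>e. (\<Sum>\<^sub>\<infinity>j. e j) \<partial>offspring_law f v) = (\<integral>\<omega>. (\<Sum>\<^sub>\<infinity>j. environment f \<omega> v j) \<partial>M)"
      unfolding offspring_law_def by (rule integral_distr[OF measurable_environment_node[OF f] sum_m])
    also have "\<dots> = (\<integral>y. f y \<partial>intensity M (N (map Suc v)) (X (map Suc v)))"
      unfolding environment_def
      by (rule A.campbell_complex[OF f])
         (use abs in \<open>auto simp: intensity_node[OF map_Suc_lists] \<mu>_def intro: le_less_trans\<close>)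
    finally show ?thesis using mean by (simp add: intensity_node[OF map_Suc_lists] \<mu>_def)
  qed
  have excess_v: "distr (offspring_law f v) borel excess
    = distr (distr (point_process_law M0 N0 X0) borel (sum_functional f)) borel (\<lambda>z. z - 1)" for v
  proof -
    interpret A: enumerated_process M "N (map Suc v)" "X (map Suc v)" by (rule node_process)
    have am: "(\<lambda>\<omega>. \<Sum>\<^sub>\<infinity>j. A.marks f \<omega> j) \<in> borel_measurable M"
      by (rule measurable_infsum) (auto intro!: A.measurable_marks)
    have "distr (offspring_law f v) borel excess = distr M borel (excess \<circ> (\<lambda>\<omega>. environment f \<omega> v))"
      unfolding offspring_law_def by (rule distr_distr[OF off_m measurable_environment_node[OF f]])
    also have "excess \<circ> (\<lambda>\<omega>. environment f \<omega> v) = (\<lambda>z. z - 1) \<circ> (\<lambda>\<omega>. \<Sum>\<^sub>\<infinity>j. A.marks f \<omega> j)"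
      by (simp add: fun_eq_iff excess_def environment_def)
    also have "distr M borel \<dots> = distr (distr M borel (\<lambda>\<omega>. \<Sum>\<^sub>\<infinity>j. A.marks f \<omega> j)) borel (\<lambda>z. z - 1)"
      by (rule distr_distr[symmetric]) (use am in auto)
    finally show ?thesis
      by (simp add: A.distr_infsum_marks[OF f] identically_distributed[OF map_Suc_lists])
  qed
  interpret RW: random_walk \<nu>
    using prob_nu sets_nu by (simp add: random_walk_def random_walk_axioms_def)
  interpret C: cascade "offspring_law f" \<kappa>
  proof (rule cascade.intro)
    show "prob_space (offspring_law f v)" for v
      unfolding offspring_law_def by (rule prob_space_distr[OF measurable_environment_node[OF f]])
    show "sets (offspring_law f v) = sets (PiM UNIV (\<lambda>_. borel))" for v
      by (simp add: offspring_law_def)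
    show "(\<integral>\<^sup>+e. \<integral>\<^sup>+j. ennreal (norm (e j)) \<partial>count_space UNIV \<partial>offspring_law f v) \<le> ennreal \<kappa>" for v
      using abs by (subst nn_integral_offspring[OF f, where g = "\<lambda>z. ennreal (norm z)"]) (simp_all add: \<mu>_def)
  qed (rule mean_v)
  show ?thesis
  proof (intro_locales, rule spinal_cascade_axioms.intro)
    show "(\<integral>\<^sup>+e. \<integral>\<^sup>+j. ennreal (norm (e j) powr \<alpha>) * g (ln (norm (e j))) \<partial>count_space UNIV \<partial>offspring_law f v) = (\<integral>\<^sup>+s. g s \<partial>\<nu>)"
      if [measurable]: "g \<in> borel_measurable borel" for v g
      by (subst nn_integral_offspring[OF f, where g = "\<lambda>z. ennreal (norm z powr \<alpha>) * g (ln (norm z))"])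
         (simp_all add: nu \<mu>_def[symmetric])
    show "distr (offspring_law f v) borel excess = distr (offspring_law f []) borel excess" for v
      by (simp only: excess_v)
    define h where "h z = ennreal (norm z powr \<alpha> * (1 + log_plus (norm z))\<^sup>2)" for z :: complex
    have hm: "h \<in> borel_measurable borel" unfolding h_def[abs_def] by measurable
    have "(\<integral>\<^sup>+z. h z \<partial>distr (offspring_law f []) borel excess) = (\<integral>\<^sup>+e. h (excess e) \<partial>offspring_law f [])"
      by (rule nn_integral_distr) (use hm in simp_all)
    also have "\<dots> = (\<integral>\<^sup>+\<omega>. h (excess (environment f \<omega> [])) \<partial>M)"
      unfolding offspring_law_def
      by (rule nn_integral_distr[OF measurable_environment_node[OF f]])
         (use measurable_compose[OF off_m hm] in simp)
    also have "\<dots> < \<infinity>" using moment by (simp add: h_def excess_def)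
    finally show "(\<integral>\<^sup>+z. ennreal (norm z powr \<alpha> * (1 + log_plus (norm z))\<^sup>2) \<partial>distr (offspring_law f []) borel excess) < \<infinity>"
      by (simp add: h_def)
  qed (use alpha step in auto)
qed

end

lemma level_one_sum: "(\<Sum>\<^sub>\<infinity>v\<in>level 1. node_weight w v) = (\<Sum>\<^sub>\<infinity>j. w [] j)"
proof -
  have "level 1 = (\<lambda>j. [] @ [j]) ` UNIV" by (auto simp: level_def length_Suc_conv)
  then have "(\<Sum>\<^sub>\<infinity>v\<in>level 1. node_weight w v) = (\<Sum>\<^sub>\<infinity>j. node_weight w ([] @ [j]))"
    by (simp only:) (subst infsum_reindex, auto simp: inj_on_def comp_def)
  then show ?thesis by (simp only: node_weight_snoc node_weight_Nil mult_1)
qed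

lemma infsum_generation:
  fixes h :: "complex \<Rightarrow> 'z :: {comm_monoid_add, t2_space}"
  assumes "h 0 = 0"
  shows "(\<Sum>\<^sub>\<infinity>u\<in>generation N \<omega> n. h (weight \<mu> N X l u \<omega>)) = (\<Sum>\<^sub>\<infinity>v\<in>level n. h (weight \<mu> N X l (map Suc v) \<omega>))"
proof -
  have inj: "inj_on (map Suc) (level n)" by (simp add: inj_on_def)
  have "(\<Sum>\<^sub>\<infinity>u\<in>generation N \<omega> n. h (weight \<mu> N X l u \<omega>)) = (\<Sum>\<^sub>\<infinity>u\<in>map Suc ` level n. h (weight \<mu> N X l u \<omega>))"
  proof (rule infsum_cong_neutral)
    fix u assume u: "u \<in> map Suc ` level n - generation N \<omega> n"
    then have "length u = n" by (auto simp: level_def)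
    then show "h (weight \<mu> N X l u \<omega>) = 0" using u assms by (simp add: weight_def)
  next
    fix u assume "u \<in> generation N \<omega> n - map Suc ` level n"
    then show "h (weight \<mu> N X l u \<omega>) = 0"
      using generation_length[of u N \<omega> n] unfolding image_map_Suc_level by simp
  qed simp
  also have "\<dots> = (\<Sum>\<^sub>\<infinity>v\<in>level n. h (weight \<mu> N X l (map Suc v) \<omega>))"
    by (subst infsum_reindex[OF inj]) (simp add: comp_def)
  finally show ?thesis .
qed

theorem theorem2p1:
  fixes M :: "'a measure" and M0 :: "'b measure"
    and N :: "nat list \<Rightarrow> 'a \<Rightarrow> enat"
    and X :: "nat list \<Rightarrow> nat \<Rightarrow> 'a \<Rightarrow> real ^ 'd"
    and N0 :: "'b \<Rightarrow> enat" and X0 :: "nat \<Rightarrow> 'b \<Rightarrow> real ^ 'd"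
    and \<mu> :: "(real ^ 'd) measure"
    and l :: "complex ^ 'd"
    and L :: "nat list \<Rightarrow> 'a \<Rightarrow> complex"
    and Z :: "nat \<Rightarrow> 'a \<Rightarrow> complex"
    and \<alpha> \<epsilon> :: real
  defines "\<mu> \<equiv> intensity M0 N0 X0"
    and "L \<equiv> weight \<mu> N X l"
    and "Z \<equiv> additive_martingale \<mu> N X l"
  assumes brw: "branching_random_walk M M0 N X N0 X0"
    and supercritical: "emeasure \<mu> UNIV > 1"
    and interior_nonempty: "interior (laplace_domain \<mu>) \<noteq> {}"
    and l_in_domain: "l \<in> laplace_domain \<mu>"
    and laplace_nonzero: "laplace \<mu> l \<noteq> 0"
    and Z1_not_one: "measure M {\<omega> \<in> space M. Z 1 \<omega> = 1} < 1"
    and alpha: "1 < \<alpha>" "\<alpha> < 2"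
    and moment_one:
      "(\<integral>\<^sup>+\<omega>. (\<Sum>\<^sub>\<infinity>u\<in>generation N \<omega> 1. ennreal (norm (L u \<omega>) powr \<alpha>)) \<partial>M) = 1"
    and log_moment_integrable:
      "integrable M (\<lambda>\<omega>. \<Sum>\<^sub>\<infinity>u\<in>generation N \<omega> 1. norm (L u \<omega>) powr \<alpha> * ln (norm (L u \<omega>)))"
    and log_moment_nonpos:
      "(\<integral>\<omega>. (\<Sum>\<^sub>\<infinity>u\<in>generation N \<omega> 1. norm (L u \<omega>) powr \<alpha> * ln (norm (L u \<omega>))) \<partial>M) \<le> 0"
    and epsilon: "\<epsilon> > 0"
    and Z1_moment:
      "(\<integral>\<^sup>+\<omega>. ennreal (norm (Z 1 \<omega>) powr \<alpha> * log_plus (norm (Z 1 \<omega>)) powr (2 + \<epsilon>)) \<partial>M) < \<infinity>"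
  shows "\<exists>Zlim \<in> borel_measurable M.
           (AE \<omega> in M. (\<lambda>n. Z n \<omega>) \<longlonglongrightarrow> Zlim \<omega>) \<and>
           (\<forall>p. 0 < p \<and> p < \<alpha> \<longrightarrow> converges_in_Lp M p Z Zlim) \<and>
           \<not> (\<exists>c. AE \<omega> in M. Zlim \<omega> = c)"
proof -
  interpret B: branching_random_walk M M0 N X N0 X0 by (rule brw)
  define m where "m = laplace \<mu> l"
  define f where "f y = exp (- cpairing l y) / m" for y
  define w where "w = B.environment f"
  have m0: "m \<noteq> 0" using laplace_nonzero by (simp add: m_def)
  have fm [measurable]: "f \<in> borel_measurable borel" unfolding f_def[abs_def] by measurable
  have f0: "f y \<noteq> 0" for y using m0 by (simp add: f_def)
  have wm [measurable]: "w \<in> M \<rightarrow>\<^sub>M PiM UNIV (B.offspring_law f)"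
    unfolding w_def by (rule B.measurable_environment[OF fm])
  have wroot: "(\<lambda>\<omega>. w \<omega> []) \<in> M \<rightarrow>\<^sub>M PiM UNIV (\<lambda>_. borel)"
    unfolding w_def by (rule B.measurable_environment_node[OF fm])
  have wj [measurable]: "(\<lambda>\<omega>. w \<omega> [] j) \<in> borel_measurable M" for j
    by (rule measurable_compose[OF wroot measurable_component_singleton]) simp
  have wlaw: "distr M (PiM UNIV (B.offspring_law f)) w = PiM UNIV (B.offspring_law f)"
    unfolding w_def by (rule B.environment_law[OF fm])
  have L_node: "L (map Suc v) \<omega> = node_weight (w \<omega>) v" for v \<omega>
    unfolding L_def w_def B.environment_def[abs_def] f_def m_def by (rule weight_eq_node_weight)
  have reindex: "(\<Sum>\<^sub>\<infinity>u\<in>generation N \<omega> n. L u \<omega>) = (\<Sum>\<^sub>\<infinity>v\<in>level n. node_weight (w \<omega>) v)" for n \<omega>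
    unfolding L_node[symmetric] unfolding L_def by (rule infsum_generation[where h = "\<lambda>z. z"]) simp
  have Z_level: "Z n \<omega> = cascade.level_sum n (w \<omega>)" if "cascade (B.offspring_law f) \<kappa>" for n \<omega> \<kappa>
    unfolding Z_def additive_martingale_def cascade.level_sum_def[OF that] L_def[symmetric] by (rule reindex)
  have Z1: "Z 1 \<omega> = (\<Sum>\<^sub>\<infinity>j. w \<omega> [] j)" for \<omega>
    unfolding Z_def additive_martingale_def level_one_sum[symmetric] L_def[symmetric] by (rule reindex)
  have Z1m [measurable]: "Z 1 \<in> borel_measurable M"
    unfolding Z1[abs_def] by (rule measurable_infsum) auto
  obtain \<theta> \<eta> :: "real ^ 'd" where l: "l = (\<chi> k. Complex (\<theta> $ k) (\<eta> $ k))"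
    and \<theta>: "(\<integral>\<^sup>+y. ennreal (exp (- (\<theta> \<bullet> y))) \<partial>\<mu>) < \<infinity>"
    using l_in_domain by (auto simp: laplace_domain_def)
  have sets_mu [measurable_cong]: "sets \<mu> = sets borel"
    unfolding \<mu>_def by (rule enumerated_process.sets_intensity[OF B.enumerated_reference])
  have nf: "norm (f y) = exp (- (\<theta> \<bullet> y)) * (1 / norm m)" for y
    unfolding f_def norm_divide norm_exp_eq_Re by (simp add: l cpairing_def inner_vec_def)
  have "(\<integral>\<^sup>+y. ennreal (norm (f y)) \<partial>\<mu>) = (\<integral>\<^sup>+y. ennreal (exp (- (\<theta> \<bullet> y))) \<partial>\<mu>) * ennreal (1 / norm m)"
    unfolding nf by (subst ennreal_mult) (simp_all add: nn_integral_multc)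
  also have "\<dots> < \<infinity>" using \<theta> by (simp add: ennreal_mult_less_top)
  finally have fin: "(\<integral>\<^sup>+y. ennreal (norm (f y)) \<partial>\<mu>) < \<infinity>" .
  define \<kappa> where "\<kappa> = enn2real (\<integral>\<^sup>+y. ennreal (norm (f y)) \<partial>\<mu>)"
  have abs: "(\<integral>\<^sup>+y. ennreal (norm (f y)) \<partial>\<mu>) \<le> ennreal \<kappa>"
    using fin by (simp add: \<kappa>_def)
  have mean: "(\<integral>y. f y \<partial>\<mu>) = 1"
    using m0 unfolding f_def by (simp add: m_def laplace_def)
  have one: "(\<integral>\<^sup>+y. ennreal (norm (f y) powr \<alpha>) \<partial>\<mu>) = 1"
  proof -
    define g where "g z = ennreal (norm z powr \<alpha>)" for z :: complex
    have gm: "g \<in> borel_measurable borel" unfolding g_def[abs_def] by measurable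
    have g0: "g 0 = 0" by (simp add: g_def)
    have "(\<Sum>\<^sub>\<infinity>u\<in>generation N \<omega> 1. g (L u \<omega>)) = (\<integral>\<^sup>+j. g (w \<omega> [] j) \<partial>count_space UNIV)" for \<omega>
    proof -
      have lev: "level 1 = (\<lambda>j. [] @ [j]) ` UNIV" by (auto simp: level_def length_Suc_conv)
      have "(\<Sum>\<^sub>\<infinity>u\<in>generation N \<omega> 1. g (L u \<omega>)) = (\<Sum>\<^sub>\<infinity>j. g (node_weight (w \<omega>) ([] @ [j])))"
        unfolding L_def infsum_generation[where h = g, OF g0] unfolding L_def[symmetric] L_node lev
        by (subst infsum_reindex) (simp_all add: inj_on_def comp_def)
      also have "\<dots> = (\<Sum>\<^sub>\<infinity>j. g (w \<omega> [] j))" by (simp only: node_weight_snoc node_weight_Nil mult_1)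
      finally show ?thesis by (simp add: infsum_ennreal_eq_nn_integral)
    qed
    then have "(\<integral>\<^sup>+\<omega>. \<integral>\<^sup>+j. g (w \<omega> [] j) \<partial>count_space UNIV \<partial>M) = 1"
      using moment_one by (simp add: g_def)
    moreover have "(\<integral>\<^sup>+e. \<integral>\<^sup>+j. g (e j) \<partial>count_space UNIV \<partial>B.offspring_law f [])
      = (\<integral>\<^sup>+\<omega>. \<integral>\<^sup>+j. g (w \<omega> [] j) \<partial>count_space UNIV \<partial>M)"
    proof -
      have gi: "(\<lambda>e. \<integral>\<^sup>+j. g (e j) \<partial>count_space UNIV) \<in> borel_measurable (PiM (UNIV :: nat set) (\<lambda>_. borel))"
        using gm by (intro measurable_nn_integral_count) simp_all
      show ?thesis
        unfolding B.offspring_law_def w_def[symmetric] by (rule nn_integral_distr[OF wroot]) (use gi in simp)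
    qed
    moreover have "(\<integral>\<^sup>+e. \<integral>\<^sup>+j. g (e j) \<partial>count_space UNIV \<partial>B.offspring_law f []) = (\<integral>\<^sup>+y. g (f y) \<partial>\<mu>)"
      unfolding \<mu>_def by (rule B.nn_integral_offspring[OF fm gm g0])
    ultimately show ?thesis by (simp add: g_def)
  qed
  have moment: "(\<integral>\<^sup>+\<omega>. ennreal (norm ((\<Sum>\<^sub>\<infinity>j. w \<omega> [] j) - 1) powr \<alpha> * (1 + log_plus (norm ((\<Sum>\<^sub>\<infinity>j. w \<omega> [] j) - 1)))\<^sup>2) \<partial>M) < \<infinity>"
  proof -
    define c where "c = 4 powr \<alpha> * (1 + log_plus 4)\<^sup>2"
    define d where "d = 9 * 2 powr \<alpha>"
    have cd: "c \<ge> 0" "d \<ge> 0" by (simp_all add: c_def d_def)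
    have "(\<integral>\<^sup>+\<omega>. ennreal (norm (Z 1 \<omega> - 1) powr \<alpha> * (1 + log_plus (norm (Z 1 \<omega> - 1)))\<^sup>2) \<partial>M)
      \<le> (\<integral>\<^sup>+\<omega>. ennreal c + ennreal d * ennreal (norm (Z 1 \<omega>) powr \<alpha> * log_plus (norm (Z 1 \<omega>)) powr (2 + \<epsilon>)) \<partial>M)"
    proof (intro nn_integral_mono)
      fix \<omega>
      have "norm (Z 1 \<omega> - 1) powr \<alpha> * (1 + log_plus (norm (Z 1 \<omega> - 1)))\<^sup>2
        \<le> c + d * (norm (Z 1 \<omega>) powr \<alpha> * log_plus (norm (Z 1 \<omega>)) powr (2 + \<epsilon>))"
        unfolding c_def d_def using alpha epsilon by (intro excess_moment_bound) auto
      then show "ennreal (norm (Z 1 \<omega> - 1) powr \<alpha> * (1 + log_plus (norm (Z 1 \<omega> - 1)))\<^sup>2)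
        \<le> ennreal c + ennreal d * ennreal (norm (Z 1 \<omega>) powr \<alpha> * log_plus (norm (Z 1 \<omega>)) powr (2 + \<epsilon>))"
        using cd by (simp add: ennreal_mult[symmetric] ennreal_plus[symmetric] ennreal_leI del: ennreal_plus)
    qed
    also have "\<dots> = ennreal c + ennreal d * (\<integral>\<^sup>+\<omega>. ennreal (norm (Z 1 \<omega>) powr \<alpha> * log_plus (norm (Z 1 \<omega>)) powr (2 + \<epsilon>)) \<partial>M)"
    proof -
      have Gm: "(\<lambda>\<omega>. ennreal (norm (Z 1 \<omega>) powr \<alpha> * log_plus (norm (Z 1 \<omega>)) powr (2 + \<epsilon>))) \<in> borel_measurable M"
        by measurable
      show ?thesis
        by (subst nn_integral_add[OF _ borel_measurable_times_ennreal[OF _ Gm]], simp, simp, subst nn_integral_cmult[OF Gm])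
           (simp add: B.emeasure_space_1)
    qed
    also have "\<dots> < \<infinity>" using Z1_moment by (simp add: ennreal_mult_less_top)
    finally show ?thesis unfolding Z1 .
  qed
  interpret C: spinal_cascade "B.offspring_law f" \<kappa>
      "distr (density \<mu> (\<lambda>y. ennreal (norm (f y) powr \<alpha>))) borel (\<lambda>y. ln (norm (f y)))" \<alpha>
      "distr (B.offspring_law f []) borel excess"
    unfolding \<mu>_def
    by (rule B.spinal_cascade_offspring[OF fm f0 alpha])
       (use abs mean one supercritical moment in \<open>simp_all add: \<mu>_def w_def\<close>)
  have Z_eq: "Z n = (\<lambda>\<omega>. C.level_sum n (w \<omega>))" for n
    using Z_level[OF C.cascade_axioms] by (simp add: fun_eq_iff)
  define Zlim where "Zlim \<omega> = C.limit_sum (w \<omega>)" for \<omega>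
  have Zlim_m: "Zlim \<in> borel_measurable M"
    unfolding Zlim_def[abs_def] by (rule measurable_compose[OF wm C.measurable_limit_sum])
  have Zm: "Z n \<in> borel_measurable M" for n
    unfolding Z_eq by (rule measurable_compose[OF wm C.measurable_level_sum])
  have transfer: "(\<integral>\<^sup>+v. h v \<partial>C.P) = (\<integral>\<^sup>+\<omega>. h (w \<omega>) \<partial>M)" if "h \<in> borel_measurable C.P" for h
    by (subst wlaw[symmetric]) (rule nn_integral_distr[OF wm], use that in simp)
  show ?thesis
  proof (intro bexI[OF _ Zlim_m] conjI allI impI)
    have "AE v in distr M C.P w. (\<lambda>n. C.level_sum n v) \<longlonglongrightarrow> C.limit_sum v"
      unfolding wlaw by (rule C.AE_tendsto_limit_sum)
    then show "AE \<omega> in M. (\<lambda>n. Z n \<omega>) \<longlonglongrightarrow> Zlim \<omega>"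
      unfolding Z_eq Zlim_def by (rule AE_distrD[OF wm])
  next
    fix p :: real assume p: "0 < p \<and> p < \<alpha>"
    have "converges_in_Lp C.P p C.level_sum C.limit_sum"
      using p by (intro C.level_sum_converges_in_Lp) auto
    then show "converges_in_Lp M p Z Zlim"
      using Zm Zlim_m unfolding converges_in_Lp_def in_Lp_def Zlim_def[abs_def]
      by (simp add: Z_eq transfer)
  next
    show "\<not> (\<exists>c. AE \<omega> in M. Zlim \<omega> = c)"
    proof
      assume "\<exists>c. AE \<omega> in M. Zlim \<omega> = c"
      then obtain c where "AE \<omega> in M. C.limit_sum (w \<omega>) = c" by (auto simp: Zlim_def)
      then have "AE v in distr M C.P w. C.limit_sum v = c"
      proof (subst AE_distr_iff[OF wm])
        show "{v \<in> space C.P. C.limit_sum v = c} \<in> sets C.P"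
          using measurable_sets[OF C.measurable_limit_sum, of "{c}"] by (simp add: vimage_def)
      qed
      then have deg: "\<exists>c. AE v in C.P. C.limit_sum v = c" unfolding wlaw by blast
      have "\<not> (AE e in B.offspring_law f []. (\<Sum>\<^sub>\<infinity>j. e j) = 1)"
      proof
        assume "AE e in B.offspring_law f []. (\<Sum>\<^sub>\<infinity>j. e j) = 1"
        then have "AE \<omega> in M. Z 1 \<omega> = 1"
          unfolding B.offspring_law_def w_def[symmetric] Z1 by (rule AE_distrD[OF wroot])
        moreover have "{\<omega> \<in> space M. Z 1 \<omega> = 1} \<in> sets M" by measurable
        ultimately have "measure M {\<omega> \<in> space M. Z 1 \<omega> = 1} = 1"
          by (simp only: B.prob_Collect_eq_1)
        then show False using Z1_not_one by simp
      qed
      then show False using C.limit_sum_nondegenerate deg by blast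
    qed
  qed
qed

end
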